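(* Let $k\ge2$, let $\chi_1,\chi_2$ be primitive non-trivial Dirichlet characters with conductors $q_1,q_2$ and $\chi_1\chi_2(-1)=(-1)^k$, and let $N=q_1q_2$. Let $\gamma=\begin{pmatrix}a&b\\ cN&d\end{pmatrix}\in\Gamma_0(N)$ and $\gamma'=\begin{pmatrix}d&-c\\ -bN&a\end{pmatrix}\in\Gamma_0(N)$. Then for every $\mathfrak a\in\mathcal C\setminus\{\infty\}$, $$\begin{aligned} &\widehat S_{\chi_1,\chi_2,k}|_{2-k}\gamma'(\mathfrak a)-\psi(\gamma')\widehat S_{\chi_1,\chi_2,k}(\mathfrak a)\\ &\quad+(-1)^k\tau(\overline{\chi_1})(k-1)\Big(\psi(\gamma')\phi_{\chi_1,\chi_2,k}(\gamma'^{-1},1,-\mathfrak a)-\psi(\gamma)\,\Phi_1|_{2-k}\omega(\mathfrak a)\Big)\\ &=R_{\chi_1,\chi_2,k}\frac{\tau(\overline{\chi_1})}{\tau(\overline{\chi_2})}\Big(\widehat S_{\chi_2,\chi_1,k}|_{2-k}\gamma'(\mathfrak a)-\widehat S_{\chi_2,\chi_1,k}(\mathfrak a)\Big)\\ &\quad+(-1)^k\tau(\overline{\chi_1})(k-1)R_{\chi_1,\chi_2,k}\Big(\phi_{\chi_2,\chi_1,k}(\omega^{-1},1,-\mathfrak a)-\Phi_2|_{2-k}\gamma'(\mathfrak a)\Big)\\ &\quad+(1-\psi(\gamma))\,\widehat S_{\chi_1,\chi_2,k}|_{2-k}\omega(\mathfrak a), \end{aligned}$$ where $\Phi_1(\mathfrak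 b)=\phi_{\chi_1,\chi_2,k}(\gamma^{-1},1,-\mathfrak b)$, $\Phi_2(\mathfrak b)=\phi_{\chi_2,\chi_1,k}(\omega^{-1},1,-\mathfrak b)$, and $R_{\chi_1,\chi_2,k}=\chi_1(-1)\frac{\tau(\chi_1)}{\tau(\chi_2)}(q_2/q_1)^{k/2}$.
   Context: Notation: $e(z)=\exp(2\pi iz)$, $\tau(\chi)$ the Gauss sum, $j(g,z)=g_{21}z+g_{22}$ for $g\in\mathrm{SL}_2(\mathbb R)$; $\psi(g)=\chi_1(g_{22})\overline{\chi_2}(g_{22})$ for $g\in\Gamma_0(N)$. $E_{\chi_1,\chi_2,k}(z)=2\sum_{M\ge1}\sum_{A\mid M}\chi_1(A)\overline{\chi_2}(M/A)(M/A)^{k-1}e(Mz)$ on the upper half plane, and $E_{\chi_2,\chi_1,k}$ is defined with the roles of $\chi_1,\chi_2$ exchanged. $P_{k-2}(z;X,Y)=(Xz+Y)^{k-2}$. The Fricke involution is $\omega=\begin{pmatrix}0&-1/\sqrt N\\ \sqrt N&0\end{pmatrix}$. Let $\mathcal C=(\Gamma_0(N))(\infty)\cup(\omega\Gamma_0(N))(\infty)\subseteq\mathbb P^1(\mathbb Q)$ (the cusps $g\infty$ for $g\in\Gamma_0(N)\cup\omega\Gamma_0(N)$). For $g\in\Gamma_0(N)\cup\omega\Gamma_0(N)$ and $X,Y\in\mathbb C$ let $\phi_{\chi_1,\chi_2,k}(g,X,Y)=\int_\infty^{g\infty}E_{\chi_1,\chi_2,k}(z)P_{k-2}(z;X,Y)dz$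 (and similarly $\phi_{\chi_2,\chi_1,k}$ with $E_{\chi_2,\chi_1,k}$). For $\mathfrak a\in\mathcal C$ let $\widehat S_{\chi_1,\chi_2,k}(\infty)=0$ and $\widehat S_{\chi_1,\chi_2,k}(\mathfrak a)=(-1)^k\tau(\overline{\chi_1})(k-1)\int_\infty^{\mathfrak a}E_{\chi_1,\chi_2,k}(z)P_{k-2}(z;1,-\mathfrak a)dz$ for $\mathfrak a\ne\infty$; $\widehat S_{\chi_2,\chi_1,k}$ is defined likewise with $\tau(\overline{\chi_2})$ and $E_{\chi_2,\chi_1,k}$. For a function $F$ on $\mathcal C$ and $g\in\{\gamma',\omega\}$, $F|_{2-k}g(\mathfrak a)=j(g,\mathfrak a)^{k-2}F(g\mathfrak a)$.
   Formalization: Where ω𝔞=∞ (i.e. 𝔞=0) or γ'𝔞=∞, the value Φ₁(∞) or Φ₂(∞) is undefined; there the slashed term is read as its polynomial extension in 𝔞, namely φ(h,0,−(g₁₁𝔞+g₁₂)) with g=ω, h=γ⁻¹ or g=γ', h=ω⁻¹. All other points are literal. *)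

theory Defs
  imports "HOL-Analysis.Analysis"
begin

definition dchar :: "nat \<Rightarrow> (int \<Rightarrow> complex) \<Rightarrow> bool" where
  "dchar q ch \<longleftrightarrow> q \<ge> 1 \<and>
     (\<forall>m n. ch (m * n) = ch m * ch n) \<and>
     (\<forall>n. ch (n + int q) = ch n) \<and>
     ch 1 = 1 \<and>
     (\<forall>n. ch n \<noteq> 0 \<longleftrightarrow> coprime n (int q))"

definition induced_from :: "nat \<Rightarrow> nat \<Rightarrow> (int \<Rightarrow> complex) \<Rightarrow> bool" where
  "induced_from d q ch \<longleftrightarrow>
     (\<exists>ch'. dchar d ch' \<and> (\<forall>n. coprime n (int q) \<longrightarrow> ch n = ch' n))"

definition primitive_dchar :: "nat \<Rightarrow> (int \<Rightarrow> complex) \<Rightarrow> bool" where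
  "primitive_dchar q ch \<longleftrightarrow> dchar q ch \<and>
     (\<forall>d. d dvd q \<and> d \<noteq> q \<longrightarrow> \<not> induced_from d q ch)"

definition nontrivial_dchar :: "nat \<Rightarrow> (int \<Rightarrow> complex) \<Rightarrow> bool" where
  "nontrivial_dchar q ch \<longleftrightarrow> (\<exists>n. coprime n (int q) \<and> ch n \<noteq> 1)"

definition ee :: "complex \<Rightarrow> complex" where
  "ee z = exp (2 * complex_of_real pi * \<i> * z)"

definition gauss :: "nat \<Rightarrow> (int \<Rightarrow> complex) \<Rightarrow> complex" where
  "gauss q ch = (\<Sum>n<q. ch (int n) * ee (of_nat n / of_nat q))"

definition cchar :: "(int \<Rightarrow> complex) \<Rightarrow> (int \<Rightarrow> complex)" where
  "cchar ch = (\<lambda>n. cnj (ch n))"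

definition eis :: "(int \<Rightarrow> complex) \<Rightarrow> (int \<Rightarrow> complex) \<Rightarrow> nat \<Rightarrow> complex \<Rightarrow> complex" where
  "eis ch1 ch2 k z = 2 * (\<Sum>m. let M = Suc m in
      (\<Sum>A\<in>{A. A dvd M}. ch1 (int A) * cnj (ch2 (int (M div A))) * of_nat (M div A) ^ (k - 1))
      * ee (of_nat M * z))"

record m2 = m11 :: real  m12 :: real  m21 :: real  m22 :: real

definition mmul :: "m2 \<Rightarrow> m2 \<Rightarrow> m2" where
  "mmul g h = \<lparr>m11 = m11 g * m11 h + m12 g * m21 h, m12 = m11 g * m12 h + m12 g * m22 h,
               m21 = m21 g * m11 h + m22 g * m21 h, m22 = m21 g * m12 h + m22 g * m22 h\<rparr>"

definition minv :: "m2 \<Rightarrow> m2" where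
  "minv g = \<lparr>m11 = m22 g, m12 = - m12 g, m21 = - m21 g, m22 = m11 g\<rparr>"

definition mk :: "int \<Rightarrow> int \<Rightarrow> int \<Rightarrow> int \<Rightarrow> m2" where
  "mk a b c d = \<lparr>m11 = of_int a, m12 = of_int b, m21 = of_int c, m22 = of_int d\<rparr>"

definition Gamma0 :: "nat \<Rightarrow> m2 set" where
  "Gamma0 N = {mk a b (int N * c) d | a b c d. a * d - b * (int N * c) = 1}"

definition omega :: "nat \<Rightarrow> m2" where
  "omega N = \<lparr>m11 = 0, m12 = - 1 / sqrt (real N), m21 = sqrt (real N), m22 = 0\<rparr>"

text \<open>Points of P^1(R): the cusp at infinity and finite points.\<close>
datatype cusp = Cinf | Cfin real

definition act :: "m2 \<Rightarrow> cusp \<Rightarrow> cusp" where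
  "act g p = (case p of
      Cinf \<Rightarrow> (if m21 g = 0 then Cinf else Cfin (m11 g / m21 g))
    | Cfin x \<Rightarrow> (if m21 g * x + m22 g = 0 then Cinf
                 else Cfin ((m11 g * x + m12 g) / (m21 g * x + m22 g))))"

definition jfac :: "m2 \<Rightarrow> real \<Rightarrow> real" where
  "jfac g x = m21 g * x + m22 g"

definition cusps :: "nat \<Rightarrow> cusp set" where
  "cusps N = {act g Cinf | g. g \<in> Gamma0 N \<or> (\<exists>h\<in>Gamma0 N. g = mmul (omega N) h)}"

text \<open>Integral from i infinity to the finite cusp x along the vertical path
  z = x + i t, t from infinity down to 0; the integral to infinity is 0.\<close>
definition cusp_int :: "(complex \<Rightarrow> complex) \<Rightarrow> cusp \<Rightarrow> complex" where
  "cusp_int f p = (case p of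
      Cinf \<Rightarrow> 0
    | Cfin x \<Rightarrow> - \<i> * integral {0<..} (\<lambda>t::real. f (complex_of_real x + \<i> * complex_of_real t)))"

definition phi :: "(complex \<Rightarrow> complex) \<Rightarrow> nat \<Rightarrow> m2 \<Rightarrow> complex \<Rightarrow> complex \<Rightarrow> complex" where
  "phi E k g X Y = cusp_int (\<lambda>z. E z * (X * z + Y) ^ (k - 2)) (act g Cinf)"

definition S_hat :: "(complex \<Rightarrow> complex) \<Rightarrow> complex \<Rightarrow> nat \<Rightarrow> cusp \<Rightarrow> complex" where
  "S_hat E tau k p = (case p of
      Cinf \<Rightarrow> 0
    | Cfin a \<Rightarrow> (-1) ^ k * tau * of_nat (k - 1) *
        cusp_int (\<lambda>z. E z * (z - complex_of_real a) ^ (k - 2)) (Cfin a))"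

definition slash :: "nat \<Rightarrow> m2 \<Rightarrow> (cusp \<Rightarrow> complex) \<Rightarrow> real \<Rightarrow> complex" where
  "slash k g F x = complex_of_real (jfac g x) ^ (k - 2) * F (act g (Cfin x))"

text \<open>Slash action on a cusp function of the form b \<mapsto> P(1, -b), where P is
  homogeneous of degree k-2 (here P = phi(h,.,.)).  When g a is finite this is
  literally j(g,a)^(k-2) P(1, -g a); when g a = infinity (j(g,a) = 0) it is the
  homogeneous value P(j(g,a), -(g11 a + g12)) = P(0, -(g11 a + g12)).\<close>
definition slashP :: "nat \<Rightarrow> m2 \<Rightarrow> (complex \<Rightarrow> complex \<Rightarrow> complex) \<Rightarrow> real \<Rightarrow> complex" where
  "slashP k g P x = (case act g (Cfin x) of
      Cfin y \<Rightarrow> complex_of_real (jfac g x) ^ (k - 2) * P 1 (- complex_of_real y)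
    | Cinf \<Rightarrow> P 0 (- complex_of_real (m11 g * x + m12 g)))"

definition psi :: "(int \<Rightarrow> complex) \<Rightarrow> (int \<Rightarrow> complex) \<Rightarrow> int \<Rightarrow> complex" where
  "psi ch1 ch2 d = ch1 d * cnj (ch2 d)"

definition Rconst :: "(int \<Rightarrow> complex) \<Rightarrow> (int \<Rightarrow> complex) \<Rightarrow> nat \<Rightarrow> nat \<Rightarrow> nat \<Rightarrow> complex" where
  "Rconst ch1 ch2 q1 q2 k = ch1 (-1) * gauss q1 ch1 / gauss q2 ch2 *
      complex_of_real ((real q2 / real q1) powr (real k / 2))"

end

theory Submission
  imports Defs "HOL-Complex_Analysis.Complex_Analysis" "HOL-Number_Theory.Residues"
begin

text \<open>
  The Eisenstein series are modular: \<open>E\<^sub>1\<^sub>2(\<gamma> z) = \<psi>(\<gamma>) j(\<gamma>, z)\<^sup>k E\<^sub>1\<^sub>2(z)\<close> and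
  \<open>E\<^sub>1\<^sub>2(\<omega> z) = R j(\<omega>, z)\<^sup>k E\<^sub>2\<^sub>1(z)\<close>. Substituting in the period integrals and writing
  \<open>J\<^sub>i\<^sub>j(p)\<close> for the integral of \<open>E\<^sub>i\<^sub>j(z) (z - x)\<^sup>k\<^sup>-\<^sup>2\<close> from \<open>\<infinity>\<close> to the cusp \<open>p\<close>, every term becomes a
  combination of values of \<open>J\<^sub>1\<^sub>2\<close> and \<open>J\<^sub>2\<^sub>1\<close>; the identity then only uses \<open>\<gamma> \<omega> = \<omega> \<gamma>'\<close> and
  \<open>\<psi>\<^sub>2\<^sub>1(\<gamma>') = \<psi>\<^sub>1\<^sub>2(\<gamma>)\<close>.

  Modularity for all weights \<open>k \<ge> 2\<close> is obtained from the differences of lattice sums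
  \<open>\<Sum>((m + x) \<tau> + n + y)\<^sup>-\<^sup>k - ((m + x') \<tau> + n + y')\<^sup>-\<^sup>k\<close>, which converge absolutely, are doubly periodic
  in \<open>(x, y)\<close> and are equivariant under \<open>SL\<^sub>2(\<int>)\<close>. Summed against \<open>\<chi>\<^sub>1(r) \<chi>\<^sub>2(s)\<close> at the points
  \<open>(r/q\<^sub>1, s/q\<^sub>2)\<close> the reference point drops out, and the Lipschitz formula together with the
  twisting property of Gauss sums identifies the result with a multiple of the Eisenstein series.

  Convergence at a cusp \<open>g \<infinity>\<close> and path independence are treated through a primitive of the
  integrand: after composition with \<open>g\<close> its derivative decays exponentially at \<open>\<infinity>\<close>, so the
  primitive has a limit along all vertical lines.
\<close>

section \<open>Dirichlet characters and Gauss sums\<close>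

text \<open>The reference point drops out because a non-trivial character sums to zero over a
  residue system; this replaces Hecke's convergence factor in weight 2, where the plain lattice sum
  is not absolutely convergent. The points (r/q1, s/q2) are paired with the variable q1 z for the
  following reason: conjugating \<gamma> by diag(q1, 1) gives a matrix with off-diagonal entries b
  q1 and c q2, which sends (r/q1, s/q2) to (a r/q1, d s/q2) up to integer translations, so
  \<Gamma>0(N) acts on the weights through character values alone. E12 is not a cusp form, hence its
  period integrals are controlled only at cusps where it decays. It has no constant term at
  \<infinity>, and \<omega> exchanges E12 and E21 up to a factor, so both series decay on the orbits
  of \<infinity> and of \<omega> \<infinity>; these orbits make up the set C.\<close>

lemma ee_add: "ee (z + w) = ee z * ee w"
  by (simp add: ee_def distrib_left exp_add)

lemma ee_of_int [simp]: "ee (of_int n) = 1"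
proof -
  have "ee (of_int n) = exp (2 * complex_of_real pi * \<i> * of_int n)" by (simp add: ee_def)
  also have "\<dots> = 1" by (subst exp_eq_1) (auto intro!: exI[of _ n])
  finally show ?thesis .
qed

lemma ee_power: "ee z ^ n = ee (of_nat n * z)"
  by (simp add: ee_def exp_of_nat_mult [symmetric] mult_ac)

lemma norm_ee: "cmod (ee z) = exp (- 2 * pi * Im z)"
  by (simp add: ee_def)

lemma dchar_pos: "dchar q ch \<Longrightarrow> q \<ge> 1"
  and dchar_mult: "dchar q ch \<Longrightarrow> ch (m * n) = ch m * ch n"
  and dchar_1: "dchar q ch \<Longrightarrow> ch 1 = 1"
  and dchar_nonzero_iff: "dchar q ch \<Longrightarrow> ch n \<noteq> 0 \<longleftrightarrow> coprime n (int q)"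
  unfolding dchar_def by auto

lemma periodic_int_cong:
  fixes h :: "int \<Rightarrow> 'a"
  assumes per: "\<And>n. h (n + q) = h n" and "[m = n] (mod q)"
  shows "h m = h n"
proof -
  have nat: "h (n + q * int j) = h n" for n j
    by (induction j) (simp_all add: algebra_simps, metis per add.commute add.left_commute)
  have int: "h (n + q * j) = h n" for n j
    using nat[of n "nat j"] nat[of "n + q * j" "nat (- j)"] by (cases "j \<ge> 0") auto
  obtain j where "m = n + q * j"
    using assms(2) by (metis cong_iff_lin cong_sym)
  then show ?thesis using int by simp
qed

lemma dchar_cong:
  assumes "dchar q ch" "[m = n] (mod int q)"
  shows "ch m = ch n"
  using assms periodic_int_cong[of ch "int q" m n] by (auto simp: dchar_def)

lemma dchar_inverse_exists:
  assumes "dchar q ch" "coprime n (int q)"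
  obtains m where "[n * m = 1] (mod int q)" "ch n * ch m = 1" "coprime m (int q)"
proof -
  obtain m where m: "[n * m = 1] (mod int q)"
    using cong_solve_coprime_int[OF assms(2)] by auto
  have "ch n * ch m = 1"
    using dchar_cong[OF assms(1) m] dchar_mult[OF assms(1)] dchar_1[OF assms(1)] by simp
  moreover from this have "coprime m (int q)"
    using dchar_nonzero_iff[OF assms(1), of m] by auto
  ultimately show ?thesis using m that by blast
qed

text \<open>By Euler's theorem n^totient(q) is congruent to 1 modulo q, so \<open>ch n\<close> is a
  root of unity.\<close>

lemma dchar_norm:
  assumes "dchar q ch" "coprime n (int q)"
  shows "cmod (ch n) = 1"
proof -
  let ?m = "nat (n mod int q)"
  have q: "q > 0" using dchar_pos[OF assms(1)] by simp
  have m: "[int ?m = n] (mod int q)" using q by (simp add: cong_def)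
  have "coprime (int ?m) (int q)" using m assms(2) by (metis cong_imp_coprime cong_sym)
  then have "[?m ^ totient q = 1] (mod q)" by (intro euler_theorem) (metis coprime_int_iff)
  then have "[int ?m ^ totient q = 1] (mod int q)"
    by (metis cong_int_iff of_nat_1 of_nat_power)
  then have "ch (int ?m ^ totient q) = 1"
    using dchar_cong[OF assms(1)] dchar_1[OF assms(1)] by metis
  moreover have "ch (l ^ j) = ch l ^ j" for l j
    by (induction j) (simp_all add: dchar_mult[OF assms(1)] dchar_1[OF assms(1)])
  ultimately have "ch n ^ totient q = 1" using dchar_cong[OF assms(1) m] by simp
  then have "cmod (ch n) ^ totient q = 1" by (metis norm_one norm_power)
  moreover have "totient q > 0" using q by simp
  ultimately show ?thesis using power_eq_iff_eq_base[of "totient q" "cmod (ch n)" 1] by auto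
qed

lemma dchar_norm_le:
  assumes "dchar q ch"
  shows "cmod (ch n) \<le> 1"
  using dchar_norm[OF assms, of n] dchar_nonzero_iff[OF assms, of n] by (cases "coprime n (int q)") auto

lemma dchar_cnj_mult:
  assumes "dchar q ch" "coprime n (int q)"
  shows "cnj (ch n) * ch n = 1"
  using dchar_norm[OF assms] by (simp add: complex_norm_square[symmetric] mult.commute)

section \<open>Conjugate characters, and primitivity in terms of units\<close>

lemma dchar_cchar: "dchar q ch \<Longrightarrow> dchar q (cchar ch)"
  unfolding dchar_def cchar_def by simp

lemma induced_from_cchar: "induced_from d q (cchar ch) \<Longrightarrow> induced_from d q ch"
  unfolding induced_from_def
proof (elim exE conjE)
  fix ch' assume "dchar d ch'" "\<forall>n. coprime n (int q) \<longrightarrow> cchar ch n = ch' n"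
  then show "\<exists>ch'. dchar d ch' \<and> (\<forall>n. coprime n (int q) \<longrightarrow> ch n = ch' n)"
    by (intro exI[of _ "cchar ch'"]) (auto simp: dchar_cchar, metis cchar_def complex_cnj_cnj)
qed

text \<open>The Gauss sum of the conjugate of \<chi>2 is a denominator in the statement; its
  non-vanishing is deduced from primitivity of the conjugate character.\<close>

lemma primitive_cchar: "primitive_dchar q ch \<Longrightarrow> primitive_dchar q (cchar ch)"
  unfolding primitive_dchar_def using dchar_cchar induced_from_cchar by blast

text \<open>The lift is n + d t, with t the product of the primes of q that do not divide n: every
  prime of q divides exactly one of n and d t.\<close>

lemma coprime_lift:
  fixes n :: int
  assumes "coprime n (int d)" "d dvd q" "q \<ge> 1"
  obtains m where "coprime m (int q)" "[m = n] (mod int d)"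
proof -
  define t where "t = \<Prod>{p \<in> prime_factors q. \<not> int p dvd n}"
  define m where "m = n + int d * int t"
  have "coprime m (int q)"
  proof (rule ccontr)
    assume "\<not> coprime m (int q)"
    then obtain p where p: "prime p" "p dvd m" "p dvd int q"
      using prime_divisor_exists[of "gcd m (int q)"] assms by (auto simp: coprime_iff_gcd_eq_1)
    obtain p' where p': "p = int p'" using p by (metis prime_int_nat_transfer zero_le_imp_eq_int prime_ge_0_int)
    have pf: "prime p'" "p' dvd q" "p' \<in> prime_factors q"
      using p p' assms by (auto simp: prime_factors_dvd)
    show False
    proof (cases "p dvd n")
      case True
      then have "p dvd int d * int t" using p by (simp add: m_def dvd_add_right_iff)
      moreover have "\<not> p dvd int d" using True assms p
        by (meson coprime_common_divisor not_prime_unit)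
      ultimately have "p' dvd t" using p p' by (simp add: prime_dvd_mult_iff)
      then have "\<exists>r\<in>{r \<in> prime_factors q. \<not> int r dvd n}. p' dvd r"
        unfolding t_def using pf by (subst (asm) prime_dvd_prod_iff) auto
      then show False using pf True p'
        by (metis (no_types, lifting) in_prime_factors_imp_prime mem_Collect_eq primes_dvd_imp_eq)
    next
      case False
      then have "p' dvd t" unfolding t_def using pf p' by (intro dvd_prodI) auto
      then have "p dvd int d * int t" using p' by simp
      then have "p dvd n" using p by (simp add: m_def dvd_add_left_iff)
      then show False using False by simp
    qed
  qed
  moreover have "[m = n] (mod int d)" by (simp add: m_def cong_def)
  ultimately show ?thesis using that by blast
qed

text \<open>If \<open>ch\<close> were 1 on the kernel of the reduction from units modulo q to units
  modulo d, it would factor through the image, which by \<open>coprime_lift\<close> consists of all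
  units modulo d. Extended by zero, the resulting character would induce \<open>ch\<close>.\<close>

lemma not_induced_witness:
  assumes ch: "dchar q ch" and d: "d dvd q" and ni: "\<not> induced_from d q ch"
  obtains n where "coprime n (int q)" "[n = 1] (mod int d)" "ch n \<noteq> 1"
proof -
  have "\<exists>n. coprime n (int q) \<and> [n = 1] (mod int d) \<and> ch n \<noteq> 1"
  proof (rule ccontr)
    assume neg: "\<not> ?thesis"
    have q: "q \<ge> 1" using dchar_pos[OF ch] .
    have d1: "d \<ge> 1" using d q by (metis dvd_0_left_iff less_one not_less not_one_le_zero)
    have eq: "ch m = ch m'"
      if h: "coprime m (int q)" "coprime m' (int q)" "[m = m'] (mod int d)" for m m'
    proof -
      obtain v where v: "[m' * v = 1] (mod int q)" "ch m' * ch v = 1" "coprime v (int q)"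
        using dchar_inverse_exists[OF ch h(2)] .
      have "[m * v = m' * v] (mod int d)" using h(3) by (intro cong_mult) auto
      also have "[m' * v = 1] (mod int d)"
        using v(1) d by (meson cong_dvd_modulus of_nat_dvd_iff)
      finally have "ch (m * v) = 1" using neg h v by auto
      then show ?thesis using v(2) dchar_mult[OF ch] by (metis mult_cancel_right mult_zero_right zero_neq_one)
    qed
    \<comment> \<open>\<open>l\<close> picks a unit modulo q above each unit modulo d; by
      \<open>eq\<close> the value of \<open>ch\<close> there does not depend on the choice.\<close>
    define l where "l n = (SOME m. coprime m (int q) \<and> [m = n] (mod int d))" for n
    have l: "coprime (l n) (int q)" "[l n = n] (mod int d)" if "coprime n (int d)" for n
      using someI_ex[of "\<lambda>m. coprime m (int q) \<and> [m = n] (mod int d)"] coprime_lift[OF that d q]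
      unfolding l_def by blast+
    define ch' where "ch' n = (if coprime n (int d) then ch (l n) else 0)" for n
    have cd: "coprime n (int d)" if "coprime n (int q)" for n
      using that d by (meson coprime_divisors dvd_refl of_nat_dvd_iff)
    have ch'_eq: "ch' n = ch m" if "coprime m (int q)" "[m = n] (mod int d)" for m n
    proof -
      have "coprime n (int d)" using that cd cong_imp_coprime by blast
      then show ?thesis using that l[of n] eq[of "l n" m] unfolding ch'_def
        by (metis cong_sym cong_trans)
    qed
    have "dchar d ch'" unfolding dchar_def
    proof (intro conjI allI)
      fix m n
      show "ch' (m * n) = ch' m * ch' n"
      proof (cases "coprime m (int d) \<and> coprime n (int d)")
        case True
        then have "ch' (m * n) = ch (l m * l n)"
          using l by (intro ch'_eq) (auto intro: cong_mult)
        then show ?thesis using True by (simp add: ch'_def dchar_mult[OF ch])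
      next
        case False then show ?thesis by (auto simp: ch'_def)
      qed
    next
      fix n
      have *: "coprime (n + int d) (int d) \<longleftrightarrow> coprime n (int d)" by (simp add: coprime_iff_gcd_eq_1)
      show "ch' (n + int d) = ch' n"
      proof (cases "coprime n (int d)")
        case True
        then show ?thesis using l[OF True] ch'_eq[of "l n" "n + int d"] ch'_eq[of "l n" n]
          by (simp add: cong_def)
      qed (use * in \<open>simp add: ch'_def\<close>)
    next
      show "ch' 1 = 1" using ch'_eq[of 1 1] dchar_1[OF ch] by simp
    next
      fix n show "(ch' n \<noteq> 0) = coprime n (int d)"
        using l[of n] dchar_nonzero_iff[OF ch] by (auto simp: ch'_def)
    qed (use d1 in simp)
    moreover have "\<forall>n. coprime n (int q) \<longrightarrow> ch n = ch' n" using ch'_eq by (metis cong_refl)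
    ultimately show False using ni by (auto simp: induced_from_def)
  qed
  then show ?thesis using that by blast
qed

section \<open>Sums over residue systems and twisted Gauss sums\<close>

lemma sum_lessThan_int: "(\<Sum>s<q. f (int s)) = (\<Sum>j\<in>{0..<int q}. f j)"
  by (rule sum.reindex_bij_witness[of _ nat int]) auto

lemma sum_periodic_mult_unit:
  fixes h :: "int \<Rightarrow> 'a::comm_monoid_add"
  assumes per: "\<And>n. h (n + int q) = h n" and u: "coprime u (int q)" and q: "q \<ge> 1"
  shows "(\<Sum>s<q. h (u * int s)) = (\<Sum>s<q. h (int s))"
proof -
  define f where "f j = (u * j) mod int q" for j
  have "inj_on f {0..<int q}"
  proof (rule inj_onI)
    fix x y assume xy: "x \<in> {0..<int q}" "y \<in> {0..<int q}" "f x = f y"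
    then have "[u * x = u * y] (mod int q)" by (simp add: f_def cong_def)
    then have "[x = y] (mod int q)" using cong_mult_lcancel[OF u] by blast
    then show "x = y" using xy by (simp add: cong_def)
  qed
  moreover have "f ` {0..<int q} \<subseteq> {0..<int q}" using q by (auto simp: f_def)
  ultimately have bij: "bij_betw f {0..<int q} {0..<int q}"
    unfolding bij_betw_def using endo_inj_surj[of "{0..<int q}" f] by blast
  have "(\<Sum>s<q. h (u * int s)) = (\<Sum>j\<in>{0..<int q}. h (u * j))" by (rule sum_lessThan_int[of "\<lambda>j. h (u * j)"])
  also have "\<dots> = (\<Sum>j\<in>{0..<int q}. h (f j))"
  proof (rule sum.cong[OF refl])
    fix j show "h (u * j) = h (f j)"
      by (rule periodic_int_cong[of h "int q", OF per]) (simp add: f_def cong_def)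
  qed
  also have "\<dots> = (\<Sum>j\<in>{0..<int q}. h j)" by (rule sum.reindex_bij_betw[OF bij])
  also have "\<dots> = (\<Sum>s<q. h (int s))" by (rule sum_lessThan_int[of h, symmetric])
  finally show ?thesis .
qed

lemma ee_periodic_frac:
  "q \<ge> 1 \<Longrightarrow> ee (of_int l * of_int (n + int q) / of_nat q) = ee (of_int l * of_int n / of_nat q)"
proof -
  assume "q \<ge> 1"
  then have "of_int l * of_int (n + int q) / of_nat q = of_int l * of_int n / of_nat q + (of_int l :: complex)"
    by (simp add: field_simps)
  then show ?thesis by (simp add: ee_add)
qed

lemma dchar_twist_shift:
  assumes ch: "dchar q ch" and u: "coprime u (int q)"
  shows "(\<Sum>s<q. ch (int s) * ee (of_int l * of_nat s / of_nat q)) =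
    ch u * (\<Sum>s<q. ch (int s) * ee (of_int (l * u) * of_nat s / of_nat q))"
proof -
  have q: "q \<ge> 1" using dchar_pos[OF ch] .
  define h where "h n = ch n * ee (of_int l * of_int n / of_nat q)" for n
  have "h (n + int q) = h n" for n
    unfolding h_def using ee_periodic_frac[OF q, of l n] ch by (simp add: dchar_def)
  from sum_periodic_mult_unit[of h, OF this u q]
  show ?thesis by (simp add: h_def dchar_mult[OF ch] sum_distrib_left mult_ac)
qed

text \<open>For l prime to q, substitute l s for s in \<open>G 1\<close>. Otherwise primitivity
  supplies a unit n with l n congruent to l modulo q and \<open>ch n\<close> different from 1; the
  same kind of substitution gives G l = ch n * G l, so the sum is zero, in agreement with ch l =
  0.\<close>

lemma gauss_twist:
  assumes pr: "primitive_dchar q ch"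
  shows "(\<Sum>s<q. ch (int s) * ee (of_int l * of_nat s / of_nat q)) = cnj (ch l) * gauss q ch"
proof -
  have ch: "dchar q ch" using pr by (simp add: primitive_dchar_def)
  define G where "G l = (\<Sum>s<q. ch (int s) * ee (of_int l * of_nat s / of_nat q))" for l
  have shift: "G l = ch u * G (l * u)" if "coprime u (int q)" for l u
    unfolding G_def by (rule dchar_twist_shift[OF ch that])
  have G1: "G 1 = gauss q ch" by (simp add: G_def gauss_def)
  have "G l = cnj (ch l) * gauss q ch"
  proof (cases "coprime l (int q)")
    case True
    from shift[OF True, of 1] have "cnj (ch l) * G 1 = (cnj (ch l) * ch l) * G l" by simp
    then show ?thesis using dchar_cnj_mult[OF ch True] G1 by simp
  next
    case False
    have q: "q \<ge> 1" using dchar_pos[OF ch] .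
    define g where "g = nat (gcd l (int q))"
    have ig: "int g = gcd l (int q)" by (simp add: g_def)
    then have gq: "g dvd q" by (metis gcd_dvd2 of_nat_dvd_iff)
    then obtain d where d: "q = g * d" by (auto elim: dvdE)
    have "g \<noteq> 1" using False ig by (auto simp: coprime_iff_gcd_eq_1)
    \<comment> \<open>d = q / gcd(l, q) is a proper divisor, and n congruent to 1 modulo d suffices
      for l n to be congruent to l modulo q.\<close>
    then have "d dvd q" "d \<noteq> q" using d q by auto
    then have "\<not> induced_from d q ch" using pr by (simp add: primitive_dchar_def)
    then obtain n where n: "coprime n (int q)" "[n = 1] (mod int d)" "ch n \<noteq> 1"
      using not_induced_witness[OF ch \<open>d dvd q\<close>] by blast
    obtain l' where l': "l = int g * l'" using ig by (metis gcd_dvd1 dvdE)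
    have "int d dvd n - 1" using n(2) by (simp add: cong_iff_dvd_diff)
    then have "int q dvd l * n - l" unfolding d l'
      by (metis (no_types, opaque_lifting) dvd_mult2 mult.assoc mult.commute mult.right_neutral mult_dvd_mono of_nat_mult right_diff_distrib dvd_refl)
    then obtain t where t: "l * n = l + int q * t" by (metis dvdE diff_eq_eq add.commute)
    have "G (l * n) = G l" unfolding G_def
    proof (intro sum.cong refl)
      fix s
      have "of_int (l * n) * of_nat s / of_nat q = of_int l * of_nat s / of_nat q + (of_int (t * int s) :: complex)"
        using q by (simp add: t field_simps)
      then show "ch (int s) * ee (of_int (l * n) * of_nat s / of_nat q) = ch (int s) * ee (of_int l * of_nat s / of_nat q)"
        by (simp only: ee_add ee_of_int mult_1_right)
    qed
    then have "G l = 0" using shift[OF n(1), of l] n(3) by simp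
    moreover have "ch l = 0" using False dchar_nonzero_iff[OF ch] by blast
    ultimately show ?thesis by simp
  qed
  then show ?thesis by (simp add: G_def)
qed

lemma sum_ee_roots:
  assumes "q \<ge> 1"
  shows "(\<Sum>l<q. ee (of_nat l * of_int t / of_nat q)) = (if int q dvd t then of_nat q else 0)"
proof -
  define r where "r = ee (of_int t / of_nat q)"
  have pw: "ee (of_nat l * of_int t / of_nat q) = r ^ l" for l by (simp add: r_def ee_power)
  show ?thesis
  proof (cases "int q dvd t")
    case True
    then obtain j where "t = int q * j" by auto
    then have "r = ee (of_int j)" using assms by (simp add: r_def)
    then have "r = 1" by simp
    then show ?thesis using True by (simp add: pw)
  next
    case False
    have "r \<noteq> 1"
    proof
      assume "r = 1"
      then obtain n :: int where "2 * pi * (of_int t / of_nat q) = of_int (2 * n) * pi"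
        unfolding r_def ee_def exp_eq_1 by (auto simp: mult_ac)
      then have "of_int t = (of_int (n * int q) :: real)" using assms by (simp add: field_simps)
      then have "t = n * int q" by (simp only: of_int_eq_iff)
      then show False using False by simp
    qed
    moreover have "r ^ q = 1" using assms by (simp add: r_def ee_power)
    ultimately show ?thesis using False by (simp add: pw geometric_sum)
  qed
qed

text \<open>If the Gauss sum were zero, \<open>gauss_twist\<close> would make the whole finite
  Fourier transform of \<open>ch\<close> zero, and Fourier inversion at 1 would give q * ch 1 =
  0.\<close>

lemma gauss_nonzero:
  assumes pr: "primitive_dchar q ch"
  shows "gauss q ch \<noteq> 0"
proof
  assume 0: "gauss q ch = 0"
  have ch: "dchar q ch" using pr by (simp add: primitive_dchar_def)
  have q: "q \<ge> 1" using dchar_pos[OF ch] .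
  have "0 = (\<Sum>l<q. ee (- (of_nat l / of_nat q)) * (\<Sum>s<q. ch (int s) * ee (of_int (int l) * of_nat s / of_nat q)))"
    unfolding gauss_twist[OF pr] 0 by simp
  also have "\<dots> = (\<Sum>s<q. ch (int s) * (\<Sum>l<q. ee (of_nat l * of_int (int s - 1) / of_nat q)))"
  proof -
    have "ee (of_nat l * of_int (int s - 1) / of_nat q) =
        ee (- (of_nat l / of_nat q)) * ee (of_int (int l) * of_nat s / of_nat q)" for l s
      by (simp add: ee_add[symmetric] diff_divide_distrib algebra_simps)
    then show ?thesis
      unfolding sum_distrib_left by (subst sum.swap) (simp add: mult_ac)
  qed
  also have "\<dots> = (\<Sum>s<q. ch (int s) * (if int q dvd int s - 1 then of_nat q else 0))"
    by (simp only: sum_ee_roots[OF q])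
  also have "\<dots> = (\<Sum>j\<in>{0..<int q}. ch j * (if int q dvd j - 1 then of_nat q else 0))"
    by (rule sum_lessThan_int[of "\<lambda>j. ch j * (if int q dvd j - 1 then of_nat q else 0)"])
  \<comment> \<open>The surviving residue is \<open>1 mod int q\<close> and not simply 1, because q
    = 1 is possible here.\<close>
  also have "\<dots> = (\<Sum>j\<in>{1 mod int q}. ch j * of_nat q)"
  proof (rule sum.mono_neutral_cong_right)
    show "\<forall>i\<in>{0..<int q} - {1 mod int q}. ch i * (if int q dvd i - 1 then of_nat q else 0) = 0"
      by (auto simp: cong_iff_dvd_diff[symmetric] cong_def)
    show "ch x * (if int q dvd x - 1 then of_nat q else 0) = ch x * of_nat q"
      if "x \<in> {1 mod int q}" for x
      using that by (auto simp: cong_iff_dvd_diff[symmetric] cong_def)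
  qed (use q in auto)
  also have "\<dots> = ch 1 * of_nat q"
    using dchar_cong[OF ch, of "1 mod int q" 1] by (simp add: cong_def)
  finally show False using dchar_1[OF ch] q by simp
qed

lemma nontrivial_modulus:
  assumes "dchar q ch" "nontrivial_dchar q ch"
  shows "q > 1"
proof (rule ccontr)
  assume "\<not> q > 1"
  then have "q = 1" using dchar_pos[OF assms(1)] by simp
  then have "ch n = 1" for n
    using dchar_cong[OF assms(1), of n 1] dchar_1[OF assms(1)] by (simp add: cong_def)
  then show False using assms(2) by (simp add: nontrivial_dchar_def)
qed

lemma sum_nontrivial_dchar:
  assumes ch: "dchar q ch" and "nontrivial_dchar q ch"
  shows "(\<Sum>s<q. ch (int s)) = 0"
proof -
  obtain n where n: "coprime n (int q)" "ch n \<noteq> 1" using assms by (auto simp: nontrivial_dchar_def)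
  have "(\<Sum>s<q. ch (int s)) = ch n * (\<Sum>s<q. ch (int s))"
    using sum_periodic_mult_unit[of ch q n] n ch
    by (simp add: dchar_def sum_distrib_left)
  then show ?thesis using n by simp
qed

section \<open>Differences of lattice sums\<close>

definition lterm :: "complex \<Rightarrow> nat \<Rightarrow> real \<Rightarrow> real \<Rightarrow> complex" where
  "lterm \<tau> k x y = inverse (of_real x * \<tau> + of_real y) ^ k"

definition nonlat :: "real \<Rightarrow> real \<Rightarrow> bool" where
  "nonlat x y \<longleftrightarrow> x \<notin> \<int> \<or> y \<notin> \<int>"

text \<open>For weight \<open>2\<close> the lattice sums themselves converge only conditionally, whereas the
  difference of the sums attached to two points of the torus converges absolutely.\<close>
definition ldiff_term :: "complex \<Rightarrow> nat \<Rightarrow> real \<Rightarrow> real \<Rightarrow> real \<Rightarrow> real \<Rightarrow> int \<times> int \<Rightarrow> complex" where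
  "ldiff_term \<tau> k x y x' y' = (\<lambda>(m, n).
     lterm \<tau> k (of_int m + x) (of_int n + y) - lterm \<tau> k (of_int m + x') (of_int n + y'))"

definition ldiff :: "complex \<Rightarrow> nat \<Rightarrow> real \<Rightarrow> real \<Rightarrow> real \<Rightarrow> real \<Rightarrow> complex" where
  "ldiff \<tau> k x y x' y' = infsum (ldiff_term \<tau> k x y x' y') UNIV"

text \<open>The imaginary part controls x; then y is recovered by subtracting x \<tau>, at the price
  of the constant c.\<close>

lemma lattice_norm_lower:
  assumes "Im \<tau> \<noteq> 0"
  obtains \<delta> where "\<delta> > 0"
    "\<And>x y. \<delta> * max \<bar>x\<bar> \<bar>y\<bar> \<le> cmod (of_real x * \<tau> + of_real y)"
proof
  define c where "c = 1 + cmod \<tau> / \<bar>Im \<tau>\<bar>"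
  have c: "c > 0" unfolding c_def by (smt (verit) divide_nonneg_nonneg norm_ge_zero)
  show "min \<bar>Im \<tau>\<bar> (1 / c) > 0" using assms c by simp
  fix x y :: real
  let ?z = "of_real x * \<tau> + of_real y"
  have "\<bar>Im ?z\<bar> \<le> cmod ?z" by (rule abs_Im_le_cmod)
  then have 1: "\<bar>x\<bar> * \<bar>Im \<tau>\<bar> \<le> cmod ?z" by (simp add: abs_mult)
  then have x: "\<bar>x\<bar> \<le> cmod ?z / \<bar>Im \<tau>\<bar>" using assms by (simp add: pos_le_divide_eq)
  have "\<bar>y\<bar> = cmod (?z - of_real x * \<tau>)" by simp
  also have "\<dots> \<le> cmod ?z + \<bar>x\<bar> * cmod \<tau>" by (metis norm_triangle_ineq4 norm_mult norm_of_real)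
  also have "\<bar>x\<bar> * cmod \<tau> \<le> cmod ?z / \<bar>Im \<tau>\<bar> * cmod \<tau>" using x by (intro mult_right_mono) auto
  finally have "\<bar>y\<bar> \<le> c * cmod ?z" by (simp add: c_def algebra_simps)
  then have 2: "1 / c * \<bar>y\<bar> \<le> cmod ?z" using c by (simp add: divide_le_eq mult.commute)
  have "min \<bar>Im \<tau>\<bar> (1 / c) * \<bar>x\<bar> \<le> \<bar>Im \<tau>\<bar> * \<bar>x\<bar>" "min \<bar>Im \<tau>\<bar> (1 / c) * \<bar>y\<bar> \<le> 1 / c * \<bar>y\<bar>"
    by (intro mult_right_mono; simp)+
  with 1 2 show "min \<bar>Im \<tau>\<bar> (1 / c) * max \<bar>x\<bar> \<bar>y\<bar> \<le> cmod ?z"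
    by (auto simp: max_def mult.commute)
qed

lemma nonint_dist:
  fixes x :: real
  assumes "x \<notin> \<int>"
  obtains \<epsilon> where "\<epsilon> > 0" "\<And>m::int. \<epsilon> \<le> \<bar>of_int m + x\<bar>"
proof
  have f: "frac x > 0" "frac x < 1" using assms by (simp_all add: frac_gt_0_iff frac_lt_1)
  then show "min (frac x) (1 - frac x) > 0" by simp
  fix m :: int
  have x: "of_int m + x = of_int (m + \<lfloor>x\<rfloor>) + frac x" by (simp add: frac_def)
  show "min (frac x) (1 - frac x) \<le> \<bar>of_int m + x\<bar>"
  proof (cases "m + \<lfloor>x\<rfloor> \<ge> 0")
    case True
    then have "(of_int (m + \<lfloor>x\<rfloor>) :: real) \<ge> 0" by (simp only: of_int_0_le_iff)
    then show ?thesis using f unfolding x by linarith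
  next
    case False
    then have "m + \<lfloor>x\<rfloor> \<le> -1" by simp
    then have "(of_int (m + \<lfloor>x\<rfloor>) :: real) \<le> of_int (-1)" by (simp only: of_int_le_iff)
    then show ?thesis using f unfolding x by simp
  qed
qed

text \<open>A point off the lattice keeps the linear form away from 0 for all (m, n), so the bound
  can be stated with 1 + max and there are no exceptional terms. The constant K combines A \<ge> M -
  c, from the triangle inequality, with A \<ge> \<epsilon>, from the distance to the
  integers.\<close>

lemma shifted_lattice_norm_lower:
  assumes "Im \<tau> \<noteq> 0" "nonlat x y"
  obtains \<delta> where "\<delta> > 0"
    "\<And>m n :: int. \<delta> * (1 + max \<bar>of_int m\<bar> \<bar>of_int n\<bar>)
        \<le> cmod (of_real (of_int m + x) * \<tau> + of_real (of_int n + y))"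
proof -
  obtain \<delta> where \<delta>: "\<delta> > 0"
    "\<And>x y. \<delta> * max \<bar>x\<bar> \<bar>y\<bar> \<le> cmod (of_real x * \<tau> + of_real y)"
    using lattice_norm_lower[OF assms(1)] by blast
  obtain \<epsilon> where \<epsilon>: "\<epsilon> > 0" "\<And>m n::int. \<epsilon> \<le> max \<bar>of_int m + x\<bar> \<bar>of_int n + y\<bar>"
    using assms(2) nonint_dist unfolding nonlat_def by (metis le_max_iff_disj)
  define c where "c = max \<bar>x\<bar> \<bar>y\<bar>"
  have c: "c \<ge> 0" by (simp add: c_def)
  define K where "K = 1 + (1 + c) / \<epsilon>"
  have K: "K > 0" using c \<epsilon> by (simp add: K_def add_pos_nonneg)
  show ?thesis
  proof
    show "\<delta> / K > 0" using \<delta> K by simp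
    fix m n :: int
    let ?A = "max \<bar>of_int m + x\<bar> \<bar>of_int n + y\<bar>" and ?M = "max \<bar>real_of_int m\<bar> \<bar>real_of_int n\<bar>"
    have 1: "?A \<ge> ?M - c" unfolding c_def by (auto simp: max_def)
    have "(1 + c) / \<epsilon> * ?A \<ge> (1 + c) / \<epsilon> * \<epsilon>"
      using \<epsilon>(1) \<epsilon>(2)[of m n] c by (intro mult_left_mono) auto
    then have "(1 + c) / \<epsilon> * ?A \<ge> 1 + c" using \<epsilon>(1) by simp
    with 1 have "1 + ?M \<le> K * ?A" by (simp add: K_def distrib_right)
    then have "\<delta> / K * (1 + ?M) \<le> \<delta> / K * (K * ?A)" using \<delta> K by (intro mult_left_mono) auto
    also have "\<dots> = \<delta> * ?A" using K by simp
    also have "\<dots> \<le> cmod (of_real (of_int m + x) * \<tau> + of_real (of_int n + y))"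
      using \<delta>(2)[of "of_int m + x" "of_int n + y"] by simp
    finally show "\<delta> / K * (1 + ?M) \<le> cmod (of_real (of_int m + x) * \<tau> + of_real (of_int n + y))" .
  qed
qed

section \<open>Absolute convergence of the lattice differences\<close>

lemma summable_on_int_powr:
  assumes "s > 1"
  shows "(\<lambda>n::int. (1 + \<bar>real_of_int n\<bar>) powr (-s)) summable_on UNIV"
proof -
  let ?f = "\<lambda>n::int. (1 + \<bar>real_of_int n\<bar>) powr (-s)"
  have "summable (\<lambda>n. real n powr (-s))" using assms by (simp add: summable_real_powr_iff)
  then have "summable (\<lambda>n. real (Suc n) powr (-s))" by (subst summable_Suc_iff)
  then have S: "(\<lambda>n. real (Suc n) powr (-s)) summable_on UNIV"
    by (intro norm_summable_imp_summable_on) simp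
  have 1: "?f summable_on (range int)"
    by (subst summable_on_reindex) (use S in \<open>auto simp: o_def\<close>)
  have 2: "?f summable_on (range (\<lambda>n. - int n))"
    by (subst summable_on_reindex) (use S in \<open>auto simp: o_def inj_on_def\<close>)
  have "range int \<union> range (\<lambda>n. - int n) = UNIV" by (auto intro: int_cases2)
  with summable_on_union[OF 1 2] show ?thesis by simp
qed

lemma summable_on_product_nonneg:
  fixes f :: "'a \<Rightarrow> real" and g :: "'b \<Rightarrow> real"
  assumes "f summable_on A" "g summable_on B" "\<And>x. f x \<ge> 0" "\<And>y. g y \<ge> 0"
  shows "(\<lambda>(x, y). f x * g y) summable_on (A \<times> B)"
proof -
  have "(\<lambda>p. norm (f (fst p) * g (snd p))) summable_on (A \<times> B)"
    unfolding Infinite_Sum.abs_summable_on_Sigma_iff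
    using assms by (auto simp: abs_mult infsum_cmult_right' abs_of_nonneg infsum_nonneg
        intro!: summable_on_cmult_right summable_on_cmult_left)
  moreover have "(\<lambda>(x, y). f x * g y) = (\<lambda>p. norm (f (fst p) * g (snd p)))"
    using assms by (auto simp: abs_mult abs_of_nonneg)
  ultimately show ?thesis by simp
qed

text \<open>The square of 1 + max is at least (1 + |m|) (1 + |n|), so the family is dominated by a
  product of two one-dimensional series with exponent s/2 > 1.\<close>

lemma summable_on_int_square_powr:
  assumes "s > 2"
  shows "(\<lambda>(m::int, n::int). (1 + max \<bar>real_of_int m\<bar> \<bar>real_of_int n\<bar>) powr (-s)) summable_on UNIV"
proof -
  let ?f = "\<lambda>n::int. (1 + \<bar>real_of_int n\<bar>) powr (-(s/2))"
  have f: "?f summable_on UNIV" using assms by (intro summable_on_int_powr) simp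
  have "(\<lambda>(m, n). ?f m * ?f n) summable_on (UNIV \<times> UNIV)"
    by (intro summable_on_product_nonneg f) auto
  then have "(\<lambda>p. ?f (fst p) * ?f (snd p)) summable_on UNIV" by (simp add: case_prod_unfold)
  then show ?thesis
  proof (rule summable_on_comparison_test)
    fix p :: "int \<times> int"
    obtain m n where p: "p = (m, n)" by (cases p)
    let ?M = "1 + max \<bar>real_of_int m\<bar> \<bar>real_of_int n\<bar>"
    have "?M powr (-s) = ?M powr (-(s/2)) * ?M powr (-(s/2))" by (simp add: powr_add[symmetric])
    also have "\<dots> \<le> ?f m * ?f n"
      using assms by (intro mult_mono powr_mono2') auto
    finally show "(case p of (m, n) \<Rightarrow> (1 + max \<bar>real_of_int m\<bar> \<bar>real_of_int n\<bar>) powr (-s))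
        \<le> ?f (fst p) * ?f (snd p)" by (simp add: p)
  qed auto
qed

text \<open>Factoring the difference of k-th powers through 1/u - 1/v = -(u - v)/(u v) gains one
  power of 1/B over the trivial bound; this is what saves weight 2.\<close>

lemma norm_inverse_power_diff_le:
  fixes u v :: complex
  assumes "B > 0" "cmod u \<ge> B" "cmod v \<ge> B" "k \<ge> 1"
  shows "cmod (inverse u ^ k - inverse v ^ k) \<le> real k * cmod (u - v) * (1 / B) ^ (k + 1)"
proof -
  have nz: "u \<noteq> 0" "v \<noteq> 0" using assms by auto
  have iu: "cmod (inverse u) \<le> 1 / B" "cmod (inverse v) \<le> 1 / B"
    using assms by (simp_all add: norm_inverse divide_inverse le_imp_inverse_le)
  have s: "cmod (\<Sum>i<k. inverse v ^ (k - Suc i) * inverse u ^ i) \<le> (\<Sum>i<k. (1 / B) ^ (k - 1))"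
  proof (rule sum_norm_le)
    fix i assume "i \<in> {..<k}"
    then have "k - 1 = (k - Suc i) + i" by auto
    moreover have "cmod (inverse v ^ (k - Suc i) * inverse u ^ i) \<le> (1/B) ^ (k - Suc i) * (1/B) ^ i"
      unfolding norm_mult norm_power using iu assms by (intro mult_mono power_mono) auto
    ultimately show "cmod (inverse v ^ (k - Suc i) * inverse u ^ i) \<le> (1/B) ^ (k - 1)"
      by (simp add: power_add)
  qed
  have "inverse u - inverse v = - (inverse u * (u - v) * inverse v)"
    using nz by (rule inverse_diff_inverse)
  then have d: "cmod (inverse u - inverse v) \<le> (1/B) * cmod (u - v) * (1/B)"
    unfolding norm_minus_cancel norm_mult by (simp only: norm_minus_cancel norm_mult) (intro mult_mono iu; use assms in simp)
  have "cmod (inverse u ^ k - inverse v ^ k) \<le> ((1/B) * cmod (u - v) * (1/B)) * (\<Sum>i<k. (1 / B) ^ (k - 1))"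
    unfolding power_diff_sumr2 norm_mult using d s assms by (intro mult_mono) auto
  also have "\<dots> = real k * cmod (u - v) * ((1 / B) ^ (k - 1) * (1/B)^2)"
    by (simp add: power2_eq_square)
  also have "(1 / B) ^ (k - 1) * (1/B)^2 = (1 / B) ^ (k + 1)"
    using assms by (simp add: power_add[symmetric])
  finally show ?thesis .
qed

text \<open>The two linear forms differ by a constant independent of (m, n), so the terms decay like
  M^-(k + 1), and k + 1 \<ge> 3 exceeds the rank 2 of the lattice.\<close>

lemma ldiff_term_summable:
  assumes \<tau>: "Im \<tau> \<noteq> 0" and nl: "nonlat x y" "nonlat x' y'" and k: "k \<ge> 2"
  shows "ldiff_term \<tau> k x y x' y' summable_on UNIV"
proof -
  obtain \<delta>1 where \<delta>1: "\<delta>1 > 0"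
    "\<And>m n :: int. \<delta>1 * (1 + max \<bar>of_int m\<bar> \<bar>of_int n\<bar>)
        \<le> cmod (of_real (of_int m + x) * \<tau> + of_real (of_int n + y))"
    using shifted_lattice_norm_lower[OF \<tau> nl(1)] by blast
  obtain \<delta>2 where \<delta>2: "\<delta>2 > 0"
    "\<And>m n :: int. \<delta>2 * (1 + max \<bar>of_int m\<bar> \<bar>of_int n\<bar>)
        \<le> cmod (of_real (of_int m + x') * \<tau> + of_real (of_int n + y'))"
    using shifted_lattice_norm_lower[OF \<tau> nl(2)] by blast
  define \<delta> where "\<delta> = min \<delta>1 \<delta>2"
  define K where "K = cmod (of_real (x - x') * \<tau> + of_real (y - y'))"
  define c where "c = real k * K * (1 / \<delta>) ^ (k + 1)"
  have \<delta>: "\<delta> > 0" using \<delta>1 \<delta>2 by (simp add: \<delta>_def)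
  have K: "K \<ge> 0" by (simp add: K_def)
  have c: "c \<ge> 0" using \<delta> K by (simp add: c_def)
  have "(\<lambda>p. c * (case p of (m, n) \<Rightarrow> (1 + max \<bar>real_of_int m\<bar> \<bar>real_of_int n\<bar>) powr (-3))) summable_on UNIV"
    by (intro summable_on_cmult_right summable_on_int_square_powr) simp
  then have "(\<lambda>p. norm (ldiff_term \<tau> k x y x' y' p)) summable_on UNIV"
  proof (rule Infinite_Sum.abs_summable_on_comparison_test')
    fix p :: "int \<times> int"
    obtain m n where p: "p = (m, n)" by (cases p)
    let ?M = "1 + max \<bar>real_of_int m\<bar> \<bar>real_of_int n\<bar>"
    let ?u = "of_real (of_int m + x) * \<tau> + of_real (of_int n + y)"
    let ?v = "of_real (of_int m + x') * \<tau> + of_real (of_int n + y')"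
    have M: "?M \<ge> 1" by simp
    have dM: "\<delta> * ?M \<le> \<delta>1 * ?M" "\<delta> * ?M \<le> \<delta>2 * ?M"
      by (intro mult_right_mono; simp add: \<delta>_def)+
    have B: "cmod ?u \<ge> \<delta> * ?M" "cmod ?v \<ge> \<delta> * ?M"
      using order_trans[OF dM(1) \<delta>1(2)] order_trans[OF dM(2) \<delta>2(2)] by blast+
    have "?u - ?v = of_real (x - x') * \<tau> + of_real (y - y')"
      by (simp add: algebra_simps)
    then have uv: "cmod (?u - ?v) = K" by (simp only: K_def)
    have "cmod (ldiff_term \<tau> k x y x' y' p) = cmod (inverse ?u ^ k - inverse ?v ^ k)"
      by (simp add: p ldiff_term_def lterm_def)
    also have "\<dots> \<le> real k * cmod (?u - ?v) * (1 / (\<delta> * ?M)) ^ (k + 1)"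
      using \<delta> M B k by (intro norm_inverse_power_diff_le) auto
    also have "\<dots> = c * (1 / ?M) ^ (k + 1)"
      unfolding uv by (simp add: c_def power_mult_distrib power_divide)
    also have "(1 / ?M) ^ (k + 1) \<le> (1 / ?M) ^ 3"
      using M k by (intro power_decreasing) auto
    also have "(1 / ?M) ^ 3 = ?M powr (-3)"
      using M by (simp add: powr_minus powr_numeral power_divide field_simps)
    finally show "cmod (ldiff_term \<tau> k x y x' y' p)
        \<le> c * (case p of (m, n) \<Rightarrow> (1 + max \<bar>real_of_int m\<bar> \<bar>real_of_int n\<bar>) powr (-3))"
      using c by (simp add: p mult_left_mono)
  qed
  then show ?thesis by (rule Infinite_Sum.abs_summable_summable)
qed

text \<open>Along a single line even weight 2 converges without taking differences. This makes
  telescoping possible and later lets each row of the lattice be evaluated on its own.\<close>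

lemma lterm_summable_line:
  assumes \<tau>: "Im \<tau> \<noteq> 0" and nl: "nonlat x y" and k: "k \<ge> 2"
  shows "(\<lambda>m::int. lterm \<tau> k (of_int m + x) (of_int n + y)) summable_on UNIV"
    and "(\<lambda>n::int. lterm \<tau> k (of_int m + x) (of_int n + y)) summable_on UNIV"
proof -
  obtain \<delta> where \<delta>: "\<delta> > 0"
    "\<And>m n :: int. \<delta> * (1 + max \<bar>of_int m\<bar> \<bar>of_int n\<bar>)
        \<le> cmod (of_real (of_int m + x) * \<tau> + of_real (of_int n + y))"
    using shifted_lattice_norm_lower[OF \<tau> nl(1)] by blast
  have bound: "cmod (lterm \<tau> k (of_int m + x) (of_int n + y)) \<le> (1/\<delta>)^k * (1 + \<bar>of_int l\<bar>) powr (-2)"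
    if "l = m \<or> l = n" for l m n
  proof -
    let ?M = "1 + \<bar>real_of_int l\<bar>"
    let ?u = "of_real (of_int m + x) * \<tau> + of_real (of_int n + y)"
    have M: "?M \<ge> 1" by simp
    have "\<delta> * ?M \<le> \<delta> * (1 + max \<bar>of_int m\<bar> \<bar>of_int n\<bar>)"
      using that \<delta> by (intro mult_left_mono) auto
    also have "\<dots> \<le> cmod ?u" using \<delta>(2)[of m n] .
    finally have "\<delta> * ?M \<le> cmod ?u" .
    then have "cmod (inverse ?u) \<le> 1 / (\<delta> * ?M)"
      using \<delta> M unfolding norm_inverse divide_inverse mult_1_left by (intro le_imp_inverse_le mult_pos_pos) auto
    then have "cmod (inverse ?u ^ k) \<le> (1 / (\<delta> * ?M)) ^ k" unfolding norm_power by (intro power_mono) auto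
    also have "\<dots> = (1/\<delta>)^k * (1 / ?M) ^ k" by (simp add: power_mult_distrib power_divide)
    also have "\<dots> \<le> (1/\<delta>)^k * (1 / ?M) ^ 2" using \<delta> M k by (intro mult_left_mono power_decreasing) auto
    also have "(1 / ?M) ^ 2 = ?M powr (-2)"
      using M by (simp add: powr_minus powr_numeral power_divide field_simps)
    finally show ?thesis by (simp add: lterm_def)
  qed
  have S: "(\<lambda>l::int. (1/\<delta>)^k * (1 + \<bar>of_int l\<bar>) powr (-2)) summable_on UNIV"
    by (intro summable_on_cmult_right summable_on_int_powr) simp
  show "(\<lambda>m::int. lterm \<tau> k (of_int m + x) (of_int n + y)) summable_on UNIV"
    by (rule Infinite_Sum.abs_summable_summable[OF Infinite_Sum.abs_summable_on_comparison_test'[OF S]]) (use bound in blast)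
  show "(\<lambda>n::int. lterm \<tau> k (of_int m + x) (of_int n + y)) summable_on UNIV"
    by (rule Infinite_Sum.abs_summable_summable[OF Infinite_Sum.abs_summable_on_comparison_test'[OF S]]) (use bound in blast)
qed

section \<open>Double periodicity and equivariance under the modular group\<close>

lemma infsum_int_shift_diff:
  fixes f :: "int \<Rightarrow> complex"
  assumes "f summable_on UNIV"
  shows "(\<Sum>\<^sub>\<infinity>m. f (m + 1) - f m) = 0"
proof -
  have b: "bij_betw (\<lambda>m::int. m + 1) UNIV UNIV"
    by (rule bij_betw_byWitness[where f' = "\<lambda>m. m - 1"]) auto
  have "(\<lambda>m. f (m + 1)) summable_on UNIV"
    using summable_on_reindex_bij_betw[OF b, of f] assms by simp
  then have "(\<Sum>\<^sub>\<infinity>m. f (m + 1) + - f m) = (\<Sum>\<^sub>\<infinity>m. f (m + 1)) + (\<Sum>\<^sub>\<infinity>m. - f m)"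
    using assms by (intro infsum_add) (auto simp: summable_on_uminus)
  also have "(\<Sum>\<^sub>\<infinity>m. f (m + 1)) = infsum f UNIV" by (rule infsum_reindex_bij_betw[OF b])
  finally show ?thesis by (simp add: infsum_uminus)
qed

lemma nonlat_shift [simp]: "nonlat (x + 1) y \<longleftrightarrow> nonlat x y" "nonlat x (y + 1) \<longleftrightarrow> nonlat x y"
  "nonlat (x + of_int i) y \<longleftrightarrow> nonlat x y" "nonlat x (y + of_int i) \<longleftrightarrow> nonlat x y"
  by (auto simp: nonlat_def)

lemma ldiff_trans:
  assumes "Im \<tau> \<noteq> 0" "nonlat x y" "nonlat x' y'" "nonlat x'' y''" "k \<ge> 2"
  shows "ldiff \<tau> k x y x'' y'' = ldiff \<tau> k x y x' y' + ldiff \<tau> k x' y' x'' y''"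
proof -
  have "ldiff_term \<tau> k x y x'' y'' = (\<lambda>p. ldiff_term \<tau> k x y x' y' p + ldiff_term \<tau> k x' y' x'' y'' p)"
    by (auto simp: ldiff_term_def)
  then show ?thesis unfolding ldiff_def using assms by (simp add: infsum_add ldiff_term_summable)
qed

text \<open>Summing first in the direction of the shift makes each line telescope to zero. For the
  first coordinate this requires interchanging the two summations, which the summability of the
  double family of differences permits.\<close>

lemma ldiff_shift1:
  assumes "Im \<tau> \<noteq> 0" "nonlat x y" "k \<ge> 2"
  shows "ldiff \<tau> k (x + 1) y x y = 0" "ldiff \<tau> k x (y + 1) x y = 0"
proof -
  have "ldiff_term \<tau> k (x + 1) y x y summable_on (UNIV \<times> UNIV)"
    using assms by (simp add: ldiff_term_summable)
  then have S: "(\<lambda>(m, n). ldiff_term \<tau> k (x + 1) y x y (m, n)) summable_on (UNIV \<times> UNIV)"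
    by simp
  have "ldiff \<tau> k (x + 1) y x y = (\<Sum>\<^sub>\<infinity>m. \<Sum>\<^sub>\<infinity>n. ldiff_term \<tau> k (x + 1) y x y (m, n))"
    unfolding ldiff_def using infsum_Sigma'_banach[OF S] by simp
  also have "\<dots> = (\<Sum>\<^sub>\<infinity>n. \<Sum>\<^sub>\<infinity>m. ldiff_term \<tau> k (x + 1) y x y (m, n))"
    by (rule infsum_swap_banach[OF S])
  also have "\<dots> = (\<Sum>\<^sub>\<infinity>n::int. 0)"
  proof (intro infsum_cong)
    fix n :: int
    show "(\<Sum>\<^sub>\<infinity>m. ldiff_term \<tau> k (x + 1) y x y (m, n)) = 0"
      using infsum_int_shift_diff[OF lterm_summable_line(1)[OF assms, of n]]
      by (simp add: ldiff_term_def add_ac)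
  qed
  finally show "ldiff \<tau> k (x + 1) y x y = 0" by simp
  have "ldiff_term \<tau> k x (y + 1) x y summable_on (UNIV \<times> UNIV)"
    using assms by (simp add: ldiff_term_summable)
  then have S: "(\<lambda>(m, n). ldiff_term \<tau> k x (y + 1) x y (m, n)) summable_on (UNIV \<times> UNIV)"
    by simp
  have "ldiff \<tau> k x (y + 1) x y = (\<Sum>\<^sub>\<infinity>m. \<Sum>\<^sub>\<infinity>n. ldiff_term \<tau> k x (y + 1) x y (m, n))"
    unfolding ldiff_def using infsum_Sigma'_banach[OF S] by simp
  also have "\<dots> = (\<Sum>\<^sub>\<infinity>n::int. 0)"
  proof (intro infsum_cong)
    fix m :: int
    show "(\<Sum>\<^sub>\<infinity>n. ldiff_term \<tau> k x (y + 1) x y (m, n)) = 0"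
      using infsum_int_shift_diff[OF lterm_summable_line(2)[OF assms, of m]]
      by (simp add: ldiff_term_def add_ac)
  qed
  finally show "ldiff \<tau> k x (y + 1) x y = 0" by simp
qed

text \<open>The choice of \<open>(1/2, 1/2)\<close> as reference point is arbitrary.\<close>
definition lwp :: "complex \<Rightarrow> nat \<Rightarrow> real \<Rightarrow> real \<Rightarrow> complex" where
  "lwp \<tau> k x y = ldiff \<tau> k x y (1/2) (1/2)"

lemma nonlat_half [simp]: "nonlat (1/2) y" "nonlat x (1/2)"
proof -
  have "(1/2 :: real) \<notin> \<int>" by (auto elim!: Ints_cases simp: field_simps)
  then show "nonlat (1/2) y" "nonlat x (1/2)" by (auto simp: nonlat_def)
qed

lemma lwp_shift1:
  assumes "Im \<tau> \<noteq> 0" "nonlat x y" "k \<ge> 2"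
  shows "lwp \<tau> k (x + 1) y = lwp \<tau> k x y" "lwp \<tau> k x (y + 1) = lwp \<tau> k x y"
  using assms ldiff_shift1[OF assms] ldiff_trans[of \<tau> "x + 1" y x y "1/2" "1/2" k]
    ldiff_trans[of \<tau> x "y + 1" x y "1/2" "1/2" k]
  by (simp_all add: lwp_def)

lemma lwp_shift:
  assumes \<tau>: "Im \<tau> \<noteq> 0" and nl: "nonlat x y" and k: "k \<ge> 2"
  shows "lwp \<tau> k (x + of_int i) (y + of_int j) = lwp \<tau> k x y"
proof -
  have 1: "lwp \<tau> k (x + of_nat i) y = lwp \<tau> k x y" "lwp \<tau> k x (y + of_nat i) = lwp \<tau> k x y"
    if "nonlat x y" for i x y
  proof -
    show "lwp \<tau> k (x + of_nat i) y = lwp \<tau> k x y"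
    proof (induction i)
      case (Suc i)
      then show ?case using lwp_shift1(1)[OF \<tau> _ k, of "x + of_nat i" y] that nonlat_shift(3)[of x "int i" y]
        by (simp add: add_ac)
    qed simp
    show "lwp \<tau> k x (y + of_nat i) = lwp \<tau> k x y"
    proof (induction i)
      case (Suc i)
      then show ?case using lwp_shift1(2)[OF \<tau> _ k, of x "y + of_nat i"] that nonlat_shift(4)[of x y "int i"]
        by (simp add: add_ac)
    qed simp
  qed
  have 2: "lwp \<tau> k (x + of_int i) y = lwp \<tau> k x y" "lwp \<tau> k x (y + of_int i) = lwp \<tau> k x y"
    if "nonlat x y" for i x y
    using 1[OF that, of "nat i"] 1(1)[of "x + of_int i" y "nat (-i)"] 1(2)[of x "y + of_int i" "nat (-i)"] that
    by (cases "i \<ge> 0"; simp)+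
  show ?thesis using 2(1)[of x "y + of_int j" i] 2(2)[of x y j] nl by simp
qed

text \<open>The matrix acts on row vectors, on (m, n) as well as on (x, y), so on the lattice it
  merely permutes the summation index. The reference point (x', y') moves along, which is why
  \<open>ldiff\<close> carries both points.\<close>

lemma ldiff_SL2:
  fixes a b c d :: int
  assumes det: "a * d - b * c = 1" and nz: "of_int c * \<tau> + of_int d \<noteq> (0 :: complex)"
  shows "ldiff ((of_int a * \<tau> + of_int b) / (of_int c * \<tau> + of_int d)) k x y x' y' =
    (of_int c * \<tau> + of_int d) ^ k * ldiff \<tau> k (x * of_int a + y * of_int c) (x * of_int b + y * of_int d)
      (x' * of_int a + y' * of_int c) (x' * of_int b + y' * of_int d)"
proof -
  let ?j = "of_int c * \<tau> + of_int d" and ?g = "(of_int a * \<tau> + of_int b) / (of_int c * \<tau> + of_int d)"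
  have lt: "lterm ?g k (of_int m + x) (of_int n + y) = ?j ^ k *
      lterm \<tau> k (of_int (m * a + n * c) + (x * of_int a + y * of_int c))
        (of_int (m * b + n * d) + (x * of_int b + y * of_int d))" for m n x y
  proof -
    have "of_real (of_int m + x) * ?g + of_real (of_int n + y) =
       (of_real (of_int (m * a + n * c) + (x * of_int a + y * of_int c)) * \<tau> +
        of_real (of_int (m * b + n * d) + (x * of_int b + y * of_int d))) / ?j"
      using nz by (simp add: field_simps)
    then show ?thesis unfolding lterm_def by (simp add: power_divide field_simps)
  qed
  have bij: "bij_betw (\<lambda>(m, n). (m * a + n * c, m * b + n * d)) (UNIV :: (int \<times> int) set) UNIV"
  proof (rule bij_betw_byWitness[where f' = "\<lambda>(m, n). (m * d - n * c, n * a - m * b)"])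
    show "\<forall>p\<in>UNIV. (case case p of (m, n) \<Rightarrow> (m * a + n * c, m * b + n * d) of (m, n) \<Rightarrow> (m * d - n * c, n * a - m * b)) = p"
    proof clarsimp
      fix m n
      have "(m * a + n * c) * d - (m * b + n * d) * c = m * (a * d - b * c)"
        "(m * b + n * d) * a - (m * a + n * c) * b = n * (a * d - b * c)" by (simp_all add: algebra_simps)
      then show "(m * a + n * c) * d - (m * b + n * d) * c = m \<and> (m * b + n * d) * a - (m * a + n * c) * b = n"
        by (simp add: det)
    qed
    show "\<forall>p\<in>UNIV. (case case p of (m, n) \<Rightarrow> (m * d - n * c, n * a - m * b) of (m, n) \<Rightarrow> (m * a + n * c, m * b + n * d)) = p"
    proof clarsimp
      fix m n
      have "(m * d - n * c) * a + (n * a - m * b) * c = m * (a * d - b * c)"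
        "(m * d - n * c) * b + (n * a - m * b) * d = n * (a * d - b * c)" by (simp_all add: algebra_simps)
      then show "(m * d - n * c) * a + (n * a - m * b) * c = m \<and> (m * d - n * c) * b + (n * a - m * b) * d = n"
        by (simp add: det)
    qed
  qed auto
  let ?L = "ldiff_term \<tau> k (x * of_int a + y * of_int c) (x * of_int b + y * of_int d)
      (x' * of_int a + y' * of_int c) (x' * of_int b + y' * of_int d)"
  have "ldiff ?g k x y x' y' = (\<Sum>\<^sub>\<infinity>p\<in>UNIV. ?j ^ k * ?L (case p of (m, n) \<Rightarrow> (m * a + n * c, m * b + n * d)))"
    unfolding ldiff_def
    by (intro infsum_cong) (auto simp only: ldiff_term_def lt split: prod.splits, simp add: right_diff_distrib)
  also have "\<dots> = ?j ^ k * (\<Sum>\<^sub>\<infinity>p\<in>UNIV. ?L (case p of (m, n) \<Rightarrow> (m * a + n * c, m * b + n * d)))"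
    by (rule infsum_cmult_right')
  also have "(\<Sum>\<^sub>\<infinity>p\<in>UNIV. ?L (case p of (m, n) \<Rightarrow> (m * a + n * c, m * b + n * d))) = infsum ?L UNIV"
    by (rule infsum_reindex_bij_betw[OF bij])
  finally show ?thesis by (simp add: ldiff_def)
qed

section \<open>The Lipschitz formula\<close>

text \<open>The polylogarithm of order -m for m > 0. Since 0^0 = 1, the case m = 0 includes the
  constant term and equals 1/(1 - x).\<close>

definition npow_series :: "nat \<Rightarrow> complex \<Rightarrow> complex" where
  "npow_series m x = (\<Sum>n. of_nat n ^ m * x ^ n)"

text \<open>The Euler operator x d/dx raises the exponent m by one; both claims are this fact read
  off coefficientwise.\<close>

lemma npow_series_shift:
  assumes "summable (\<lambda>n. diffs (\<lambda>n. of_nat n ^ m :: complex) n * x ^ n)"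
  shows "summable (\<lambda>n. of_nat n ^ Suc m * x ^ n)"
    and "npow_series (Suc m) x = x * (\<Sum>n. diffs (\<lambda>n. of_nat n ^ m) n * x ^ n)"
proof -
  have eq: "of_nat (Suc n) ^ Suc m * x ^ Suc n = x * (diffs (\<lambda>n. of_nat n ^ m) n * x ^ n)" for n
    by (simp add: diffs_def)
  have "summable (\<lambda>n. of_nat (Suc n) ^ Suc m * x ^ Suc n)"
    unfolding eq using assms by (rule summable_mult)
  then show S: "summable (\<lambda>n. of_nat n ^ Suc m * x ^ n)" by (subst (asm) summable_Suc_iff)
  have "npow_series (Suc m) x = (\<Sum>n. of_nat (Suc n) ^ Suc m * x ^ Suc n)"
    unfolding npow_series_def by (subst suminf_split_head[OF S]) simp
  also have "\<dots> = x * (\<Sum>n. diffs (\<lambda>n. of_nat n ^ m) n * x ^ n)"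
    unfolding eq using assms by (rule suminf_mult)
  finally show "npow_series (Suc m) x = x * (\<Sum>n. diffs (\<lambda>n. of_nat n ^ m) n * x ^ n)" .
qed

lemma npow_series_summable:
  fixes x :: complex
  assumes "norm x < 1"
  shows "summable (\<lambda>n. of_nat n ^ m * x ^ n)"
  using assms
proof (induction m arbitrary: x)
  case 0
  then show ?case by (simp add: summable_geometric)
next
  case (Suc m)
  show ?case by (rule npow_series_shift, rule termdiff_converges[OF Suc.prems Suc.IH])
qed

lemma npow_series_deriv:
  assumes "norm x < 1"
  shows "\<exists>D. (npow_series m has_field_derivative D) (at x) \<and> x * D = npow_series (Suc m) x"
proof (intro exI conjI)
  show "(npow_series m has_field_derivative (\<Sum>n. diffs (\<lambda>n. of_nat n ^ m) n * x ^ n)) (at x)"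
    unfolding npow_series_def[abs_def]
    by (rule termdiffs_strong'[where K = 1]) (use assms npow_series_summable in auto)
  show "x * (\<Sum>n. diffs (\<lambda>n. of_nat n ^ m) n * x ^ n) = npow_series (Suc m) x"
    by (rule npow_series_shift(2)[symmetric], rule termdiff_converges[OF assms npow_series_summable])
qed

lemma norm_ee_less_1: "Im w > 0 \<Longrightarrow> cmod (ee w) < 1"
  by (simp add: norm_ee)

lemma npow_series_ee_deriv:
  assumes "Im w > 0"
  shows "((\<lambda>w. npow_series m (ee w)) has_field_derivative (2 * pi * \<i> * npow_series (Suc m) (ee w))) (at w)"
proof -
  obtain D where D: "(npow_series m has_field_derivative D) (at (ee w))" "ee w * D = npow_series (Suc m) (ee w)"
    using npow_series_deriv[OF norm_ee_less_1[OF assms]] by blast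
  have "(ee has_field_derivative (2 * pi * \<i> * ee w)) (at w)"
    unfolding ee_def[abs_def] by (auto intro!: derivative_eq_intros)
  from DERIV_chain2[OF D(1) this] show ?thesis
    by (simp add: D(2)[symmetric] mult_ac)
qed

text \<open>The sum of (w + n)^-k over all integers n splits into Hurwitz-type sums at w and at 1 -
  w, that is, polygamma values of index m = k - 1. The sign is then (-1)^k, and differentiation
  sends each member of the family to minus the next.\<close>

definition refl_polygamma :: "nat \<Rightarrow> complex \<Rightarrow> complex" where
  "refl_polygamma m w = (-1) ^ Suc m * Polygamma m w + Polygamma m (1 - w)"

lemma Im_nonzero_not_nonpos_Int: "Im w \<noteq> 0 \<Longrightarrow> w \<notin> \<int>\<^sub>\<le>\<^sub>0"
  using complex_nonpos_Reals_iff nonpos_Ints_subset_nonpos_Reals by blast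

lemma refl_polygamma_deriv:
  assumes "Im w > 0"
  shows "(refl_polygamma m has_field_derivative (- refl_polygamma (Suc m) w)) (at w)"
  unfolding refl_polygamma_def[abs_def]
  by (rule derivative_eq_intros refl Im_nonzero_not_nonpos_Int | use assms in simp)+

text \<open>The left side is \<pi> cot(\<pi> w), obtained by differentiating the reflection formula
  for 1/(\<Gamma>(w) \<Gamma>(1 - w)). In terms of E = exp(i \<pi> w), whose square is
  \<open>ee w\<close>, it becomes a geometric series.\<close>

lemma refl_digamma:
  assumes w: "Im w > 0"
  shows "refl_polygamma 0 w = pi * \<i> - 2 * pi * \<i> * npow_series 0 (ee w)"
proof -
  have nz: "w \<notin> \<int>\<^sub>\<le>\<^sub>0" "1 - w \<notin> \<int>\<^sub>\<le>\<^sub>0" using w by (simp_all add: Im_nonzero_not_nonpos_Int)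
  let ?D = "rGamma w * rGamma (1 - w) * (Digamma (1 - w) - Digamma w)"
  have "((\<lambda>w. rGamma w * rGamma (1 - w)) has_field_derivative ?D) (at w)"
    by (rule derivative_eq_intros refl nz | simp add: algebra_simps)+
  moreover have "((\<lambda>w. rGamma w * rGamma (1 - w)) has_field_derivative cos (of_real pi * w)) (at w)"
    unfolding rGamma_reflection_complex by (auto intro!: derivative_eq_intros)
  ultimately have eq: "?D = cos (of_real pi * w)" by (rule DERIV_unique)
  have sn: "sin (of_real pi * w) \<noteq> 0"
    using rGamma_reflection_complex[of w] nz by (auto simp: rGamma_eq_zero_iff)
  define E where "E = exp (\<i> * (of_real pi * w))"
  have E0: "E \<noteq> 0" by (simp add: E_def)
  have q: "ee w = E ^ 2" by (simp add: E_def ee_def power2_eq_square exp_add[symmetric] algebra_simps)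
  have q1: "norm (ee w) < 1" using norm_ee_less_1[OF w] .
  then have q1': "ee w \<noteq> 1" by auto
  have sin: "sin (of_real pi * w) = (E - 1 / E) / (2 * \<i>)"
    and cos: "cos (of_real pi * w) = (E + 1 / E) / 2"
    by (simp_all add: sin_exp_eq cos_exp_eq E_def exp_minus inverse_eq_divide)
  have "Digamma (1 - w) - Digamma w = pi * cos (of_real pi * w) / sin (of_real pi * w)"
    using eq sn unfolding rGamma_reflection_complex by (simp add: field_simps)
  also have "\<dots> = pi * \<i> - 2 * pi * \<i> / (1 - ee w)"
  proof -
    have "cos (of_real pi * w) * (1 - ee w) = - \<i> * sin (of_real pi * w) * (1 + ee w)"
      unfolding sin cos q using E0 by (simp add: field_simps power2_eq_square)
    then have "cos (of_real pi * w) / sin (of_real pi * w) = - \<i> * (1 + ee w) / (1 - ee w)"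
      using sn q1' by (simp add: field_simps)
    then have "pi * cos (of_real pi * w) / sin (of_real pi * w) = pi * (- \<i> * (1 + ee w) / (1 - ee w))"
      by (metis times_divide_eq_right)
    also have "\<dots> = pi * \<i> - 2 * pi * \<i> / (1 - ee w)" using q1' by (simp add: field_simps)
    finally show ?thesis .
  qed
  also have "npow_series 0 (ee w) = 1 / (1 - ee w)"
    using q1 by (simp add: npow_series_def suminf_geometric)
  then have "pi * \<i> - 2 * pi * \<i> / (1 - ee w) = pi * \<i> - 2 * pi * \<i> * npow_series 0 (ee w)" by simp
  finally show ?thesis by (simp add: refl_polygamma_def)
qed

text \<open>Repeated differentiation of \<open>refl_digamma\<close>. The constant \<pi> i disappears
  after one step, which is why the formula starts at index 1; each step contributes a factor -2
  \<pi> i.\<close>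

lemma refl_polygamma_eq:
  assumes "Im w > 0"
  shows "refl_polygamma (Suc m) w = (- 2 * pi * \<i>) ^ (m + 2) * npow_series (Suc m) (ee w)"
  using assms
proof (induction m arbitrary: w)
  case 0
  have "((\<lambda>w. pi * \<i> - 2 * pi * \<i> * npow_series 0 (ee w)) has_field_derivative
      (- (2 * pi * \<i> * (2 * pi * \<i> * npow_series (Suc 0) (ee w))))) (at w)"
    by (rule derivative_eq_intros npow_series_ee_deriv 0 refl | simp)+
  then have "(refl_polygamma 0 has_field_derivative
      (- (2 * pi * \<i> * (2 * pi * \<i> * npow_series (Suc 0) (ee w))))) (at w)"
    by (rule has_field_derivative_transform_within_open[where S = "{w. Im w > 0}"])
      (use 0 refl_digamma in \<open>auto simp: open_halfspace_Im_gt\<close>)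
  from DERIV_unique[OF this refl_polygamma_deriv[OF 0]]
  show ?case by (simp add: power2_eq_square mult_ac)
next
  case (Suc m)
  have "((\<lambda>w. (- 2 * pi * \<i>) ^ (m + 2) * npow_series (Suc m) (ee w)) has_field_derivative
      ((- 2 * pi * \<i>) ^ (m + 2) * (2 * pi * \<i> * npow_series (Suc (Suc m)) (ee w)))) (at w)"
    by (rule DERIV_cmult npow_series_ee_deriv Suc.prems)+
  then have "(refl_polygamma (Suc m) has_field_derivative
      ((- 2 * pi * \<i>) ^ (m + 2) * (2 * pi * \<i> * npow_series (Suc (Suc m)) (ee w)))) (at w)"
    by (rule has_field_derivative_transform_within_open[where S = "{w. Im w > 0}"])
      (use Suc in \<open>auto simp: open_halfspace_Im_gt\<close>)
  from DERIV_unique[OF this refl_polygamma_deriv[OF Suc.prems]]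
  show ?case by (simp add: mult_ac)
qed

lemma infsum_nat_eq_suminf:
  fixes f :: "nat \<Rightarrow> 'a :: banach"
  assumes "f summable_on UNIV"
  shows "infsum f UNIV = suminf f"
  using has_sum_imp_sums[OF has_sum_infsum[OF assms]] by (simp add: sums_iff)

lemma inverse_power_int_summable:
  assumes "Im w \<noteq> 0" "k \<ge> 2"
  shows "(\<lambda>n::int. inverse (w + of_int n) ^ k) summable_on UNIV"
  using lterm_summable_line(2)[of "2 * w" "1/2" 0 k 0] assms by (simp add: lterm_def)

theorem Lipschitz_formula:
  assumes w: "Im w > 0" and k: "k \<ge> 2"
  shows "(\<Sum>\<^sub>\<infinity>n::int. inverse (w + of_int n) ^ k) =
    (- 2 * pi * \<i>) ^ k / fact (k - 1) * npow_series (k - 1) (ee w)"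
proof -
  define f where "f n = inverse (w + of_int n) ^ k" for n :: int
  obtain m where m: "k = m + 2" using k by (metis le_add_diff_inverse add.commute)
  have S: "f summable_on UNIV" unfolding f_def using w k by (intro inverse_power_int_summable) auto
  \<comment> \<open>j enumerates the negative integers as n = -1 - j; then w + n = -(1 - w + j),
    which leads to the polygamma function at 1 - w.\<close>
  have inj: "inj_on (\<lambda>j. - 1 - int j) UNIV" by (auto simp: inj_on_def)
  have S1: "f summable_on range int" and S2: "f summable_on range (\<lambda>j. - 1 - int j)"
    by (rule summable_on_subset[OF S]; simp)+
  have N1: "(\<lambda>n. f (int n)) summable_on UNIV" and N2: "(\<lambda>n. f (- 1 - int n)) summable_on UNIV"
    using S1 S2 by (simp_all add: summable_on_reindex inj o_def)
  have "UNIV = range int \<union> range (\<lambda>j. - 1 - int j)"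
  proof -
    have "x \<in> range int \<union> range (\<lambda>j. - 1 - int j)" for x :: int
    proof (cases "x \<ge> 0")
      case True
      then have "x = int (nat x)" by simp
      then show ?thesis by blast
    next
      case False
      then have "x = - 1 - int (nat (- 1 - x))" by simp
      then show ?thesis by blast
    qed
    then show ?thesis by blast
  qed
  moreover have "range int \<inter> range (\<lambda>j. - 1 - int j) = {}" by auto
  ultimately have "infsum f UNIV = infsum f (range int) + infsum f (range (\<lambda>j. - 1 - int j))"
    using infsum_Un_disjoint[OF S1 S2] by simp
  also have "\<dots> = (\<Sum>n. f (int n)) + (\<Sum>n. f (- 1 - int n))"
    using infsum_nat_eq_suminf[OF N1] infsum_nat_eq_suminf[OF N2] by (simp add: infsum_reindex inj o_def)
  also have "(\<Sum>n. f (int n)) = (- 1) ^ k / fact (k - 1) * Polygamma (k - 1) w"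
  proof -
    have "Polygamma (k - 1) w = (- 1) ^ k * (fact (k - 1) * (\<Sum>n. f (int n)))"
      by (simp add: f_def Polygamma_def m power_inverse del: fact_Suc)
    moreover have "(- 1) ^ k * (- 1) ^ k = (1 :: complex)" by (simp add: power_mult_distrib[symmetric])
    ultimately show ?thesis by (simp add: field_simps del: fact_Suc)
  qed
  also have "(\<Sum>n. f (- 1 - int n)) = 1 / fact (k - 1) * Polygamma (k - 1) (1 - w)"
  proof -
    have "f (- 1 - int n) = (- 1) ^ k * inverse ((1 - w + of_nat n) ^ k)" for n
    proof -
      have "w + of_int (- 1 - int n) = - (1 - w + of_nat n)" by simp
      then show ?thesis unfolding f_def
        by (simp only: inverse_minus_eq power_minus[of "inverse _"] power_inverse)
    qed
    moreover have "summable (\<lambda>n. inverse ((1 - w + of_nat n) ^ k))"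
      by (rule Polygamma_converges') (use w k in auto)
    ultimately have "(\<Sum>n. f (- 1 - int n)) = (- 1) ^ k * (\<Sum>n. inverse ((1 - w + of_nat n) ^ k))"
      by (simp add: suminf_mult)
    moreover have "Polygamma (k - 1) (1 - w) = (- 1) ^ k * (fact (k - 1) * (\<Sum>n. inverse ((1 - w + of_nat n) ^ k)))"
      by (simp add: Polygamma_def m del: fact_Suc)
    ultimately show ?thesis by (simp del: fact_Suc)
  qed
  also have "(- 1) ^ k / fact (k - 1) * Polygamma (k - 1) w + 1 / fact (k - 1) * Polygamma (k - 1) (1 - w)
     = refl_polygamma (k - 1) w / fact (k - 1)"
    by (simp add: refl_polygamma_def m add_divide_distrib)
  also have "refl_polygamma (k - 1) w = (- 2 * pi * \<i>) ^ k * npow_series (k - 1) (ee w)"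
    using refl_polygamma_eq[OF w, of m] by (simp add: m)
  finally show ?thesis by (simp add: f_def)
qed

section \<open>Eisenstein series with characters\<close>

lemma sum_periodic_mult_units:
  fixes h :: "int \<Rightarrow> int \<Rightarrow> 'a::comm_monoid_add"
  assumes "\<And>i j. h (i + int q) j = h i j" "\<And>i j. h i (j + int q') = h i j"
    and "coprime u (int q)" "coprime v (int q')" and "q \<ge> 1" "q' \<ge> 1"
  shows "(\<Sum>r<q. \<Sum>s<q'. h (u * int r) (v * int s)) = (\<Sum>r<q. \<Sum>s<q'. h (int r) (int s))"
proof -
  have "(\<Sum>r<q. \<Sum>s<q'. h (u * int r) (v * int s)) = (\<Sum>r<q. \<Sum>s<q'. h (u * int r) (int s))"
    by (intro sum.cong refl sum_periodic_mult_unit assms)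
  also have "\<dots> = (\<Sum>s<q'. \<Sum>r<q. h (u * int r) (int s))" by (rule sum.swap)
  also have "\<dots> = (\<Sum>s<q'. \<Sum>r<q. h (int r) (int s))"
    by (intro sum.cong refl sum_periodic_mult_unit[of "\<lambda>i. h i _"] assms)
  also have "\<dots> = (\<Sum>r<q. \<Sum>s<q'. h (int r) (int s))" by (rule sum.swap)
  finally show ?thesis .
qed

lemma coprime_quotient_not_Int:
  assumes "coprime n (int q)" "q > 1"
  shows "of_int n / of_nat q \<notin> (\<int> :: real set)"
proof
  assume "of_int n / of_nat q \<in> (\<int> :: real set)"
  then obtain m where "of_int n / of_nat q = (of_int m :: real)" by (auto elim: Ints_cases)
  then have "of_int n = (of_int (m * int q) :: real)" using assms by (simp add: field_simps)
  then have "n = m * int q" by (simp only: of_int_eq_iff)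
  then show False using assms by auto
qed

lemma has_sum_finite_sum:
  fixes f :: "'a \<Rightarrow> 'b \<Rightarrow> 'c::topological_comm_monoid_add"
  assumes "finite A" "\<And>a. a \<in> A \<Longrightarrow> (f a has_sum s a) B"
  shows "((\<lambda>x. \<Sum>a\<in>A. f a x) has_sum (\<Sum>a\<in>A. s a)) B"
  using assms by (induction A rule: finite_induct) (auto intro: has_sum_add has_sum_0)

text \<open>At \<tau> = q1 z and for k \<ge> 3, with non-trivial characters, this is q2^k times the
  classical sum of ch1(c) ch2(d) (c q2 z + d)^-k over all integers c, d; the form chosen here makes
  sense for k = 2 as well.\<close>

definition eis_lat :: "nat \<Rightarrow> nat \<Rightarrow> (int \<Rightarrow> complex) \<Rightarrow> (int \<Rightarrow> complex) \<Rightarrow> nat \<Rightarrow> complex \<Rightarrow> complex" where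
  "eis_lat q1 q2 ch1 ch2 k \<tau> =
     (\<Sum>r<q1. \<Sum>s<q2. ch1 (int r) * ch2 (int s) * lwp \<tau> k (of_nat r / of_nat q1) (of_nat s / of_nat q2))"

locale eis_pair =
  fixes q1 q2 k :: nat and ch1 ch2 :: "int \<Rightarrow> complex"
  assumes k: "k \<ge> 2"
    and pr1: "primitive_dchar q1 ch1" and nt1: "nontrivial_dchar q1 ch1"
    and pr2: "primitive_dchar q2 ch2" and nt2: "nontrivial_dchar q2 ch2"
    and parity: "ch1 (-1) * ch2 (-1) = (-1) ^ k"
begin

text \<open>The hypotheses are symmetric in the two characters, so every result of the locale is
  also available for E21.\<close>

lemma swap: "eis_pair q2 q1 k ch2 ch1"
  using k pr1 nt1 pr2 nt2 parity by unfold_locales (simp_all add: mult.commute)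

lemma d1: "dchar q1 ch1" and d2: "dchar q2 ch2"
  using pr1 pr2 by (simp_all add: primitive_dchar_def)

lemma q1: "q1 > 1" and q2: "q2 > 1"
  using nontrivial_modulus d1 d2 nt1 nt2 by blast+

lemma ch1_nonzeroD: "ch1 i \<noteq> 0 \<Longrightarrow> nonlat (of_int i / of_nat q1) y"
  using coprime_quotient_not_Int[OF _ q1] dchar_nonzero_iff[OF d1] by (auto simp: nonlat_def)

lemma ch2_nonzeroD: "ch2 i \<noteq> 0 \<Longrightarrow> nonlat x (of_int i / of_nat q2)"
  using coprime_quotient_not_Int[OF _ q2] dchar_nonzero_iff[OF d2] by (auto simp: nonlat_def)

text \<open>The discrepancy between two reference points is independent of (r, s) and gets
  multiplied by the complete sum of ch1, which is zero. X and Y are left general so that a linear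
  change of coordinates can come before.\<close>

lemma char_sum_change_reference:
  assumes \<tau>: "Im \<tau> \<noteq> 0" and nl: "nonlat x' y'"
    and XY: "\<And>r s. ch1 (int r) \<noteq> 0 \<Longrightarrow> ch2 (int s) \<noteq> 0 \<Longrightarrow> nonlat (X r s) (Y r s)"
  shows "(\<Sum>r<q1. \<Sum>s<q2. ch1 (int r) * ch2 (int s) * ldiff \<tau> k (X r s) (Y r s) x' y') =
    (\<Sum>r<q1. \<Sum>s<q2. ch1 (int r) * ch2 (int s) * lwp \<tau> k (X r s) (Y r s))"
proof -
  have "ch1 (int r) * ch2 (int s) * lwp \<tau> k (X r s) (Y r s) =
      ch1 (int r) * ch2 (int s) * ldiff \<tau> k (X r s) (Y r s) x' y' + ch1 (int r) * (ch2 (int s) * lwp \<tau> k x' y')" for r s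
    using XY[of r s] ldiff_trans[OF \<tau> _ nl nonlat_half(1)[of "1/2"] k, of "X r s" "Y r s"]
    by (cases "ch1 (int r) = 0 \<or> ch2 (int s) = 0") (auto simp: lwp_def algebra_simps)
  moreover have "(\<Sum>r<q1. \<Sum>s<q2. ch1 (int r) * (ch2 (int s) * lwp \<tau> k x' y')) = 0"
    by (simp add: sum_distrib_left[symmetric] sum_distrib_right[symmetric] sum_nontrivial_dchar[OF d1 nt1])
  ultimately show ?thesis by (simp add: sum.distrib)
qed

definition char_lwp :: "complex \<Rightarrow> int \<Rightarrow> int \<Rightarrow> complex" where
  "char_lwp \<tau> i j = ch1 i * ch2 j * lwp \<tau> k (of_int i / of_nat q1) (of_int j / of_nat q2)"

lemma char_lwp_periodic:
  assumes "Im \<tau> \<noteq> 0"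
  shows "char_lwp \<tau> (i + int q1) j = char_lwp \<tau> i j" "char_lwp \<tau> i (j + int q2) = char_lwp \<tau> i j"
proof -
  have c: "ch1 (i + int q1) = ch1 i" "ch2 (j + int q2) = ch2 j"
    using d1 d2 by (simp_all add: dchar_def)
  have x: "of_int (i + int q1) / real q1 = of_int i / real q1 + 1"
    "of_int (j + int q2) / real q2 = of_int j / real q2 + 1"
    using q1 q2 by (simp_all add: add_divide_distrib)
  show "char_lwp \<tau> (i + int q1) j = char_lwp \<tau> i j"
    using lwp_shift1(1)[OF assms ch1_nonzeroD k] unfolding char_lwp_def c x
    by (cases "ch1 i = 0") auto
  show "char_lwp \<tau> i (j + int q2) = char_lwp \<tau> i j"
    using lwp_shift1(2)[OF assms ch2_nonzeroD k] unfolding char_lwp_def c x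
    by (cases "ch2 j = 0") auto
qed

lemma eis_lat_mult_units:
  assumes "Im \<tau> \<noteq> 0" "coprime u (int q1)" "coprime v (int q2)"
  shows "(\<Sum>r<q1. \<Sum>s<q2. char_lwp \<tau> (u * int r) (v * int s)) = eis_lat q1 q2 ch1 ch2 k \<tau>"
  using sum_periodic_mult_units[of "char_lwp \<tau>" q1 q2 u v] char_lwp_periodic[OF assms(1)] assms q1 q2
  by (simp add: eis_lat_def char_lwp_def)

text \<open>On ch1 the unit a is inverse to d, and on ch2 the effect of d is undone by complex
  conjugation; permuting the residues by these units therefore leaves the factor ch1(d)
  conj(ch2(d)).\<close>

lemma eis_lat_Gamma0:
  fixes a b c d :: int
  assumes det: "a * d - b * (c * int (q1 * q2)) = 1" and \<tau>: "Im \<tau> \<noteq> 0"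
    and nz: "of_int (c * int q2) * \<tau> + of_int d \<noteq> 0"
  shows "eis_lat q1 q2 ch1 ch2 k ((of_int a * \<tau> + of_int (b * int q1)) / (of_int (c * int q2) * \<tau> + of_int d))
    = psi ch1 ch2 d * (of_int (c * int q2) * \<tau> + of_int d) ^ k * eis_lat q1 q2 ch1 ch2 k \<tau>"
proof -
  let ?j = "of_int (c * int q2) * \<tau> + of_int d"
  have det': "a * d - (b * int q1) * (c * int q2) = 1" using det by (simp add: algebra_simps)
  have cong1: "[d * a = 1] (mod int q1)"
  proof -
    have "d * a - 1 = int q1 * (b * c * int q2)" using det by (simp add: algebra_simps)
    then show ?thesis by (metis cong_iff_dvd_diff dvd_triv_left)
  qed
  have cong2: "[d * a = 1] (mod int q2)"
  proof -
    have "d * a - 1 = int q2 * (b * c * int q1)" using det by (simp add: algebra_simps)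
    then show ?thesis by (metis cong_iff_dvd_diff dvd_triv_left)
  qed
  have da: "ch1 d * ch1 a = 1"
    using dchar_cong[OF d1 cong1] dchar_mult[OF d1] dchar_1[OF d1] by simp
  have "ch2 d * ch2 a = 1"
    using dchar_cong[OF d2 cong2] dchar_mult[OF d2] dchar_1[OF d2] by simp
  then have "ch2 d \<noteq> 0" by auto
  then have cd: "coprime d (int q2)" using dchar_nonzero_iff[OF d2] by simp
  have "ch1 a \<noteq> 0" using da by auto
  then have ca: "coprime a (int q1)" using dchar_nonzero_iff[OF d1] by simp
  define X :: "nat \<Rightarrow> nat \<Rightarrow> real" where "X r s = of_nat r / of_nat q1 * of_int a + of_nat s / of_nat q2 * of_int (c * int q2)" for r s
  define Y :: "nat \<Rightarrow> nat \<Rightarrow> real" where "Y r s = of_nat r / of_nat q1 * of_int (b * int q1) + of_nat s / of_nat q2 * of_int d" for r s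
  have X: "X r s = of_int (a * int r) / of_nat q1 + of_int (int s * c)" for r s
    using q2 by (simp add: X_def field_simps)
  have Y: "Y r s = of_int (d * int s) / of_nat q2 + of_int (int r * b)" for r s
    using q1 by (simp add: Y_def field_simps)
  have nlXY: "nonlat (of_int (a * int r) / of_nat q1) (of_int (d * int s) / of_nat q2)" if "ch1 (int r) \<noteq> 0" for r s
  proof -
    have "ch1 (a * int r) \<noteq> 0" using that da by (auto simp: dchar_mult[OF d1])
    then show ?thesis by (rule ch1_nonzeroD)
  qed
  \<comment> \<open>The image of the reference point (1/2, 1/2) under the matrix.\<close>
  define x' y' :: real where "x' = 1/2 * of_int a + 1/2 * of_int (c * int q2)"
    and "y' = (1/2 * of_int (b * int q1) + 1/2 * of_int d :: real)"
  have nl': "nonlat x' y'"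
  proof (rule ccontr)
    assume "\<not> nonlat x' y'"
    then obtain m n where mn: "x' = of_int m" "y' = of_int n" by (auto simp: nonlat_def elim!: Ints_cases)
    then have "real_of_int (a + c * int q2) = of_int (2 * m)" "real_of_int (b * int q1 + d) = of_int (2 * n)"
      by (simp_all add: x'_def y'_def)
    then have e: "a + c * int q2 = 2 * m" "b * int q1 + d = 2 * n" by (simp_all only: of_int_eq_iff)
    \<comment> \<open>Modulo 2 the row vector (1, 1) would be annihilated by a matrix of odd
      determinant.\<close>
    have "even (a + c * int q2)" "even (b * int q1 + d)" using e by simp_all
    moreover have "odd (a * d - (b * int q1) * (c * int q2))" by (simp add: det')
    ultimately show False by (auto simp del: of_nat_mult)
  qed
  have "eis_lat q1 q2 ch1 ch2 k ((of_int a * \<tau> + of_int (b * int q1)) / ?j) =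
      (\<Sum>r<q1. \<Sum>s<q2. ?j ^ k * (ch1 (int r) * ch2 (int s) * ldiff \<tau> k (X r s) (Y r s) x' y'))"
    unfolding eis_lat_def lwp_def ldiff_SL2[OF det' nz] X_def Y_def x'_def y'_def by (simp add: mult_ac)
  also have "\<dots> = ?j ^ k * (\<Sum>r<q1. \<Sum>s<q2. ch1 (int r) * ch2 (int s) * ldiff \<tau> k (X r s) (Y r s) x' y')"
    by (simp add: sum_distrib_left)
  also have "(\<Sum>r<q1. \<Sum>s<q2. ch1 (int r) * ch2 (int s) * ldiff \<tau> k (X r s) (Y r s) x' y') =
      (\<Sum>r<q1. \<Sum>s<q2. ch1 (int r) * ch2 (int s) * lwp \<tau> k (X r s) (Y r s))"
    by (rule char_sum_change_reference[OF \<tau> nl']) (use nlXY in \<open>simp only: X Y nonlat_shift\<close>)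
  also have "\<dots> = (\<Sum>r<q1. \<Sum>s<q2. psi ch1 ch2 d * char_lwp \<tau> (a * int r) (d * int s))"
  proof (intro sum.cong refl)
    fix r s
    show "ch1 (int r) * ch2 (int s) * lwp \<tau> k (X r s) (Y r s) = psi ch1 ch2 d * char_lwp \<tau> (a * int r) (d * int s)"
    proof (cases "ch1 (int r) = 0")
      case True then show ?thesis by (simp add: char_lwp_def dchar_mult[OF d1])
    next
      case False
      have "lwp \<tau> k (X r s) (Y r s) = lwp \<tau> k (of_int (a * int r) / of_nat q1) (of_int (d * int s) / of_nat q2)"
        unfolding X Y by (rule lwp_shift[OF \<tau> nlXY[OF False] k])
      moreover have "psi ch1 ch2 d * (ch1 (a * int r) * ch2 (d * int s)) =
          (ch1 d * ch1 a) * (cnj (ch2 d) * ch2 d) * (ch1 (int r) * ch2 (int s))"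
        by (simp add: psi_def dchar_mult[OF d1] dchar_mult[OF d2])
      then have "psi ch1 ch2 d * (ch1 (a * int r) * ch2 (d * int s)) = ch1 (int r) * ch2 (int s)"
        using da dchar_cnj_mult[OF d2 cd] by simp
      ultimately show ?thesis by (simp add: char_lwp_def mult.assoc[symmetric])
    qed
  qed
  also have "\<dots> = psi ch1 ch2 d * eis_lat q1 q2 ch1 ch2 k \<tau>"
    by (simp only: sum_distrib_left[symmetric] eis_lat_mult_units[OF \<tau> ca cd])
  finally show ?thesis by (simp add: mult_ac)
qed

text \<open>The inversion takes (x, y) to (y, -x): the two characters trade places, and reflecting s
  costs ch2(-1).\<close>

lemma eis_lat_inversion:
  assumes \<tau>: "Im \<tau> \<noteq> 0"
  shows "eis_lat q2 q1 ch2 ch1 k (- 1 / \<tau>) = ch2 (-1) * \<tau> ^ k * eis_lat q1 q2 ch1 ch2 k \<tau>"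
proof -
  have nz: "\<tau> \<noteq> 0" using \<tau> by auto
  have nl: "nonlat (1/2) (- (1/2))" by simp
  have S: "lwp (- 1 / \<tau>) k x y = \<tau> ^ k * ldiff \<tau> k y (- x) (1/2) (- (1/2))" for x y
    using ldiff_SL2[of 0 0 "-1" 1 \<tau> k x y "1/2" "1/2"] nz by (simp add: lwp_def)
  have sq: "ch2 (-1) * ch2 (-1) = 1"
    using dchar_mult[OF d2, of "-1" "-1"] dchar_1[OF d2] by simp
  have "eis_lat q2 q1 ch2 ch1 k (- 1 / \<tau>) =
      \<tau> ^ k * (\<Sum>s<q2. \<Sum>r<q1. ch1 (int r) * ch2 (int s) * ldiff \<tau> k (of_nat r / of_nat q1) (- (of_nat s / of_nat q2)) (1/2) (- (1/2)))"
    unfolding eis_lat_def S by (simp add: sum_distrib_left mult_ac)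
  also have "(\<Sum>s<q2. \<Sum>r<q1. ch1 (int r) * ch2 (int s) * ldiff \<tau> k (of_nat r / of_nat q1) (- (of_nat s / of_nat q2)) (1/2) (- (1/2))) =
      (\<Sum>r<q1. \<Sum>s<q2. ch1 (int r) * ch2 (int s) * ldiff \<tau> k (of_nat r / of_nat q1) (- (of_nat s / of_nat q2)) (1/2) (- (1/2)))"
    by (rule sum.swap)
  also have "\<dots> = (\<Sum>r<q1. \<Sum>s<q2. ch1 (int r) * ch2 (int s) * lwp \<tau> k (of_nat r / of_nat q1) (- (of_nat s / of_nat q2)))"
  proof (rule char_sum_change_reference[OF \<tau> nl])
    fix r s assume "ch1 (int r) \<noteq> 0"
    then show "nonlat (of_nat r / of_nat q1) (- (of_nat s / of_nat q2))"
      using ch1_nonzeroD[of "int r"] by simp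
  qed
  also have "\<dots> = (\<Sum>r<q1. \<Sum>s<q2. ch2 (-1) * char_lwp \<tau> (1 * int r) (-1 * int s))"
  proof (intro sum.cong refl)
    fix r s
    have "ch2 (-1 * int s) = ch2 (-1) * ch2 (int s)" by (rule dchar_mult[OF d2])
    then have "ch2 (int s) = ch2 (-1) * ch2 (-1 * int s)" using sq by (simp add: mult.assoc[symmetric])
    then show "ch1 (int r) * ch2 (int s) * lwp \<tau> k (of_nat r / of_nat q1) (- (of_nat s / of_nat q2)) =
        ch2 (-1) * char_lwp \<tau> (1 * int r) (-1 * int s)" by (simp add: char_lwp_def)
  qed
  also have "\<dots> = ch2 (-1) * eis_lat q1 q2 ch1 ch2 k \<tau>"
    by (simp only: sum_distrib_left[symmetric]) (subst eis_lat_mult_units[OF \<tau>]; simp)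
  finally show ?thesis by (simp add: mult_ac)
qed

end

section \<open>Fourier expansion of the character-weighted lattice sums\<close>

lemma infsum_atLeast1_nat:
  fixes f :: "nat \<Rightarrow> 'a :: banach"
  assumes "f summable_on {1..}"
  shows "infsum f {1..} = (\<Sum>n. f (Suc n))" "summable (\<lambda>n. f (Suc n))"
proof -
  have r: "{1..} = range Suc" by (auto simp: image_iff Suc_le_D)
  have "(\<lambda>n. f (Suc n)) summable_on UNIV"
    using assms unfolding r by (simp add: summable_on_reindex o_def)
  then show "infsum f {1..} = (\<Sum>n. f (Suc n))" "summable (\<lambda>n. f (Suc n))"
    unfolding r by (simp_all add: infsum_reindex o_def infsum_nat_eq_suminf summable_on_imp_summable)
qed

lemma npow_geometric_summable_on:
  fixes \<rho> :: real
  assumes "0 \<le> \<rho>" "\<rho> < 1"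
  shows "(\<lambda>n::nat. of_nat n ^ m * \<rho> ^ n) summable_on A"
proof -
  have "summable (\<lambda>n. norm (of_nat n ^ m * complex_of_real \<rho> ^ n))"
  proof (rule powser_insidea)
    show "summable (\<lambda>n. of_nat n ^ m * complex_of_real ((1 + \<rho>) / 2) ^ n)"
      by (rule npow_series_summable) (use assms in \<open>simp only: norm_of_real; simp\<close>)
    show "norm (complex_of_real \<rho>) < norm (complex_of_real ((1 + \<rho>) / 2))"
      using assms by (simp only: norm_of_real; simp)
  qed
  then have "summable (\<lambda>n. norm (real n ^ m * \<rho> ^ n))"
    using assms by (simp add: norm_mult norm_power)
  then have "(\<lambda>n::nat. of_nat n ^ m * \<rho> ^ n) summable_on UNIV"
    by (rule norm_summable_imp_summable_on)
  then show ?thesis by (rule summable_on_subset) simp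
qed

text \<open>For c, l \<ge> 1 one has c l \<ge> c + l - 1, which decouples the exponents. The missing
  power is paid for by the factor 1/\<rho>, so q = 0 is a separate case.\<close>

lemma dirichlet_double_series_summable:
  fixes f :: "nat \<Rightarrow> nat \<Rightarrow> complex"
  assumes q: "cmod q < 1" and f: "\<And>c l. cmod (f c l) \<le> real l ^ m"
  shows "(\<lambda>(c, l). f c l * q ^ (c * l)) summable_on ({1..} \<times> {1..})"
proof (cases "q = 0")
  case True
  then show ?thesis
    by (intro summable_on_cong[THEN iffD2, OF _ summable_on_0]) auto
next
  case False
  let ?\<rho> = "cmod q"
  have "(\<lambda>(c, l). (real c ^ 0 * ?\<rho> ^ c) * (1 / ?\<rho> * (real l ^ m * ?\<rho> ^ l))) summable_on ({1..} \<times> {1..})"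
    by (intro summable_on_product_nonneg npow_geometric_summable_on summable_on_cmult_right) (use q in auto)
  then have "(\<lambda>p. norm (case p of (c, l) \<Rightarrow> f c l * q ^ (c * l))) summable_on ({1..} \<times> {1..})"
  proof (rule Infinite_Sum.abs_summable_on_comparison_test')
    fix p :: "nat \<times> nat" assume "p \<in> {1..} \<times> {1..}"
    then obtain c l where p: "p = (Suc c, Suc l)" by (auto simp: Suc_le_D) (metis Suc_le_D)
    have "cmod (f (Suc c) (Suc l) * q ^ (Suc c * Suc l)) \<le> real (Suc l) ^ m * ?\<rho> ^ (Suc c * Suc l)"
      unfolding norm_mult norm_power by (intro mult_right_mono f) auto
    also have "\<dots> \<le> real (Suc l) ^ m * ?\<rho> ^ (Suc c + l)"
      by (intro mult_left_mono power_decreasing) (use q in auto)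
    also have "\<dots> = (real (Suc c) ^ 0 * ?\<rho> ^ Suc c) * (1 / ?\<rho> * (real (Suc l) ^ m * ?\<rho> ^ Suc l))"
      using False by (simp add: power_add del: of_nat_Suc)
    finally show "norm (case p of (c, l) \<Rightarrow> f c l * q ^ (c * l))
        \<le> (case p of (c, l) \<Rightarrow> (real c ^ 0 * ?\<rho> ^ c) * (1 / ?\<rho> * (real l ^ m * ?\<rho> ^ l)))"
      by (simp only: p prod.case)
  qed
  then show ?thesis by (rule Infinite_Sum.abs_summable_summable)
qed

lemma divisor_pairs_bij:
  "bij_betw (\<lambda>(M, A). (A, M div A)) (Sigma {1..} (\<lambda>M. {A. A dvd M})) ({1..} \<times> {1..} :: (nat \<times> nat) set)"
proof (rule bij_betw_byWitness[where f' = "\<lambda>(A, B). (A * B, A)"])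
  show "(\<lambda>(M, A). (A, M div A)) ` (Sigma {1..} (\<lambda>M. {A. A dvd M})) \<subseteq> ({1..} \<times> {1..} :: (nat \<times> nat) set)"
    by (auto simp: Suc_le_eq elim!: dvdE)
qed (auto simp: Suc_le_eq)

context eis_pair
begin

definition eis_row :: "complex \<Rightarrow> int \<Rightarrow> int \<Rightarrow> complex" where
  "eis_row z c j = (\<Sum>\<^sub>\<infinity>n::int. inverse (of_int c * z + of_int j / of_nat q2 + of_int n) ^ k)"

definition eis_char_row :: "complex \<Rightarrow> int \<Rightarrow> complex" where
  "eis_char_row z c = (\<Sum>s<q2. ch2 (int s) * eis_row z c (int s))"

text \<open>In weight 2 only the differences are summable over the whole lattice, so the finite sum
  over (r, s) is carried out first, in \<open>blk\<close>, where the reference terms cancel exactly.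
  After that the rows, each convergent by itself, can be summed over n. The row index m q1 + r is
  the coefficient of z.\<close>

lemma eis_lat_eq_rows:
  assumes z: "Im z > 0"
  shows "eis_lat q1 q2 ch1 ch2 k (of_nat q1 * z) =
    (\<Sum>\<^sub>\<infinity>m::int. \<Sum>r<q1. ch1 (m * int q1 + int r) * eis_char_row z (m * int q1 + int r))"
proof -
  define \<tau> where "\<tau> = of_nat q1 * z"
  have \<tau>: "Im \<tau> \<noteq> 0" using z q1 by (simp add: \<tau>_def)
  define x where "x r = real r / real q1" for r
  define y where "y s = real s / real q2" for s
  define blk where "blk p = (\<Sum>r<q1. \<Sum>s<q2. ch1 (int r) * ch2 (int s) * ldiff_term \<tau> k (x r) (y s) (1/2) (1/2) p)" for p
  have nl: "nonlat (x r) y'" if "ch1 (int r) \<noteq> 0" for r y'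
    using ch1_nonzeroD[OF that] by (simp add: x_def)
  have "(blk has_sum eis_lat q1 q2 ch1 ch2 k \<tau>) UNIV"
    unfolding blk_def eis_lat_def
  proof (intro has_sum_finite_sum finite_lessThan)
    fix r s
    show "((\<lambda>p. ch1 (int r) * ch2 (int s) * ldiff_term \<tau> k (x r) (y s) (1/2) (1/2) p) has_sum
        ch1 (int r) * ch2 (int s) * lwp \<tau> k (of_nat r / of_nat q1) (of_nat s / of_nat q2)) UNIV"
    proof (cases "ch1 (int r) = 0")
      case False
      have "(ldiff_term \<tau> k (x r) (y s) (1/2) (1/2) has_sum lwp \<tau> k (x r) (y s)) UNIV"
        unfolding lwp_def ldiff_def by (intro has_sum_infsum ldiff_term_summable \<tau> nl False k) simp
      then show ?thesis by (intro has_sum_cmult_right) (simp add: x_def y_def)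
    qed simp
  qed
  then have bs: "blk summable_on UNIV" "infsum blk UNIV = eis_lat q1 q2 ch1 ch2 k \<tau>"
    by (auto simp: summable_on_def infsumI)
  have blk: "blk (m, n) = (\<Sum>r<q1. \<Sum>s<q2. ch1 (int r) * ch2 (int s) * lterm \<tau> k (of_int m + x r) (of_int n + y s))" for m n
  proof -
    have "(\<Sum>r<q1. \<Sum>s<q2. ch1 (int r) * (ch2 (int s) * lterm \<tau> k (of_int m + 1/2) (of_int n + 1/2))) = 0"
      by (simp add: sum_distrib_left[symmetric] sum_distrib_right[symmetric] sum_nontrivial_dchar[OF d1 nt1])
    then show ?thesis
      by (simp add: blk_def ldiff_term_def right_diff_distrib sum_subtractf mult.assoc)
  qed
  have lt: "lterm \<tau> k (of_int m + x r) (of_int n + y s) =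
      inverse (of_int (m * int q1 + int r) * z + of_int (int s) / of_nat q2 + of_int n) ^ k" for m n r s
  proof -
    have "of_real (of_int m + x r) * \<tau> = of_int (m * int q1 + int r) * z"
      using q1 by (simp add: x_def \<tau>_def field_simps)
    then show ?thesis by (simp add: lterm_def y_def add_ac)
  qed
  have "((\<lambda>n. blk (m, n)) has_sum (\<Sum>r<q1. \<Sum>s<q2. ch1 (int r) * ch2 (int s) * eis_row z (m * int q1 + int r) (int s))) UNIV" for m
    unfolding blk
  proof (intro has_sum_finite_sum finite_lessThan)
    fix r s
    show "((\<lambda>n. ch1 (int r) * ch2 (int s) * lterm \<tau> k (of_int m + x r) (of_int n + y s)) has_sum
        ch1 (int r) * ch2 (int s) * eis_row z (m * int q1 + int r) (int s)) UNIV"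
    proof (cases "ch1 (int r) = 0")
      case False
      have "((\<lambda>n::int. lterm \<tau> k (of_int m + x r) (of_int n + y s)) has_sum eis_row z (m * int q1 + int r) (int s)) UNIV"
        using has_sum_infsum[OF lterm_summable_line(2)[OF \<tau> nl[OF False] k, of m "y s"]]
        unfolding lt eis_row_def .
      then show ?thesis by (rule has_sum_cmult_right)
    qed simp
  qed
  then have row: "(\<Sum>\<^sub>\<infinity>n. blk (m, n)) = (\<Sum>r<q1. \<Sum>s<q2. ch1 (int r) * ch2 (int s) * eis_row z (m * int q1 + int r) (int s))" for m
    by (rule infsumI)
  have c1: "ch1 (m * int q1 + int r) = ch1 (int r)" for m r
    by (rule dchar_cong[OF d1]) (simp add: cong_def)
  have "(\<lambda>(m, n). blk (m, n)) summable_on (UNIV \<times> UNIV)" using bs(1) by simp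
  from infsum_Sigma'_banach[OF this]
  have "eis_lat q1 q2 ch1 ch2 k \<tau> = (\<Sum>\<^sub>\<infinity>m. \<Sum>\<^sub>\<infinity>n. blk (m, n))" using bs(2) by simp
  then show ?thesis unfolding row by (simp add: \<tau>_def c1 eis_char_row_def sum_distrib_left mult.assoc)
qed

lemma eis_row_periodic: "eis_row z c (j + int q2) = eis_row z c j"
proof -
  have b: "bij_betw (\<lambda>n::int. n + 1) UNIV UNIV"
    by (rule bij_betw_byWitness[where f' = "\<lambda>m. m - 1"]) auto
  have "eis_row z c (j + int q2) = (\<Sum>\<^sub>\<infinity>n::int. inverse (of_int c * z + of_int j / of_nat q2 + of_int (n + 1)) ^ k)"
    unfolding eis_row_def
  proof (rule infsum_cong)
    fix n
    have "of_int c * z + of_int (j + int q2) / of_nat q2 + of_int n = of_int c * z + of_int j / of_nat q2 + of_int (n + 1)"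
      using q2 by (simp add: add_divide_distrib)
    then show "inverse (of_int c * z + of_int (j + int q2) / of_nat q2 + of_int n) ^ k =
        inverse (of_int c * z + of_int j / of_nat q2 + of_int (n + 1)) ^ k" by (simp only:)
  qed
  also have "\<dots> = eis_row z c j"
    unfolding eis_row_def by (rule infsum_reindex_bij_betw[OF b])
  finally show ?thesis .
qed

lemma eis_row_minus: "eis_row z (- c) j = (-1) ^ k * eis_row z c (- j)"
proof -
  have b: "bij_betw (\<lambda>n::int. - n) UNIV UNIV"
    by (rule bij_betw_byWitness[where f' = "\<lambda>m. - m"]) auto
  have "eis_row z (- c) j = (\<Sum>\<^sub>\<infinity>n::int. (-1) ^ k * inverse (of_int c * z + of_int (- j) / of_nat q2 + of_int (- n)) ^ k)"
    unfolding eis_row_def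
  proof (rule infsum_cong)
    fix n
    have "of_int (- c) * z + of_int j / of_nat q2 + of_int n = - (of_int c * z + of_int (- j) / of_nat q2 + of_int (- n))"
      by simp
    then show "inverse (of_int (- c) * z + of_int j / of_nat q2 + of_int n) ^ k =
        (-1) ^ k * inverse (of_int c * z + of_int (- j) / of_nat q2 + of_int (- n)) ^ k"
      by (simp only: inverse_minus_eq power_minus[of "inverse _"])
  qed
  also have "\<dots> = (-1) ^ k * (\<Sum>\<^sub>\<infinity>n::int. inverse (of_int c * z + of_int (- j) / of_nat q2 + of_int (- n)) ^ k)"
    by (rule infsum_cmult_right')
  also have "(\<Sum>\<^sub>\<infinity>n::int. inverse (of_int c * z + of_int (- j) / of_nat q2 + of_int (- n)) ^ k) = eis_row z c (- j)"
    unfolding eis_row_def by (rule infsum_reindex_bij_betw[OF b])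
  finally show ?thesis .
qed

lemma eis_char_row_minus: "eis_char_row z (- c) = (-1) ^ k * ch2 (-1) * eis_char_row z c"
proof -
  define h where "h j = ch2 j * eis_row z c j" for j
  have h: "h (j + int q2) = h j" for j
    using d2 by (simp add: h_def eis_row_periodic dchar_def)
  have m: "ch2 (-1 * int s) = ch2 (-1) * ch2 (int s)" for s by (rule dchar_mult[OF d2])
  have "ch2 (-1) * ch2 (-1) = 1"
    using dchar_mult[OF d2, of "-1" "-1"] dchar_1[OF d2] by simp
  then have "ch2 (int s) = ch2 (-1) * ch2 (-1 * int s)" for s
    unfolding m by (simp add: mult.assoc[symmetric])
  then have "eis_char_row z (- c) = (\<Sum>s<q2. (-1) ^ k * ch2 (-1) * h (-1 * int s))"
    unfolding eis_char_row_def eis_row_minus h_def by (intro sum.cong refl) (simp add: mult_ac)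
  also have "\<dots> = (-1) ^ k * ch2 (-1) * (\<Sum>s<q2. h (-1 * int s))" by (simp only: sum_distrib_left)
  also have "(\<Sum>s<q2. h (-1 * int s)) = (\<Sum>s<q2. h (int s))"
    by (rule sum_periodic_mult_unit[of h q2, OF h]) (use q2 in auto)
  finally show ?thesis by (simp add: h_def eis_char_row_def)
qed

definition lipschitz_const :: complex where
  "lipschitz_const = (- 2 * pi * \<i>) ^ k / fact (k - 1)"

definition eis_term :: "nat \<Rightarrow> nat \<Rightarrow> complex" where
  "eis_term c l = ch1 (int c) * cnj (ch2 (int l)) * of_nat l ^ (k - 1)"

lemma eis_term_norm: "cmod (eis_term c l) \<le> real l ^ (k - 1)"
proof -
  have "cmod (ch1 (int c)) * cmod (ch2 (int l)) \<le> 1 * 1"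
    by (intro mult_mono dchar_norm_le[OF d1] dchar_norm_le[OF d2]) auto
  then show ?thesis
    using mult_right_mono[of "cmod (ch1 (int c)) * cmod (ch2 (int l))" 1 "real l ^ (k - 1)"]
    by (simp add: eis_term_def norm_mult norm_power)
qed

lemma eis_term_summable:
  "Im z > 0 \<Longrightarrow> (\<lambda>(c, l). eis_term c l * ee z ^ (c * l)) summable_on ({1..} \<times> {1..})"
  by (rule dirichlet_double_series_summable[OF norm_ee_less_1 eis_term_norm])

text \<open>The Lipschitz formula is applied at w = c z + s/q2. The phases e(n s/q2) that it
  produces are summed against ch2, and \<open>gauss_twist\<close> turns them into conj(ch2(n)) times
  the Gauss sum; this is where primitivity of ch2 enters.\<close>

lemma eis_char_row_pos:
  assumes z: "Im z > 0" and c: "c \<ge> 1"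
  shows "ch1 (int c) * eis_char_row z (int c) =
    lipschitz_const * gauss q2 ch2 * (\<Sum>\<^sub>\<infinity>l\<in>{1..}. eis_term c l * ee z ^ (c * l))"
proof -
  let ?C = "lipschitz_const"
  have row: "eis_row z (int c) (int s) = ?C * (\<Sum>n. of_nat n ^ (k - 1) * ee (of_nat c * z + of_nat s / of_nat q2) ^ n)" for s
    using Lipschitz_formula[of "of_nat c * z + of_nat s / of_nat q2" k] z c k
    by (simp add: eis_row_def lipschitz_const_def npow_series_def)
  have S: "summable (\<lambda>n. of_nat n ^ (k - 1) * ee (of_nat c * z + of_nat s / of_nat q2) ^ n)" for s
    by (intro npow_series_summable norm_ee_less_1) (use z c in simp)
  define t where "t n = cnj (ch2 (int n)) * of_nat n ^ (k - 1) * ee z ^ (c * n)" for n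
  have "eis_char_row z (int c) =
      (\<Sum>s<q2. \<Sum>n. ?C * (ch2 (int s) * (of_nat n ^ (k - 1) * ee (of_nat c * z + of_nat s / of_nat q2) ^ n)))"
    unfolding eis_char_row_def row by (subst suminf_mult, intro summable_mult S, subst suminf_mult, rule S, simp add: mult_ac)
  also have "\<dots> = (\<Sum>n. \<Sum>s<q2. ?C * (ch2 (int s) * (of_nat n ^ (k - 1) * ee (of_nat c * z + of_nat s / of_nat q2) ^ n)))"
    by (rule suminf_sum[symmetric]) (intro summable_mult S)
  also have "\<dots> = (\<Sum>n. ?C * gauss q2 ch2 * t n)"
  proof (rule suminf_cong)
    fix n
    have e: "ee (of_nat c * z + of_nat s / of_nat q2) ^ n = ee z ^ (c * n) * ee (of_int (int n) * of_nat s / of_nat q2)" for s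
      by (simp add: ee_power ee_add[symmetric] algebra_simps)
    have "(\<Sum>s<q2. ?C * (ch2 (int s) * (of_nat n ^ (k - 1) * ee (of_nat c * z + of_nat s / of_nat q2) ^ n))) =
       ?C * of_nat n ^ (k - 1) * ee z ^ (c * n) * (\<Sum>s<q2. ch2 (int s) * ee (of_int (int n) * of_nat s / of_nat q2))"
      unfolding e sum_distrib_left by (intro sum.cong refl) (simp add: mult_ac)
    also have "\<dots> = ?C * gauss q2 ch2 * t n"
      unfolding gauss_twist[OF pr2] t_def by (simp add: mult_ac)
    finally show "(\<Sum>s<q2. ?C * (ch2 (int s) * (of_nat n ^ (k - 1) * ee (of_nat c * z + of_nat s / of_nat q2) ^ n)))
       = ?C * gauss q2 ch2 * t n" .
  qed
  finally have 1: "eis_char_row z (int c) = (\<Sum>n. ?C * gauss q2 ch2 * t n)" .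
  have "(\<lambda>n. norm (t n)) summable_on UNIV"
  proof (rule Infinite_Sum.abs_summable_on_comparison_test')
    show "(\<lambda>n. real n ^ (k - 1) * (cmod (ee z) ^ c) ^ n) summable_on UNIV"
      by (rule npow_geometric_summable_on) (use norm_ee_less_1[OF z] c in \<open>auto simp: power_less_one_iff\<close>)
    show "norm (t n) \<le> real n ^ (k - 1) * (cmod (ee z) ^ c) ^ n" for n
      using mult_right_mono[OF dchar_norm_le[OF d2, of "int n"], of "real n ^ (k - 1) * cmod (ee z) ^ (c * n)"]
      by (simp add: t_def norm_mult norm_power power_mult mult.assoc)
  qed
  then have ts: "t summable_on UNIV" by (rule Infinite_Sum.abs_summable_summable)
  \<comment> \<open>Since k - 1 \<ge> 1, the term n = 0 vanishes and the sum may start at 1, as the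
    divisor sums do.\<close>
  have t0: "t 0 = 0" using k by (simp add: t_def)
  have "(\<Sum>n. ?C * gauss q2 ch2 * t n) = ?C * gauss q2 ch2 * infsum t UNIV"
    using ts by (simp add: infsum_nat_eq_suminf suminf_mult summable_on_imp_summable)
  also have "infsum t UNIV = infsum t {1..}"
  proof (rule infsum_cong_neutral)
    fix n assume "n \<in> UNIV - {1::nat..}"
    then have "n = 0" by auto
    then show "t n = 0" using t0 by simp
  qed auto
  finally have "ch1 (int c) * eis_char_row z (int c) = ?C * gauss q2 ch2 * (ch1 (int c) * infsum t {1..})"
    unfolding 1 by (simp add: mult_ac)
  also have "ch1 (int c) * infsum t {1..} = (\<Sum>\<^sub>\<infinity>l\<in>{1..}. eis_term c l * ee z ^ (c * l))"
    by (subst infsum_cmult_right'[symmetric]) (simp add: t_def eis_term_def mult_ac)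
  finally show ?thesis .
qed

lemma eis_eq_double_series:
  assumes z: "Im z > 0"
  shows "eis ch1 ch2 k z = 2 * (\<Sum>\<^sub>\<infinity>c\<in>{1..}. \<Sum>\<^sub>\<infinity>l\<in>{1..}. eis_term c l * ee z ^ (c * l))"
proof -
  let ?f = "\<lambda>(c, l). eis_term c l * ee z ^ (c * l)"
  let ?g = "\<lambda>M A. eis_term A (M div A) * ee z ^ M"
  note S = eis_term_summable[OF z]
  have eq: "(case p of (M, A) \<Rightarrow> ?g M A) = ?f (case p of (M, A) \<Rightarrow> (A, M div A))"
    if "p \<in> Sigma {1..} (\<lambda>M. {A. A dvd M})" for p
    using that by auto
  have S': "(\<lambda>(M, A). ?g M A) summable_on (Sigma {1..} (\<lambda>M. {A. A dvd M}))"
    by (rule summable_on_cong[THEN iffD2, OF eq], assumption)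
      (rule iffD2[OF summable_on_reindex_bij_betw[OF divisor_pairs_bij, of ?f] S])
  have "(\<Sum>\<^sub>\<infinity>c\<in>{1..}. \<Sum>\<^sub>\<infinity>l\<in>{1..}. eis_term c l * ee z ^ (c * l)) = infsum ?f ({1..} \<times> {1..})"
    by (rule infsum_Sigma'_banach[OF S])
  also have "\<dots> = (\<Sum>\<^sub>\<infinity>(M, A)\<in>Sigma {1..} (\<lambda>M. {A. A dvd M}). ?g M A)"
    by (rule trans[OF infsum_reindex_bij_betw[OF divisor_pairs_bij, of ?f, symmetric] infsum_cong[OF eq, symmetric]])
  also have "\<dots> = (\<Sum>\<^sub>\<infinity>M\<in>{1..}. \<Sum>\<^sub>\<infinity>A\<in>{A. A dvd M}. ?g M A)"
    by (rule infsum_Sigma'_banach[OF S', symmetric])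
  also have "\<dots> = (\<Sum>m. \<Sum>\<^sub>\<infinity>A\<in>{A. A dvd Suc m}. ?g (Suc m) A)"
    by (rule infsum_atLeast1_nat(1)[OF summable_on_Sigma_banach[OF S']])
  also have "\<dots> = (\<Sum>m. let M = Suc m in
      (\<Sum>A\<in>{A. A dvd M}. ch1 (int A) * cnj (ch2 (int (M div A))) * of_nat (M div A) ^ (k - 1)) * ee (of_nat M * z))"
    by (intro suminf_cong) (simp add: Let_def eis_term_def sum_distrib_right ee_power del: of_nat_Suc power_Suc)
  finally show ?thesis by (simp add: eis_def)
qed

text \<open>By the parity condition the rows c and -c contribute equally, and the row c = 0
  disappears because ch1(0) = 0 when q1 > 1. This accounts for the factor 2 in \<open>eis\<close>
  and for the absence of a constant term.\<close>

theorem eis_lat_eq_eis: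
  assumes z: "Im z > 0"
  shows "eis_lat q1 q2 ch1 ch2 k (of_nat q1 * z) = lipschitz_const * gauss q2 ch2 * eis ch1 ch2 k z"
proof -
  define C where "C = lipschitz_const * gauss q2 ch2"
  define G where "G c = ch1 c * eis_char_row z c" for c
  define P where "P = (\<Sum>\<^sub>\<infinity>c\<in>{1..}. \<Sum>\<^sub>\<infinity>l\<in>{1..}. eis_term c l * ee z ^ (c * l))"
  have G_pos: "G (int c) = C * (\<Sum>\<^sub>\<infinity>l\<in>{1..}. eis_term c l * ee z ^ (c * l))" if "c \<in> {1..}" for c
    using eis_char_row_pos[OF z, of c] that by (simp add: G_def C_def)
  have G_minus: "G (- c) = G c" for c
  proof -
    have "ch1 (- c) = ch1 (-1) * ch1 c" using dchar_mult[OF d1, of "-1" c] by simp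
    then have "G (- c) = (ch1 (-1) * ch2 (-1)) * (-1) ^ k * G c"
      by (simp add: G_def eis_char_row_minus mult_ac)
    also have "(ch1 (-1) * ch2 (-1)) * (-1) ^ k = 1"
      unfolding parity by (simp add: power_mult_distrib[symmetric])
    finally show ?thesis by simp
  qed
  have "ch1 0 = 0" using dchar_nonzero_iff[OF d1, of 0] q1 by auto
  then have G0: "G 0 = 0" by (simp add: G_def)
  have GS: "(\<lambda>c. G (int c)) summable_on {1..}"
    using summable_on_cmult_right[OF summable_on_Sigma_banach[OF eis_term_summable[OF z]], of C]
    by (subst summable_on_cong[OF G_pos]) auto
  have GP: "(\<Sum>\<^sub>\<infinity>c\<in>{1..}. G (int c)) = C * P"
    unfolding P_def by (subst infsum_cmult_right'[symmetric]) (rule infsum_cong[OF G_pos])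
  have inj: "inj_on int {1..}" "inj_on (\<lambda>c. - int c) {1..}" by (auto simp: inj_on_def)
  have S1: "G summable_on (int ` {1..})" and S2: "G summable_on ((\<lambda>c. - int c) ` {1..})"
    by (subst summable_on_reindex, rule inj, use GS in \<open>simp add: o_def G_minus\<close>)+
  have I1: "infsum G (int ` {1..}) = C * P" and I2: "infsum G ((\<lambda>c. - int c) ` {1..}) = C * P"
    by (subst infsum_reindex, rule inj, use GP in \<open>simp add: o_def G_minus\<close>)+
  let ?U = "int ` {1..} \<union> (\<lambda>c. - int c) ` {1..}"
  have disj: "int ` {1..} \<inter> (\<lambda>c. - int c) ` {1..} = {}" by auto
  have U: "G summable_on ?U" "infsum G ?U = C * (2 * P)"
    using summable_on_Un_disjoint[OF S1 S2 disj] infsum_Un_disjoint[OF S1 S2 disj] I1 I2 by simp_all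
  have zero: "G c = 0" if "c \<notin> ?U" for c
  proof -
    have "c = 0"
    proof (rule ccontr)
      assume "c \<noteq> 0"
      then have "c = int (nat c) \<and> nat c \<in> {1..} \<or> c = - int (nat (- c)) \<and> nat (- c) \<in> {1..}" by auto
      then show False using that by blast
    qed
    then show ?thesis by (simp add: G0)
  qed
  have GU: "G summable_on UNIV" using U(1) summable_on_cong_neutral[of UNIV ?U G G] zero by auto
  have GI: "infsum G UNIV = C * (2 * P)" using U(2) infsum_cong_neutral[of UNIV ?U G G] zero by auto
  have bij: "bij_betw (\<lambda>(m, r). m * int q1 + int r) (UNIV \<times> {..<q1}) UNIV"
  proof (rule bij_betw_byWitness[where f' = "\<lambda>c. (c div int q1, nat (c mod int q1))"])
    show "\<forall>c\<in>UNIV. (case (c div int q1, nat (c mod int q1)) of (m, r) \<Rightarrow> m * int q1 + int r) = c"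
      using q1 by simp
    show "(\<lambda>c. (c div int q1, nat (c mod int q1))) ` UNIV \<subseteq> UNIV \<times> {..<q1}"
      using q1 by (auto simp: nat_less_iff)
  qed (use q1 in auto)
  have GS2: "(\<lambda>(m, r). G (m * int q1 + int r)) summable_on (UNIV \<times> {..<q1})"
    using summable_on_reindex_bij_betw[OF bij, of G] GU by (simp add: case_prod_unfold)
  have "eis_lat q1 q2 ch1 ch2 k (of_nat q1 * z) = (\<Sum>\<^sub>\<infinity>m::int. \<Sum>\<^sub>\<infinity>r\<in>{..<q1}. G (m * int q1 + int r))"
    unfolding eis_lat_eq_rows[OF z] by (simp add: G_def)
  also have "\<dots> = (\<Sum>\<^sub>\<infinity>(m, r)\<in>UNIV \<times> {..<q1}. G (m * int q1 + int r))"
    by (rule infsum_Sigma'_banach[OF GS2])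
  also have "\<dots> = infsum G UNIV"
    using infsum_reindex_bij_betw[OF bij, of G] by (simp add: case_prod_unfold)
  finally show ?thesis by (simp add: GI P_def C_def eis_eq_double_series[OF z])
qed

end

section \<open>Modular behaviour of the Eisenstein series\<close>

definition mdet :: "m2 \<Rightarrow> real" where
  "mdet g = m11 g * m22 g - m12 g * m21 g"

definition mj :: "m2 \<Rightarrow> complex \<Rightarrow> complex" where
  "mj g z = of_real (m21 g) * z + of_real (m22 g)"

definition mob :: "m2 \<Rightarrow> complex \<Rightarrow> complex" where
  "mob g z = (of_real (m11 g) * z + of_real (m12 g)) / mj g z"

lemma mmul_sel [simp]:
  "m11 (mmul g h) = m11 g * m11 h + m12 g * m21 h" "m12 (mmul g h) = m11 g * m12 h + m12 g * m22 h"
  "m21 (mmul g h) = m21 g * m11 h + m22 g * m21 h" "m22 (mmul g h) = m21 g * m12 h + m22 g * m22 h"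
  by (simp_all add: mmul_def)

lemma minv_sel [simp]: "m11 (minv g) = m22 g" "m12 (minv g) = - m12 g" "m21 (minv g) = - m21 g" "m22 (minv g) = m11 g"
  by (simp_all add: minv_def)

lemma mk_sel [simp]: "m11 (mk a b c d) = of_int a" "m12 (mk a b c d) = of_int b"
  "m21 (mk a b c d) = of_int c" "m22 (mk a b c d) = of_int d"
  by (simp_all add: mk_def)

lemma omega_sel [simp]: "m11 (omega N) = 0" "m12 (omega N) = - 1 / sqrt (real N)"
  "m21 (omega N) = sqrt (real N)" "m22 (omega N) = 0"
  by (simp_all add: omega_def)

lemma mdet_mmul: "mdet (mmul g h) = mdet g * mdet h"
  by (simp add: mdet_def algebra_simps)

lemma mdet_minv [simp]: "mdet (minv g) = mdet g"
  by (simp add: mdet_def)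

lemma mdet_mk: "mdet (mk a b c d) = of_int (a * d - b * c)"
  by (simp add: mdet_def)

lemma mdet_omega: "N > 0 \<Longrightarrow> mdet (omega N) = 1"
  by (simp add: mdet_def)

lemma mj_nonzero:
  assumes "mdet g = 1" "Im z > 0"
  shows "mj g z \<noteq> 0"
proof
  assume "mj g z = 0"
  then have "Im (mj g z) = 0" "Re (mj g z) = 0" by simp_all
  then have "m21 g = 0" "m22 g = 0" using assms(2) by (auto simp: mj_def)
  then show False using assms(1) by (simp add: mdet_def)
qed

lemma Im_mob:
  assumes "mdet g = 1" "Im z > 0"
  shows "Im (mob g z) > 0"
proof -
  have nz: "mj g z \<noteq> 0" by (rule mj_nonzero[OF assms])
  have "Im (mob g z) = mdet g * Im z / ((Re (mj g z))\<^sup>2 + (Im (mj g z))\<^sup>2)"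
    unfolding mob_def Im_divide by (simp add: mj_def mdet_def algebra_simps)
  moreover have "(Re (mj g z))\<^sup>2 + (Im (mj g z))\<^sup>2 > 0"
    using nz by (simp add: complex_neq_0)
  ultimately show ?thesis using assms by simp
qed

lemma mj_mmul:
  assumes "mdet h = 1" "Im z > 0"
  shows "mj (mmul g h) z = mj g (mob h z) * mj h z"
  using mj_nonzero[OF assms] by (simp add: mj_def[of g] mj_def[of "mmul g h"] mob_def distrib_right)
    (simp add: mj_def algebra_simps)

lemma mob_mmul:
  assumes "mdet h = 1" "Im z > 0"
  shows "mob (mmul g h) z = mob g (mob h z)"
proof -
  have nz: "mj h z \<noteq> 0" by (rule mj_nonzero[OF assms])
  have "of_real (m11 (mmul g h)) * z + of_real (m12 (mmul g h)) = (of_real (m11 g) * mob h z + of_real (m12 g)) * mj h z"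
    using nz by (simp add: mob_def distrib_right) (simp add: mj_def algebra_simps)
  then show ?thesis using nz unfolding mob_def[of "mmul g h"] mob_def[of g] mj_mmul[OF assms] by simp
qed

lemma mmul_minv_cancel:
  assumes "mdet g = 1"
  shows "mmul g (mmul (minv g) h) = h"
proof -
  have "mmul g (mmul (minv g) h) = \<lparr>m11 = mdet g * m11 h, m12 = mdet g * m12 h, m21 = mdet g * m21 h, m22 = mdet g * m22 h\<rparr>"
    by (simp add: mmul_def mdet_def algebra_simps)
  then show ?thesis using assms by simp
qed

lemma mob_has_derivative:
  assumes "mdet g = 1" "Im z > 0"
  shows "(mob g has_field_derivative 1 / mj g z ^ 2) (at z)"
proof -
  have nz: "mj g z \<noteq> 0" by (rule mj_nonzero[OF assms])
  have "((\<lambda>z. of_real (m11 g) * z + of_real (m12 g)) has_field_derivative of_real (m11 g)) (at z)"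
    "(mj g has_field_derivative of_real (m21 g)) (at z)"
    unfolding mj_def[abs_def] by (auto intro!: derivative_eq_intros)
  from DERIV_divide[OF this nz]
  have "(mob g has_field_derivative
      (of_real (m11 g) * mj g z - (of_real (m11 g) * z + of_real (m12 g)) * of_real (m21 g)) / (mj g z * mj g z)) (at z)"
    unfolding mob_def[abs_def] .
  moreover have "of_real (m11 g) * mj g z - (of_real (m11 g) * z + of_real (m12 g)) * of_real (m21 g) = of_real (mdet g)"
    by (simp add: mj_def mdet_def algebra_simps)
  ultimately show ?thesis by (simp add: assms power2_eq_square)
qed

definition uhp :: "complex set" where
  "uhp = {z. Im z > 0}"

lemma open_uhp: "open uhp" and convex_uhp: "convex uhp"
  by (simp_all add: uhp_def open_halfspace_Im_gt convex_halfspace_Im_gt)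

lemma mem_uhp: "z \<in> uhp \<longleftrightarrow> Im z > 0"
  by (simp add: uhp_def)

text \<open>The bound is uniform in Re z, so it survives the affine maps by which two matrices with
  the same image of \<infinity> differ.\<close>

definition cusp_decay :: "(complex \<Rightarrow> complex) \<Rightarrow> bool" where
  "cusp_decay F \<longleftrightarrow> (\<exists>K c T. K \<ge> 0 \<and> c > 0 \<and> (\<forall>z. Im z \<ge> T \<longrightarrow> cmod (F z) \<le> K * exp (- c * Im z)))"

section \<open>Transformation laws, Fourier series and decay of the Eisenstein series\<close>

context eis_pair
begin

lemma gauss_lipschitz_nonzero: "lipschitz_const * gauss q2 ch2 \<noteq> 0"
  using gauss_nonzero[OF pr2] by (simp add: lipschitz_const_def)

lemma eis_Gamma0:
  assumes det: "a * d - b * (c * int (q1 * q2)) = 1" and z: "Im z > 0"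
  shows "eis ch1 ch2 k (mob (mk a b (c * int (q1 * q2)) d) z) =
    psi ch1 ch2 d * mj (mk a b (c * int (q1 * q2)) d) z ^ k * eis ch1 ch2 k z"
proof -
  let ?g = "mk a b (c * int (q1 * q2)) d"
  have g: "mdet ?g = 1" using det by (simp add: mdet_mk del: of_int_diff of_int_mult)
  have q1': "(of_nat q1 :: complex) \<noteq> 0" using q1 by simp
  define \<tau> where "\<tau> = of_nat q1 * z"
  have \<tau>: "Im \<tau> \<noteq> 0" using z q1 by (simp add: \<tau>_def)
  have j: "of_int (c * int q2) * \<tau> + of_int d = mj ?g z" by (simp add: mj_def \<tau>_def mult_ac)
  have nz: "mj ?g z \<noteq> 0" by (rule mj_nonzero[OF g z])
  have arg: "of_nat q1 * mob ?g z = (of_int a * \<tau> + of_int (b * int q1)) / (of_int (c * int q2) * \<tau> + of_int d)"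
    unfolding j by (simp add: mob_def \<tau>_def algebra_simps)
  have "lipschitz_const * gauss q2 ch2 * eis ch1 ch2 k (mob ?g z) = eis_lat q1 q2 ch1 ch2 k (of_nat q1 * mob ?g z)"
    by (rule eis_lat_eq_eis[symmetric, OF Im_mob[OF g z]])
  also have "\<dots> = psi ch1 ch2 d * mj ?g z ^ k * eis_lat q1 q2 ch1 ch2 k \<tau>"
    unfolding arg by (subst eis_lat_Gamma0[OF det \<tau>]) (simp_all only: j nz not_False_eq_True)
  also have "eis_lat q1 q2 ch1 ch2 k \<tau> = lipschitz_const * gauss q2 ch2 * eis ch1 ch2 k z"
    unfolding \<tau>_def by (rule eis_lat_eq_eis[OF z])
  finally show ?thesis using gauss_lipschitz_nonzero by (simp add: mult_ac)
qed

text \<open>Since q1 (\<omega> z) = -1/(q2 z), inversion at \<tau> = q2 z connects E12 with E21. The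
  quotient of Gauss sums in R comes from the two normalisations in \<open>eis_lat_eq_eis\<close>,
  and (q2/q1)^(k/2) from comparing \<tau>^k = q2^k z^k with j(\<omega>, z)^k = N^(k/2) z^k.\<close>

lemma eis_omega:
  assumes z: "Im z > 0"
  shows "eis ch1 ch2 k (mob (omega (q1 * q2)) z) =
    Rconst ch1 ch2 q1 q2 k * mj (omega (q1 * q2)) z ^ k * eis ch2 ch1 k z"
proof -
  interpret sw: eis_pair q2 q1 k ch2 ch1 by (rule swap)
  let ?w = "omega (q1 * q2)"
  have w: "mdet ?w = 1" using q1 q2 by (intro mdet_omega) auto
  have z0: "z \<noteq> 0" using z by auto
  define \<tau> where "\<tau> = of_nat q2 * z"
  have \<tau>: "Im \<tau> \<noteq> 0" using z q2 by (simp add: \<tau>_def)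
  have sq: "complex_of_real (sqrt (real q1 * real q2)) * complex_of_real (sqrt (real q1 * real q2)) = of_nat q1 * of_nat q2"
    by (simp only: of_real_mult[symmetric] real_sqrt_mult_self) simp
  have arg: "of_nat q1 * mob ?w z = - 1 / \<tau>"
  proof -
    have "mob ?w z = - 1 / (complex_of_real (sqrt (real q1 * real q2)) * complex_of_real (sqrt (real q1 * real q2)) * z)"
      by (simp add: mob_def mj_def del: real_sqrt_mult_self)
    then show ?thesis unfolding sq using q1 z0 by (simp add: \<tau>_def)
  qed
  have pw: "((real q2 / real q1) powr (real k / 2)) * sqrt (real (q1 * q2)) ^ k = real q2 ^ k"
  proof -
    have "(real q2 / real q1) powr (real k / 2) = ((real q2 / real q1) powr (1 / 2)) powr real k"
      by (simp add: powr_powr)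
    also have "\<dots> = sqrt (real q2 / real q1) ^ k" using q1 q2 by (simp add: powr_half_sqrt powr_realpow)
    finally have "((real q2 / real q1) powr (real k / 2)) * sqrt (real (q1 * q2)) ^ k =
        (sqrt (real q2 / real q1) * sqrt (real (q1 * q2))) ^ k" by (simp add: power_mult_distrib)
    also have "sqrt (real q2 / real q1) * sqrt (real (q1 * q2)) = sqrt (real q2 ^ 2)"
      using q1 by (simp add: real_sqrt_mult[symmetric] power2_eq_square)
    finally show ?thesis by simp
  qed
  have R: "Rconst ch1 ch2 q1 q2 k * mj ?w z ^ k = ch1 (-1) * gauss q1 ch1 / gauss q2 ch2 * \<tau> ^ k"
  proof -
    have "Rconst ch1 ch2 q1 q2 k * mj ?w z ^ k = ch1 (-1) * gauss q1 ch1 / gauss q2 ch2 *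
        complex_of_real (((real q2 / real q1) powr (real k / 2)) * sqrt (real (q1 * q2)) ^ k) * z ^ k"
      by (simp add: Rconst_def mj_def power_mult_distrib)
    then show ?thesis unfolding pw by (simp add: \<tau>_def power_mult_distrib)
  qed
  have "lipschitz_const * gauss q2 ch2 * eis ch1 ch2 k (mob ?w z) = eis_lat q1 q2 ch1 ch2 k (of_nat q1 * mob ?w z)"
    by (rule eis_lat_eq_eis[symmetric, OF Im_mob[OF w z]])
  also have "\<dots> = ch1 (-1) * \<tau> ^ k * eis_lat q2 q1 ch2 ch1 k \<tau>"
    unfolding arg by (rule sw.eis_lat_inversion[OF \<tau>])
  also have "eis_lat q2 q1 ch2 ch1 k \<tau> = lipschitz_const * gauss q1 ch1 * eis ch2 ch1 k z"
    unfolding \<tau>_def lipschitz_const_def by (rule sw.eis_lat_eq_eis[OF z, unfolded sw.lipschitz_const_def])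
  finally have "gauss q2 ch2 * eis ch1 ch2 k (mob ?w z) = gauss q2 ch2 * (ch1 (-1) * gauss q1 ch1 / gauss q2 ch2 * \<tau> ^ k * eis ch2 ch1 k z)"
    using gauss_lipschitz_nonzero by (simp add: field_simps)
  then show ?thesis unfolding R using gauss_nonzero[OF pr2] by (simp only: mult_cancel_left) simp
qed

definition eis_coeff :: "nat \<Rightarrow> complex" where
  "eis_coeff M = (\<Sum>A\<in>{A. A dvd M}. ch1 (int A) * cnj (ch2 (int (M div A))) * of_nat (M div A) ^ (k - 1))"

text \<open>There are at most M divisors, each contributing at most M^(k - 1).\<close>

lemma eis_coeff_norm:
  assumes "M \<ge> 1"
  shows "cmod (eis_coeff M) \<le> real M ^ k"
proof -
  have "{A. A dvd M} \<subseteq> {1..M}" using assms by (auto dest: dvd_imp_le intro: Suc_leI dvd_pos_nat)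
  then have c: "card {A. A dvd M} \<le> M" using card_mono[of "{1..M}"] by fastforce
  have "cmod (eis_coeff M) \<le> (\<Sum>A\<in>{A. A dvd M}. real M ^ (k - 1))"
    unfolding eis_coeff_def
  proof (rule sum_norm_le)
    fix A
    have "cmod (ch1 (int A) * cnj (ch2 (int (M div A))) * of_nat (M div A) ^ (k - 1)) \<le> real (M div A) ^ (k - 1)"
      using eis_term_norm[of A "M div A"] by (simp add: eis_term_def)
    also have "\<dots> \<le> real M ^ (k - 1)" by (intro power_mono) (simp_all add: div_le_dividend)
    finally show "cmod (ch1 (int A) * cnj (ch2 (int (M div A))) * of_nat (M div A) ^ (k - 1)) \<le> real M ^ (k - 1)" .
  qed
  also have "\<dots> \<le> real M * real M ^ (k - 1)" using c by (simp add: mult_right_mono)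
  also have "\<dots> = real M ^ k" using k by (simp add: power_eq_if)
  finally show ?thesis .
qed

lemma eis_coeff_summable:
  assumes "cmod x < 1"
  shows "summable (\<lambda>m. 2 * eis_coeff (Suc m) * x ^ m)"
proof (cases "x = 0")
  case True
  then show ?thesis using powser_sums_zero sums_summable by fastforce
next
  case False
  have "summable (\<lambda>n. real n ^ k * cmod x ^ n)"
    by (rule summable_on_imp_summable[OF npow_geometric_summable_on]) (use assms in auto)
  then have S: "summable (\<lambda>n. 2 / cmod x * (real (Suc n) ^ k * cmod x ^ Suc n))"
    by (intro summable_mult) (subst summable_Suc_iff)
  show ?thesis
  proof (rule summable_comparison_test'[OF S])
    fix m :: nat
    show "norm (2 * eis_coeff (Suc m) * x ^ m) \<le> 2 / cmod x * (real (Suc m) ^ k * cmod x ^ Suc m)"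
      using mult_right_mono[OF eis_coeff_norm[of "Suc m"], of "2 * cmod x ^ m"] False
      by (simp add: norm_mult norm_power mult_ac)
  qed
qed

text \<open>E divided by e(z), as a function of e(z). With one power split off, boundedness near 0
  already yields exponential decay of E at \<infinity>.\<close>

definition eis_power_series :: "complex \<Rightarrow> complex" where
  "eis_power_series x = (\<Sum>m. 2 * eis_coeff (Suc m) * x ^ m)"

lemma eis_eq_power_series:
  assumes z: "Im z > 0"
  shows "eis ch1 ch2 k z = ee z * eis_power_series (ee z)"
proof -
  note S = eis_coeff_summable[OF norm_ee_less_1[OF z]]
  have e: "ee (of_nat (Suc m) * z) = ee z * ee z ^ m" for m by (metis ee_power power_Suc)
  have S': "summable (\<lambda>m. eis_coeff (Suc m) * ee (of_nat (Suc m) * z))"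
  proof -
    have "eis_coeff (Suc m) * ee (of_nat (Suc m) * z) = ee z / 2 * (2 * eis_coeff (Suc m) * ee z ^ m)" for m
      by (simp add: e del: of_nat_Suc)
    then show ?thesis by (simp only:) (rule summable_mult[OF S])
  qed
  have "eis ch1 ch2 k z = 2 * (\<Sum>m. eis_coeff (Suc m) * ee (of_nat (Suc m) * z))"
    by (simp add: eis_def eis_coeff_def Let_def)
  also have "\<dots> = (\<Sum>m. ee z * (2 * eis_coeff (Suc m) * ee z ^ m))"
  proof -
    have "2 * (eis_coeff (Suc m) * ee (of_nat (Suc m) * z)) = ee z * (2 * eis_coeff (Suc m) * ee z ^ m)" for m
      unfolding e by (simp add: mult_ac)
    then show ?thesis by (simp only: suminf_mult[OF S', symmetric])
  qed
  also have "\<dots> = ee z * eis_power_series (ee z)"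
    unfolding eis_power_series_def by (rule suminf_mult[OF S])
  finally show ?thesis .
qed

lemma eis_power_series_holomorphic: "eis_power_series holomorphic_on ball 0 1"
proof -
  have "(eis_power_series has_field_derivative (\<Sum>m. diffs (\<lambda>m. 2 * eis_coeff (Suc m)) m * x ^ m)) (at x)"
    if "cmod x < 1" for x
    unfolding eis_power_series_def[abs_def]
    by (rule termdiffs_strong'[of 1]) (use eis_coeff_summable that in auto)
  then show ?thesis by (subst holomorphic_on_open) (auto, blast)
qed

lemma eis_holomorphic: "eis ch1 ch2 k holomorphic_on uhp"
proof -
  have "ee holomorphic_on uhp" unfolding ee_def[abs_def] by (intro holomorphic_intros)
  moreover from this have "(eis_power_series \<circ> ee) holomorphic_on uhp"
    by (rule holomorphic_on_compose_gen[OF _ eis_power_series_holomorphic]) (auto simp: mem_uhp norm_ee_less_1)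
  ultimately have "(\<lambda>z. ee z * (eis_power_series \<circ> ee) z) holomorphic_on uhp"
    by (rule holomorphic_on_mult)
  then show ?thesis
    by (rule holomorphic_transform) (simp add: mem_uhp eis_eq_power_series)
qed

lemma eis_cusp_decay: "cusp_decay (eis ch1 ch2 k)"
proof -
  \<comment> \<open>\<rho> is the modulus of e(z) on the line Im z = 1; the closed disc of this
    radius is compact inside the unit disc.\<close>
  define \<rho> where "\<rho> = exp (- 2 * pi)"
  have \<rho>: "\<rho> < 1" by (simp add: \<rho>_def)
  have "continuous_on (cball 0 \<rho>) eis_power_series"
    by (rule holomorphic_on_imp_continuous_on, rule holomorphic_on_subset[OF eis_power_series_holomorphic])
      (use \<rho> in auto)
  then have "compact (eis_power_series ` cball 0 \<rho>)" by (intro compact_continuous_image) auto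
  then obtain B where B: "\<And>x. x \<in> cball 0 \<rho> \<Longrightarrow> cmod (eis_power_series x) \<le> B"
    using compact_imp_bounded by (metis bounded_iff imageI)
  have "cmod (eis ch1 ch2 k z) \<le> max B 0 * exp (- (2 * pi) * Im z)" if "Im z \<ge> 1" for z
  proof -
    have "ee z \<in> cball 0 \<rho>" using that by (simp add: norm_ee \<rho>_def)
    then have "cmod (eis_power_series (ee z)) \<le> max B 0" using B by fastforce
    then show ?thesis
      using that by (simp add: eis_eq_power_series norm_mult norm_ee mult.commute mult_right_mono)
  qed
  then show ?thesis unfolding cusp_decay_def
    by (intro exI[of _ "max B 0"] exI[of _ "2 * pi"] exI[of _ 1]) auto
qed

end

section \<open>Integrals to cusps\<close>

lemma power_exp_bounded:
  fixes c :: real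
  assumes c: "c > 0"
  shows "\<exists>C\<ge>0. \<forall>t\<ge>0. t ^ n * exp (- c * t) \<le> C"
proof (cases "n = 0")
  case True
  show ?thesis by (rule exI[of _ 1]) (use True c in auto)
next
  case False
  then have n: "real n > 0" by simp
  show ?thesis
  proof (intro exI[of _ "(real n / c) ^ n"] conjI allI impI)
    fix t :: real assume t: "t \<ge> 0"
    have "c * t / n \<le> exp (c * t / n)" using exp_ge_add_one_self[of "c * t / n"] by linarith
    then have "t \<le> real n / c * exp (c * t / n)" using n c by (simp add: field_simps)
    then have "t ^ n \<le> (real n / c * exp (c * t / n)) ^ n" using t by (rule power_mono)
    also have "\<dots> = (real n / c) ^ n * exp (c * t)"
      by (simp only: power_mult_distrib exp_of_nat_mult[symmetric]) (use n in simp)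
    finally have "t ^ n * exp (- c * t) \<le> (real n / c) ^ n * exp (c * t) * exp (- c * t)"
      by (rule mult_right_mono) simp
    then show "t ^ n * exp (- c * t) \<le> (real n / c) ^ n" by (simp add: mult.assoc exp_add[symmetric])
  qed (use c in simp)
qed

text \<open>Half of the exponential rate absorbs the polynomial factor, which on the strip |Re w|
  \<le> B is at most (M Im w)^n once Im w \<ge> 1.\<close>

lemma cusp_decay_poly:
  assumes "cusp_decay F" "B \<ge> 0"
  obtains K c T where "K \<ge> 0" "c > 0" "T \<ge> 1"
    "\<And>w. \<bar>Re w\<bar> \<le> B \<Longrightarrow> Im w \<ge> T \<Longrightarrow> cmod (F w * (X * w + Y) ^ n) \<le> K * exp (- c * Im w)"
proof -
  obtain K0 c0 T0 where F: "K0 \<ge> 0" "c0 > 0" "\<And>z. Im z \<ge> T0 \<Longrightarrow> cmod (F z) \<le> K0 * exp (- c0 * Im z)"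
    using assms(1) by (auto simp: cusp_decay_def)
  define M where "M = cmod X * (B + 1) + cmod Y"
  have M: "M \<ge> 0" using assms(2) by (simp add: M_def)
  obtain C where C: "C \<ge> 0" "\<And>t. t \<ge> 0 \<Longrightarrow> t ^ n * exp (- (c0 / 2) * t) \<le> C"
    using power_exp_bounded[of "c0 / 2" n] F(2) by auto
  show ?thesis
  proof (rule that)
    show "K0 * M ^ n * C \<ge> 0" "c0 / 2 > 0" "max T0 1 \<ge> 1" using F M C by auto
    fix w assume w: "\<bar>Re w\<bar> \<le> B" "Im w \<ge> max T0 1"
    have "cmod (X * w + Y) \<le> cmod X * cmod w + cmod Y" by (metis norm_mult norm_triangle_ineq)
    also have "cmod X * cmod w \<le> cmod X * ((B + 1) * Im w)"
    proof (rule mult_left_mono)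
      have "cmod w \<le> \<bar>Re w\<bar> + \<bar>Im w\<bar>" by (rule cmod_le)
      also have "\<dots> \<le> B * Im w + Im w" using w assms(2) mult_left_mono[of 1 "Im w" B] by auto
      finally show "cmod w \<le> (B + 1) * Im w" by (simp add: algebra_simps)
    qed simp
    also have "cmod X * ((B + 1) * Im w) + cmod Y \<le> M * Im w"
      using w mult_left_mono[of 1 "Im w" "cmod Y"] by (simp add: M_def algebra_simps)
    finally have "cmod ((X * w + Y) ^ n) \<le> M ^ n * Im w ^ n"
      unfolding norm_power power_mult_distrib[symmetric] by (intro power_mono) auto
    then have "cmod (F w * (X * w + Y) ^ n) \<le> (K0 * exp (- c0 * Im w)) * (M ^ n * Im w ^ n)"
      unfolding norm_mult using F w M by (intro mult_mono F(3)) auto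
    also have "exp (- c0 * Im w) = exp (- (c0 / 2) * Im w) * exp (- (c0 / 2) * Im w)"
      by (simp add: exp_add[symmetric] algebra_simps)
    also have "(K0 * (exp (- (c0 / 2) * Im w) * exp (- (c0 / 2) * Im w))) * (M ^ n * Im w ^ n) =
        K0 * M ^ n * (Im w ^ n * exp (- (c0 / 2) * Im w)) * exp (- (c0 / 2) * Im w)"
      by (simp add: mult_ac)
    also have "\<dots> \<le> K0 * M ^ n * C * exp (- (c0 / 2) * Im w)"
      using F M w by (intro mult_right_mono mult_left_mono C(2)) auto
    finally show "cmod (F w * (X * w + Y) ^ n) \<le> K0 * M ^ n * C * exp (- (c0 / 2) * Im w)" .
  qed
qed

lemma tendsto_exp_neg: "c > 0 \<Longrightarrow> ((\<lambda>t. K * exp (- c * t)) \<longlongrightarrow> (0::real)) at_top"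
  by real_asymp

text \<open>The derivative decays exponentially, so G is Cauchy along the imaginary axis and
  horizontal displacements of bounded length become negligible. One L must serve all \<alpha> and
  \<beta>, because elements of the stabiliser of \<infinity> carry the imaginary axis to such
  parametrised lines.\<close>

lemma vertical_limit_exists:
  assumes G: "\<And>w. Im w > 0 \<Longrightarrow> (G has_field_derivative F w * (X * w + Y) ^ n) (at w)"
    and F: "cusp_decay F"
  obtains L where "\<And>\<alpha> \<beta>. \<alpha> > 0 \<Longrightarrow>
    ((\<lambda>t. G (of_real \<beta> + \<i> * of_real (\<alpha> * t))) \<longlongrightarrow> L) at_top"
proof -
  obtain K c T where KcT: "K \<ge> 0" "c > 0" "T \<ge> 1"
    "\<And>w. \<bar>Re w\<bar> \<le> 0 \<Longrightarrow> Im w \<ge> T \<Longrightarrow> cmod (F w * (X * w + Y) ^ n) \<le> K * exp (- c * Im w)"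
    using cusp_decay_poly[OF F order_refl] by metis
  \<comment> \<open>The integral of K exp(-c u) over u \<ge> t, so that -\<epsilon> is a primitive
    of the majorant.\<close>
  define \<epsilon> where "\<epsilon> t = K / c * exp (- c * t)" for t
  have eps0: "(\<epsilon> \<longlongrightarrow> 0) at_top" unfolding \<epsilon>_def by (rule tendsto_exp_neg[OF KcT(2)])
  have eps_nonneg: "\<epsilon> t \<ge> 0" for t using KcT by (simp add: \<epsilon>_def)
  have diff: "cmod (G (\<i> * of_real t) - G (\<i> * of_real s)) \<le> \<epsilon> s" if st: "T \<le> s" "s \<le> t" for s t
  proof (cases "s = t")
    case True then show ?thesis using eps_nonneg by simp
  next
    case False
    have der: "((\<lambda>t. G (\<i> * of_real t)) has_vector_derivative (\<i> * (F (\<i> * of_real t) * (X * (\<i> * of_real t) + Y) ^ n))) (at t)"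
      if "t > 0" for t
    proof -
      have "((\<lambda>t. \<i> * of_real t) has_vector_derivative \<i>) (at t)"
        by (auto intro!: derivative_eq_intros)
      from field_vector_diff_chain_at[OF this G] that show ?thesis by (simp add: o_def)
    qed
    have "cmod (G (\<i> * of_real t) - G (\<i> * of_real s)) \<le> - \<epsilon> t - - \<epsilon> s"
    proof (rule differentiable_bound_general[where f = "\<lambda>t. G (\<i> * of_real t)" and \<phi> = "\<lambda>t. - \<epsilon> t"])
      show "s < t" using that False by simp
      show "continuous_on {s..t} (\<lambda>t. G (\<i> * of_real t))"
        by (intro continuous_at_imp_continuous_on ballI has_vector_derivative_continuous[OF der])
          (use st KcT in auto)
      show "continuous_on {s..t} (\<lambda>t. - \<epsilon> t)" unfolding \<epsilon>_def by (intro continuous_intros)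
      fix u assume u: "s < u" "u < t"
      then have u0: "u > 0" "u \<ge> T" using st KcT by auto
      show "((\<lambda>t. G (\<i> * of_real t)) has_vector_derivative (\<i> * (F (\<i> * of_real u) * (X * (\<i> * of_real u) + Y) ^ n))) (at u)"
        by (rule der[OF u0(1)])
      have "((\<lambda>t. - \<epsilon> t) has_real_derivative K * exp (- c * u)) (at u)"
        unfolding \<epsilon>_def using KcT by (auto intro!: derivative_eq_intros)
      then show "((\<lambda>t. - \<epsilon> t) has_vector_derivative K * exp (- c * u)) (at u)"
        by (simp add: has_real_derivative_iff_has_vector_derivative)
      show "norm (\<i> * (F (\<i> * of_real u) * (X * (\<i> * of_real u) + Y) ^ n)) \<le> K * exp (- c * u)"
        using KcT(4)[of "\<i> * of_real u"] u0 by (simp add: norm_mult)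
    qed
    then show ?thesis using eps_nonneg[of t] by linarith
  qed
  have "Cauchy (\<lambda>j. G (\<i> * of_real (real j)))"
  proof (rule metric_CauchyI)
    fix e :: real assume e: "e > 0"
    have "\<forall>\<^sub>F t in at_top. \<epsilon> t < e / 2 \<and> t \<ge> T"
      using eps0 e by (intro eventually_conj order_tendstoD eventually_ge_at_top) auto
    then obtain s where s: "\<And>t. t \<ge> s \<Longrightarrow> \<epsilon> t < e / 2 \<and> t \<ge> T" by (auto simp: eventually_at_top_linorder)
    obtain M :: nat where M: "real M \<ge> s" using real_arch_simple by blast
    have *: "cmod (G (\<i> * of_real (real m)) - G (\<i> * of_real (real M))) < e / 2" if "m \<ge> M" for m
      using diff[of "real M" "real m"] s[OF M] that by force
    show "\<exists>M. \<forall>m\<ge>M. \<forall>n\<ge>M. dist (G (\<i> * of_real (real m))) (G (\<i> * of_real (real n))) < e"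
    proof (intro exI[of _ M] allI impI)
      fix m n assume "m \<ge> M" "n \<ge> M"
      then show "dist (G (\<i> * of_real (real m))) (G (\<i> * of_real (real n))) < e"
        using *[of m] *[of n] dist_triangle_half_l[of "G (\<i> * of_real (real m))" "G (\<i> * of_real (real M))" e "G (\<i> * of_real (real n))"]
        by (simp add: dist_norm norm_minus_commute)
    qed
  qed
  then obtain L where L: "(\<lambda>j. G (\<i> * of_real (real j))) \<longlonglongrightarrow> L"
    using Cauchy_convergent convergent_def by blast
  have bound: "cmod (G (\<i> * of_real t) - L) \<le> \<epsilon> t" if "t \<ge> T" for t
  proof -
    have "(\<lambda>j. cmod (G (\<i> * of_real (real j)) - G (\<i> * of_real t))) \<longlonglongrightarrow> cmod (L - G (\<i> * of_real t))"
      by (intro tendsto_intros L)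
    moreover have "\<forall>\<^sub>F j in sequentially. cmod (G (\<i> * of_real (real j)) - G (\<i> * of_real t)) \<le> \<epsilon> t"
    proof -
      have "\<forall>\<^sub>F j in sequentially. real j \<ge> t" using eventually_ge_at_top[of "nat \<lceil>t\<rceil>"] by eventually_elim linarith
      then show ?thesis by eventually_elim (rule diff[OF that])
    qed
    ultimately have "cmod (L - G (\<i> * of_real t)) \<le> \<epsilon> t" by (rule tendsto_upperbound) simp
    then show ?thesis by (simp add: norm_minus_commute)
  qed
  have "\<forall>\<^sub>F t in at_top. cmod (G (\<i> * of_real t) - L) \<le> \<epsilon> t"
    using eventually_ge_at_top[of T] by eventually_elim (rule bound)
  then have "((\<lambda>t. G (\<i> * of_real t) - L) \<longlongrightarrow> 0) at_top"
    by (rule Lim_null_comparison) (rule eps0)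
  then have lim: "((\<lambda>t. G (\<i> * of_real t)) \<longlongrightarrow> L) at_top" by (simp add: LIM_zero_iff)
  show ?thesis
  proof (rule that)
    fix \<alpha> \<beta> :: real assume \<alpha>: "\<alpha> > 0"
    obtain K' c' T' where B: "K' \<ge> 0" "c' > 0" "T' \<ge> 1"
      "\<And>w. \<bar>Re w\<bar> \<le> \<bar>\<beta>\<bar> \<Longrightarrow> Im w \<ge> T' \<Longrightarrow> cmod (F w * (X * w + Y) ^ n) \<le> K' * exp (- c' * Im w)"
      using cusp_decay_poly[OF F abs_ge_zero[of \<beta>]] by metis
    have top: "filterlim (\<lambda>t. \<alpha> * t) at_top at_top"
      using \<alpha> by (rule filterlim_tendsto_pos_mult_at_top[OF tendsto_const _ filterlim_ident])
    have horiz: "cmod (G (of_real \<beta> + \<i> * of_real s) - G (\<i> * of_real s)) \<le> K' * \<bar>\<beta>\<bar> * exp (- c' * s)" if s: "s \<ge> T'" for s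
    proof -
      let ?S = "closed_segment (of_real \<beta> + \<i> * of_real s) (\<i> * of_real s)"
      have seg: "\<bar>Re w\<bar> \<le> \<bar>\<beta>\<bar>" "Im w = s" if w: "w \<in> ?S" for w
      proof -
        obtain u where u: "0 \<le> u" "u \<le> 1" "w = (1 - u) *\<^sub>R (of_real \<beta> + \<i> * of_real s) + u *\<^sub>R (\<i> * of_real s)"
          using w by (auto simp: closed_segment_def)
        have "Re w = Re ((1 - u) *\<^sub>R (of_real \<beta> + \<i> * of_real s) + u *\<^sub>R (\<i> * of_real s))"
          by (rule arg_cong[OF u(3)])
        also have "\<dots> = (1 - u) * \<beta>" by simp
        finally have "\<bar>Re w\<bar> = \<bar>1 - u\<bar> * \<bar>\<beta>\<bar>" by (simp only: abs_mult)
        also have "\<bar>1 - u\<bar> = 1 - u" using u(1,2) by simp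
        also have "(1 - u) * \<bar>\<beta>\<bar> \<le> 1 * \<bar>\<beta>\<bar>" using u(1,2) by (intro mult_right_mono) auto
        finally show "\<bar>Re w\<bar> \<le> \<bar>\<beta>\<bar>" by simp
        have "Im w = Im ((1 - u) *\<^sub>R (of_real \<beta> + \<i> * of_real s) + u *\<^sub>R (\<i> * of_real s))"
          by (rule arg_cong[OF u(3)])
        also have "\<dots> = s" by (simp add: algebra_simps)
        finally show "Im w = s" .
      qed
      have "cmod (G (of_real \<beta> + \<i> * of_real s) - G (\<i> * of_real s)) \<le> K' * exp (- c' * s) * cmod ((of_real \<beta> + \<i> * of_real s) - \<i> * of_real s)"
      proof (rule field_differentiable_bound[where S = ?S])
        fix w assume w: "w \<in> ?S"
        have Im: "T' \<le> Im w" "0 < Im w" using seg(2)[OF w] s B(3) by linarith+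
        show "(G has_field_derivative F w * (X * w + Y) ^ n) (at w within ?S)"
          by (rule has_field_derivative_at_within[OF G[OF Im(2)]])
        show "cmod (F w * (X * w + Y) ^ n) \<le> K' * exp (- c' * s)"
          using B(4)[OF seg(1)[OF w] Im(1)] unfolding seg(2)[OF w] .
      qed auto
      then show ?thesis by (simp add: mult_ac)
    qed
    have "\<forall>\<^sub>F s in at_top. cmod (G (of_real \<beta> + \<i> * of_real s) - G (\<i> * of_real s)) \<le> K' * \<bar>\<beta>\<bar> * exp (- c' * s)"
      using eventually_ge_at_top[of T'] by eventually_elim (rule horiz)
    then have "((\<lambda>s. G (of_real \<beta> + \<i> * of_real s) - G (\<i> * of_real s)) \<longlongrightarrow> 0) at_top"
      by (rule Lim_null_comparison) (rule tendsto_exp_neg[OF B(2)])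
    from tendsto_add[OF this lim]
    have "((\<lambda>s. G (of_real \<beta> + \<i> * of_real s)) \<longlongrightarrow> L) at_top" by simp
    from filterlim_compose[OF this top]
    show "((\<lambda>t. G (of_real \<beta> + \<i> * of_real (\<alpha> * t))) \<longlongrightarrow> L) at_top" .
  qed
qed

text \<open>F is the weight k slash of E by g, so this says that E vanishes at the cusp p = g
  \<infinity>. One matrix is enough, as any other differs from it by an upper triangular factor, see
  \<open>cusp_good_rep\<close>.\<close>

definition cusp_good :: "(complex \<Rightarrow> complex) \<Rightarrow> nat \<Rightarrow> cusp \<Rightarrow> bool" where
  "cusp_good E k p \<longleftrightarrow> (\<exists>g F. mdet g = 1 \<and> act g Cinf = p \<and> cusp_decay F \<and>
     (\<forall>z. Im z > 0 \<longrightarrow> E (mob g z) = mj g z ^ k * F z))"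

section \<open>Cusps as images of infinity, and limits of primitives at them\<close>

lemma act_Cinf: "act g Cinf = (if m21 g = 0 then Cinf else Cfin (m11 g / m21 g))"
  by (simp add: act_def)

lemma act_mmul_Cinf:
  assumes "mdet g = 1" "mdet h = 1"
  shows "act (mmul g h) Cinf = act g (act h Cinf)"
proof (cases "m21 h = 0")
  case True
  then have "m11 h \<noteq> 0" using assms(2) by (auto simp: mdet_def)
  then show ?thesis using True by (simp add: act_def)
next
  case False
  have "m21 g * (m11 h / m21 h) + m22 g = (m21 g * m11 h + m22 g * m21 h) / m21 h"
    "m11 g * (m11 h / m21 h) + m12 g = (m11 g * m11 h + m12 g * m21 h) / m21 h"
    using False by (simp_all add: field_simps)
  then show ?thesis using False by (simp add: act_def)
qed

lemma upper_triangular_mob: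
  assumes "mdet b = 1" "m21 b = 0"
  shows "mob b z = of_real ((m11 b)\<^sup>2) * z + of_real (m11 b * m12 b)" "mj b z = of_real (1 / m11 b)" "m11 b \<noteq> 0"
proof -
  have d: "m11 b * m22 b = 1" using assms by (simp add: mdet_def)
  then show nz: "m11 b \<noteq> 0" by auto
  have i: "m22 b = 1 / m11 b" using d nz by (simp add: field_simps)
  show "mob b z = of_real ((m11 b)\<^sup>2) * z + of_real (m11 b * m12 b)" "mj b z = of_real (1 / m11 b)"
    using nz by (simp_all add: mob_def mj_def i assms field_simps power2_eq_square)
qed

lemma same_cusp_upper:
  assumes "mdet g = 1" "mdet h = 1" "act g Cinf = act h Cinf"
  obtains b where "mdet b = 1" "m21 b = 0" "h = mmul g b"
proof (rule that)
  show "mdet (mmul (minv g) h) = 1" using assms by (simp add: mdet_mmul)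
  show "h = mmul g (mmul (minv g) h)" using mmul_minv_cancel[OF assms(1)] by simp
  show "m21 (mmul (minv g) h) = 0"
    using assms(3) by (auto simp: act_Cinf field_simps split: if_splits)
qed

text \<open>Write h = g b with b upper triangular. The action of b is real affine, so decay persists
  with the rate multiplied by m11(b)^2, and the constant j(b, z) is absorbed into the new F.\<close>

lemma cusp_good_rep:
  assumes "cusp_good E k p" "mdet h = 1" "act h Cinf = p"
  obtains F where "cusp_decay F" "\<And>z. Im z > 0 \<Longrightarrow> E (mob h z) = mj h z ^ k * F z"
proof -
  obtain g F where g: "mdet g = 1" "act g Cinf = p" "cusp_decay F"
    and E: "\<And>z. Im z > 0 \<Longrightarrow> E (mob g z) = mj g z ^ k * F z"
    using assms(1) by (auto simp: cusp_good_def)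
  obtain b where b: "mdet b = 1" "m21 b = 0" "h = mmul g b"
    using same_cusp_upper[OF g(1) assms(2) trans[OF g(2) assms(3)[symmetric]]] .
  note ub = upper_triangular_mob[OF b(1,2)]
  define F' where "F' z = F (mob b z) * of_real (m11 b) ^ k" for z
  show ?thesis
  proof (rule that)
    obtain K c T where F: "K \<ge> 0" "c > 0" "\<And>z. Im z \<ge> T \<Longrightarrow> cmod (F z) \<le> K * exp (- c * Im z)"
      using g(3) by (auto simp: cusp_decay_def)
    show "cusp_decay F'" unfolding cusp_decay_def
    proof (intro exI conjI allI impI)
      show "K * \<bar>m11 b\<bar> ^ k \<ge> 0" "c * (m11 b)\<^sup>2 > 0" using F ub by simp_all
      fix z assume z: "Im z \<ge> T / (m11 b)\<^sup>2"
      have Im: "Im (mob b z) = (m11 b)\<^sup>2 * Im z" by (simp add: ub)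
      have "(m11 b)\<^sup>2 > 0" using ub(3) by simp
      then have "Im (mob b z) \<ge> T" using z unfolding Im by (simp only: pos_divide_le_eq mult.commute)
      from F(3)[OF this] have "cmod (F (mob b z)) * \<bar>m11 b\<bar> ^ k \<le> K * exp (- c * Im (mob b z)) * \<bar>m11 b\<bar> ^ k"
        by (rule mult_right_mono) simp
      then show "cmod (F' z) \<le> K * \<bar>m11 b\<bar> ^ k * exp (- (c * (m11 b)\<^sup>2) * Im z)"
        unfolding Im by (simp add: F'_def norm_mult norm_power mult_ac)
    qed
    fix z assume z: "Im z > 0"
    have "E (mob h z) = mj g (mob b z) ^ k * F (mob b z)"
      unfolding b(3) mob_mmul[OF b(1) z] by (rule E[OF Im_mob[OF b(1) z]])
    moreover have "mj h z = mj g (mob b z) * mj b z" unfolding b(3) by (rule mj_mmul[OF b(1) z])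
    then have "mj h z ^ k * of_real (m11 b) ^ k = mj g (mob b z) ^ k"
      using ub(2,3) by (simp only: power_mult_distrib[symmetric]) simp
    ultimately show "E (mob h z) = mj h z ^ k * F' z" by (simp add: F'_def mult_ac)
  qed
qed

text \<open>Geodesics ending at \<open>p = h \<infinity>\<close> are the images under \<open>h\<close> of vertical lines, so the limit
  of a primitive at a cusp is taken along all of these simultaneously.\<close>
definition cusp_lim :: "(complex \<Rightarrow> complex) \<Rightarrow> cusp \<Rightarrow> complex \<Rightarrow> bool" where
  "cusp_lim H p L \<longleftrightarrow> (\<forall>h. mdet h = 1 \<longrightarrow> act h Cinf = p \<longrightarrow>
     ((\<lambda>t. H (mob h (\<i> * of_real t))) \<longlongrightarrow> L) at_top)"

text \<open>An explicit matrix sending \<infinity> to p; without such a witness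
  \<open>cusp_lim\<close> could hold vacuously, and limits would not be unique.\<close>

definition cusp_mat :: "cusp \<Rightarrow> m2" where
  "cusp_mat p = (case p of Cinf \<Rightarrow> \<lparr>m11 = 1, m12 = 0, m21 = 0, m22 = 1\<rparr>
     | Cfin x \<Rightarrow> \<lparr>m11 = x, m12 = -1, m21 = 1, m22 = 0\<rparr>)"

lemma cusp_mat: "mdet (cusp_mat p) = 1" "act (cusp_mat p) Cinf = p"
  by (auto simp: cusp_mat_def mdet_def act_def split: cusp.splits)

lemma cusp_lim_unique: "cusp_lim H p L \<Longrightarrow> cusp_lim H p L' \<Longrightarrow> L = L'"
  using cusp_mat[of p] unfolding cusp_lim_def
  by (intro tendsto_unique[OF trivial_limit_at_top_linorder, of "\<lambda>t. H (mob (cusp_mat p) (\<i> * of_real t))"]) simp_all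

lemma cusp_lim_compose:
  assumes "cusp_lim H (act \<gamma> p) L" "mdet \<gamma> = 1"
  shows "cusp_lim (H \<circ> mob \<gamma>) p L"
  unfolding cusp_lim_def
proof (intro allI impI)
  fix h assume h: "mdet h = 1" "act h Cinf = p"
  have "mdet (mmul \<gamma> h) = 1" "act (mmul \<gamma> h) Cinf = act \<gamma> p"
    using h assms(2) by (simp_all add: mdet_mmul act_mmul_Cinf)
  with assms(1) have "((\<lambda>t. H (mob (mmul \<gamma> h) (\<i> * of_real t))) \<longlongrightarrow> L) at_top"
    by (simp add: cusp_lim_def)
  moreover have "\<forall>\<^sub>F t in at_top. H (mob (mmul \<gamma> h) (\<i> * of_real t)) = (H \<circ> mob \<gamma>) (mob h (\<i> * of_real t))"
    using eventually_gt_at_top[of 0] by eventually_elim (simp add: mob_mmul[OF h(1)])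
  ultimately show "((\<lambda>t. (H \<circ> mob \<gamma>) (mob h (\<i> * of_real t))) \<longlongrightarrow> L) at_top"
    using tendsto_cong by force
qed

lemma cusp_lim_affine:
  assumes "cusp_lim H p L" "\<And>z. Im z > 0 \<Longrightarrow> G z = c * H z + d"
  shows "cusp_lim G p (c * L + d)"
  unfolding cusp_lim_def
proof (intro allI impI)
  fix h assume h: "mdet h = 1" "act h Cinf = p"
  then have "((\<lambda>t. c * H (mob h (\<i> * of_real t)) + d) \<longlongrightarrow> c * L + d) at_top"
    using assms(1) by (intro tendsto_intros) (simp add: cusp_lim_def)
  moreover have "\<forall>\<^sub>F t in at_top. c * H (mob h (\<i> * of_real t)) + d = G (mob h (\<i> * of_real t))"
    using eventually_gt_at_top[of 0] by eventually_elim (simp add: assms(2) Im_mob[OF h(1)])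
  ultimately show "((\<lambda>t. G (mob h (\<i> * of_real t))) \<longlongrightarrow> c * L + d) at_top"
    using tendsto_cong by force
qed

text \<open>The weights match: k - 2 powers of j(g, z) clear the denominators of the polynomial, and
  the derivative j(g, z)^-2 of the Moebius map consumes the remaining two.\<close>

lemma primitive_compose_deriv:
  assumes k: "k \<ge> 2" and g: "mdet g = 1" and z: "Im z > 0"
    and H: "\<And>z. Im z > 0 \<Longrightarrow> (H has_field_derivative E z * (X * z + Y) ^ (k - 2)) (at z)"
    and E: "E (mob g z) = mj g z ^ k * F z"
  shows "((H \<circ> mob g) has_field_derivative
    F z * ((X * of_real (m11 g) + Y * of_real (m21 g)) * z + (X * of_real (m12 g) + Y * of_real (m22 g))) ^ (k - 2)) (at z)"
proof -
  have nz: "mj g z \<noteq> 0" by (rule mj_nonzero[OF g z])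
  have "(X * of_real (m11 g) + Y * of_real (m21 g)) * z + (X * of_real (m12 g) + Y * of_real (m22 g)) =
      (X * mob g z + Y) * mj g z"
    using nz by (simp add: mob_def distrib_right) (simp add: mj_def algebra_simps)
  moreover have "k = (k - 2) + 2" using k by simp
  then have "mj g z ^ k = mj g z ^ (k - 2) * mj g z ^ 2" by (metis power_add)
  ultimately have eq: "E (mob g z) * (X * mob g z + Y) ^ (k - 2) * (1 / mj g z ^ 2) =
      F z * ((X * of_real (m11 g) + Y * of_real (m21 g)) * z + (X * of_real (m12 g) + Y * of_real (m22 g))) ^ (k - 2)"
    using nz by (simp add: E power_mult_distrib)
  show ?thesis
    using DERIV_chain[OF H[OF Im_mob[OF g z]] mob_has_derivative[OF g z]] unfolding eq .
qed

text \<open>Composed with g, the primitive has the derivative required by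
  \<open>vertical_limit_exists\<close>. Passing from g to h = g b replaces the imaginary axis by the
  line with \<alpha> = m11(b)^2 and \<beta> = m11(b) m12(b), on which the limit is the same.\<close>

lemma cusp_lim_exists:
  assumes good: "cusp_good E k p" and k: "k \<ge> 2"
    and H: "\<And>z. Im z > 0 \<Longrightarrow> (H has_field_derivative E z * (X * z + Y) ^ (k - 2)) (at z)"
  obtains L where "cusp_lim H p L"
proof -
  obtain g F where g: "mdet g = 1" "act g Cinf = p" "cusp_decay F"
    and E: "\<And>z. Im z > 0 \<Longrightarrow> E (mob g z) = mj g z ^ k * F z"
    using good by (auto simp: cusp_good_def)
  have d: "((H \<circ> mob g) has_field_derivative F z * ((X * of_real (m11 g) + Y * of_real (m21 g)) * z +
      (X * of_real (m12 g) + Y * of_real (m22 g))) ^ (k - 2)) (at z)" if "Im z > 0" for z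
    by (rule primitive_compose_deriv[where E = E and H = H and F = F and X = X and Y = Y, OF k g(1) that H E[OF that]])
  obtain L where L: "\<And>\<alpha> \<beta>. \<alpha> > 0 \<Longrightarrow> ((\<lambda>t. (H \<circ> mob g) (of_real \<beta> + \<i> * of_real (\<alpha> * t))) \<longlongrightarrow> L) at_top"
    using vertical_limit_exists[OF d g(3)] by blast
  have "cusp_lim H p L" unfolding cusp_lim_def
  proof (intro allI impI)
    fix h assume h: "mdet h = 1" "act h Cinf = p"
    obtain b where b: "mdet b = 1" "m21 b = 0" "h = mmul g b"
      using same_cusp_upper[OF g(1) h(1) trans[OF g(2) h(2)[symmetric]]] .
    note ub = upper_triangular_mob[OF b(1,2)]
    have "\<forall>\<^sub>F t in at_top. (H \<circ> mob g) (of_real (m11 b * m12 b) + \<i> * of_real ((m11 b)\<^sup>2 * t)) = H (mob h (\<i> * of_real t))"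
      using eventually_gt_at_top[of 0]
    proof eventually_elim
      case (elim t)
      then have "mob h (\<i> * of_real t) = mob g (mob b (\<i> * of_real t))" unfolding b(3) by (intro mob_mmul b) simp
      then show ?case by (simp add: ub algebra_simps)
    qed
    moreover have "((\<lambda>t. (H \<circ> mob g) (of_real (m11 b * m12 b) + \<i> * of_real ((m11 b)\<^sup>2 * t))) \<longlongrightarrow> L) at_top"
      by (rule L) (use ub in simp)
    ultimately show "((\<lambda>t. H (mob h (\<i> * of_real t))) \<longlongrightarrow> L) at_top"
      using tendsto_cong by force
  qed
  then show ?thesis by (rule that)
qed

text \<open>Provides one majorant on all of (0, \<infinity>) for dominated convergence. For large t
  it comes from the decay at \<infinity>; for small t from the decay at x, as the matrix (x, -1; 1,
  0) sends i/t to x + i t; the range between is compact.\<close>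

lemma vertical_line_exp_bound:
  assumes good: "cusp_good E k Cinf" "cusp_good E k (Cfin x)" and E: "E holomorphic_on uhp"
  obtains M c where "c > 0"
    "\<And>t. t > 0 \<Longrightarrow> cmod (E (of_real x + \<i> * of_real t) * (X * (of_real x + \<i> * of_real t) + Y) ^ n) \<le> M * exp (- c * t)"
proof -
  define \<phi> where "\<phi> t = E (of_real x + \<i> * of_real t) * (X * (of_real x + \<i> * of_real t) + Y) ^ n" for t
  have "mdet \<lparr>m11 = 1, m12 = x, m21 = 0, m22 = 1\<rparr> = 1" "act \<lparr>m11 = 1, m12 = x, m21 = 0, m22 = 1\<rparr> Cinf = Cinf"
    by (simp_all add: mdet_def act_def)
  from cusp_good_rep[OF good(1) this] obtain F1 where F1: "cusp_decay F1"
    "\<And>z. Im z > 0 \<Longrightarrow> E (z + of_real x) = F1 z" by (auto simp: mob_def mj_def)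
  have "act \<lparr>m11 = x, m12 = -1, m21 = 1, m22 = 0\<rparr> Cinf = Cfin x" "mdet \<lparr>m11 = x, m12 = -1, m21 = 1, m22 = 0\<rparr> = 1"
    by (simp_all add: mdet_def act_def)
  from cusp_good_rep[OF good(2) this(2,1)] obtain F2 where F2: "cusp_decay F2"
    "\<And>z. Im z > 0 \<Longrightarrow> E ((of_real x * z - 1) / z) = z ^ k * F2 z" by (auto simp: mob_def mj_def)
  obtain K1 c1 T1 where b1: "K1 \<ge> 0" "c1 > 0" "T1 \<ge> 1"
    "\<And>w. \<bar>Re w\<bar> \<le> 0 \<Longrightarrow> Im w \<ge> T1 \<Longrightarrow> cmod (F1 w * (X * w + (X * of_real x + Y)) ^ n) \<le> K1 * exp (- c1 * Im w)"
    using cusp_decay_poly[OF F1(1) order_refl] by metis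
  obtain K2 c2 T2 where b2: "K2 \<ge> 0" "c2 > 0" "T2 \<ge> 1"
    "\<And>w. \<bar>Re w\<bar> \<le> 0 \<Longrightarrow> Im w \<ge> T2 \<Longrightarrow> cmod (F2 w * (1 * w + 0) ^ k) \<le> K2 * exp (- c2 * Im w)"
    using cusp_decay_poly[OF F2(1) order_refl] by metis
  have large: "cmod (\<phi> t) \<le> K1 * exp (- c1 * t)" if "t \<ge> T1" for t
    using b1(4)[of "\<i> * of_real t"] F1(2)[of "\<i> * of_real t"] that b1(3)
    by (simp add: \<phi>_def add_ac distrib_left)
  define B where "B = (cmod X * (\<bar>x\<bar> + 1) + cmod Y) ^ n"
  have B: "B \<ge> 0" by (simp add: B_def)
  have small: "cmod (\<phi> t) \<le> K2 * B" if t: "0 < t" "t \<le> 1 / T2" for t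
  proof -
    let ?w = "\<i> * of_real (1 / t)"
    have T2: "T2 \<le> 1 / t" using t b2(3) by (simp add: field_simps)
    have arg: "(of_real x * ?w - 1) / ?w = of_real x + \<i> * of_real t"
      using t by (simp add: field_simps)
    have "cmod (E (of_real x + \<i> * of_real t)) = cmod (F2 ?w * (1 * ?w + 0) ^ k)"
      using F2(2)[of ?w] t unfolding arg by (simp add: mult.commute)
    also have "\<dots> \<le> K2 * exp (- c2 * (1 / t))" using b2(4)[of ?w] T2 by simp
    also have "\<dots> \<le> K2 * 1" using b2 t by (intro mult_left_mono) auto
    finally have e: "cmod (E (of_real x + \<i> * of_real t)) \<le> K2" by simp
    have "1 / T2 \<le> 1" using b2(3) by simp
    then have t1: "t \<le> 1" using t by simp
    have "cmod (X * (of_real x + \<i> * of_real t) + Y) \<le> cmod X * cmod (of_real x + \<i> * of_real t) + cmod Y"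
      by (metis norm_mult norm_triangle_ineq)
    also have "cmod (of_real x + \<i> * of_real t) \<le> \<bar>x\<bar> + 1"
      using norm_triangle_ineq[of "of_real x :: complex" "\<i> * of_real t"] t t1 by (simp add: norm_mult)
    finally have "cmod (X * (of_real x + \<i> * of_real t) + Y) \<le> cmod X * (\<bar>x\<bar> + 1) + cmod Y"
      by (simp add: mult_left_mono)
    then have "cmod (X * (of_real x + \<i> * of_real t) + Y) ^ n \<le> B" unfolding B_def by (intro power_mono) auto
    then show ?thesis unfolding \<phi>_def norm_mult norm_power using e b2(1) by (intro mult_mono) auto
  qed
  have "continuous_on {1 / T2..T1} \<phi>"
  proof -
    have "continuous_on {1 / T2..T1} (\<lambda>t. E (of_real x + \<i> * of_real t))"
    proof (rule continuous_on_compose2[OF holomorphic_on_imp_continuous_on[OF E]])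
      have "1 / T2 > 0" using b2(3) by simp
      then have "t > 0" if "t \<in> {1 / T2..T1}" for t using that by (simp only: atLeastAtMost_iff) linarith
      then show "(\<lambda>t. of_real x + \<i> * of_real t) ` {1 / T2..T1} \<subseteq> uhp"
        unfolding mem_uhp subset_iff by (auto simp del: atLeastAtMost_iff)
    qed (intro continuous_intros)
    then show ?thesis unfolding \<phi>_def by (intro continuous_intros)
  qed
  then have "compact (\<phi> ` {1 / T2..T1})" by (intro compact_continuous_image compact_Icc)
  then obtain B' where B': "\<And>t. t \<in> {1 / T2..T1} \<Longrightarrow> cmod (\<phi> t) \<le> B'"
    using compact_imp_bounded by (metis bounded_iff imageI)
  define M0 where "M0 = \<bar>B'\<bar> + K2 * B"
  have M0: "M0 \<ge> 0" using b2 B by (simp add: M0_def)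
  have mid: "cmod (\<phi> t) \<le> M0" if "0 < t" "t \<le> T1" for t
  proof (cases "t \<le> 1 / T2")
    case True
    then show ?thesis using small[OF that(1)] by (auto simp: M0_def)
  next
    case False
    then have "cmod (\<phi> t) \<le> B'" using that by (intro B') auto
    moreover have "K2 * B \<ge> 0" using b2 B by simp
    ultimately show ?thesis unfolding M0_def by linarith
  qed
  show ?thesis
  proof (rule that[of c1 "K1 + M0 * exp (c1 * T1)"])
    fix t :: real assume t: "t > 0"
    have "cmod (\<phi> t) \<le> (K1 + M0 * exp (c1 * T1)) * exp (- c1 * t)"
    proof (cases "t \<ge> T1")
      case True
      have "M0 * exp (c1 * T1) * exp (- c1 * t) \<ge> 0" using M0 by simp
      then show ?thesis using large[OF True] unfolding distrib_right by linarith
    next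
      case False
      then have "0 \<le> c1 * (T1 - t)" using b1 by simp
      then have "M0 * 1 \<le> M0 * exp (c1 * (T1 - t))" by (intro mult_left_mono M0) simp
      also have "\<dots> = M0 * exp (c1 * T1) * exp (- c1 * t)" by (simp add: mult.assoc exp_add[symmetric] algebra_simps)
      finally have "M0 \<le> M0 * exp (c1 * T1) * exp (- c1 * t)" by simp
      moreover have "K1 * exp (- c1 * t) \<ge> 0" using b1 by simp
      ultimately show ?thesis using mid[OF t] False unfolding distrib_right by linarith
    qed
    then show "cmod (E (of_real x + \<i> * of_real t) * (X * (of_real x + \<i> * of_real t) + Y) ^ n)
      \<le> (K1 + M0 * exp (c1 * T1)) * exp (- c1 * t)" by (simp only: \<phi>_def)
  qed (rule b1(2))
qed

lemma cusp_lim_vertical: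
  assumes H: "cusp_lim H (Cfin x) L" "cusp_lim H Cinf L'"
  shows "(\<lambda>j. H (of_real x + \<i> * of_real (1 / (real j + 1)))) \<longlonglongrightarrow> L"
    "(\<lambda>j. H (of_real x + \<i> * of_real (real j + 1))) \<longlonglongrightarrow> L'"
proof -
  have top: "filterlim (\<lambda>j. real j + 1) at_top sequentially" by real_asymp
  let ?g = "\<lparr>m11 = 1, m12 = x, m21 = 0, m22 = 1\<rparr>" and ?h = "\<lparr>m11 = x, m12 = -1, m21 = 1, m22 = 0\<rparr>"
  have g: "mdet ?g = 1" "act ?g Cinf = Cinf" and h: "mdet ?h = 1" "act ?h Cinf = Cfin x"
    by (simp_all add: mdet_def act_def)
  have mg: "mob ?g (\<i> * of_real (real j + 1)) = of_real x + \<i> * of_real (real j + 1)" for j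
    by (simp add: mob_def mj_def)
  have "((\<lambda>t. H (mob ?g (\<i> * of_real t))) \<longlongrightarrow> L') at_top"
    using H(2) g unfolding cusp_lim_def by blast
  from filterlim_compose[OF this top] show "(\<lambda>j. H (of_real x + \<i> * of_real (real j + 1))) \<longlonglongrightarrow> L'"
    unfolding mg .
  have mh: "mob ?h (\<i> * of_real (real j + 1)) = of_real x + \<i> * of_real (1 / (real j + 1))" for j
  proof -
    define r where "r = complex_of_real (real j + 1)"
    have r: "r \<noteq> 0" unfolding r_def of_real_eq_0_iff by linarith
    have "(of_real x * (\<i> * r) - 1) / (\<i> * r) = of_real x + \<i> * (1 / r)"
      using r by (simp add: field_simps)
    moreover have "complex_of_real (1 / (real j + 1)) = 1 / r" by (simp add: r_def)
    ultimately show ?thesis unfolding r_def[symmetric] by (simp add: mob_def mj_def)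
  qed
  have "((\<lambda>t. H (mob ?h (\<i> * of_real t))) \<longlongrightarrow> L) at_top"
    using H(1) h unfolding cusp_lim_def by blast
  from filterlim_compose[OF this top] show "(\<lambda>j. H (of_real x + \<i> * of_real (1 / (real j + 1)))) \<longlonglongrightarrow> L"
    unfolding mh .
qed

text \<open>The fundamental theorem of calculus on [1/(j + 1), j + 1], followed by dominated
  convergence. \<open>cusp_int\<close> runs downwards from \<infinity>, hence the limit at p minus
  the limit at \<infinity>.\<close>

lemma cusp_int_eq_limits:
  assumes good: "cusp_good E k Cinf" "cusp_good E k p" and E: "E holomorphic_on uhp"
    and H: "\<And>z. Im z > 0 \<Longrightarrow> (H has_field_derivative E z * (X * z + Y) ^ n) (at z)"
    and lim: "cusp_lim H p L" "cusp_lim H Cinf L'"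
  shows "cusp_int (\<lambda>z. E z * (X * z + Y) ^ n) p = L - L'"
proof (cases p)
  case Cinf
  then show ?thesis using cusp_lim_unique lim by (auto simp: cusp_int_def)
next
  case (Cfin x)
  define \<psi> where "\<psi> t = \<i> * (E (of_real x + \<i> * of_real t) * (X * (of_real x + \<i> * of_real t) + Y) ^ n)" for t
  define f where "f j t = (if t \<in> {1 / (real j + 1)..real j + 1} then \<psi> t else 0)" for j t
  obtain M c where Mc: "c > 0"
    "\<And>t. t > 0 \<Longrightarrow> cmod (E (of_real x + \<i> * of_real t) * (X * (of_real x + \<i> * of_real t) + Y) ^ n) \<le> M * exp (- c * t)"
    using vertical_line_exp_bound[OF good(1) good(2)[unfolded Cfin] E] by metis
  have \<psi>_bound: "cmod (\<psi> t) \<le> M * exp (- c * t)" if "t > 0" for t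
    using Mc(2)[OF that] by (simp add: \<psi>_def norm_mult)
  have der: "((\<lambda>t. H (of_real x + \<i> * of_real t)) has_vector_derivative \<psi> t) (at t)" if "t > 0" for t
  proof -
    have "((\<lambda>t. of_real x + \<i> * of_real t) has_vector_derivative \<i>) (at t)"
      by (auto intro!: derivative_eq_intros)
    from field_vector_diff_chain_at[OF this H] that show ?thesis by (simp add: o_def \<psi>_def)
  qed
  have f_int: "(f j has_integral (H (of_real x + \<i> * of_real (real j + 1)) - H (of_real x + \<i> * of_real (1 / (real j + 1))))) {0<..}" for j
  proof -
    have pos: "1 / (real j + 1) > 0" by simp
    have le: "1 / (real j + 1) \<le> real j + 1"
      by (rule order_trans[of _ 1]) auto
    have "(\<psi> has_integral (H (of_real x + \<i> * of_real (real j + 1)) - H (of_real x + \<i> * of_real (1 / (real j + 1)))))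
        {1 / (real j + 1)..real j + 1}"
    proof (rule fundamental_theorem_of_calculus[OF le])
      fix t assume "t \<in> {1 / (real j + 1)..real j + 1}"
      then have "t > 0" using pos by (simp only: atLeastAtMost_iff) linarith
      then show "((\<lambda>t. H (of_real x + \<i> * of_real t)) has_vector_derivative \<psi> t) (at t within {1 / (real j + 1)..real j + 1})"
        by (rule has_vector_derivative_at_within[OF der])
    qed
    moreover have "{1 / (real j + 1)..real j + 1} \<subseteq> {0<..}"
      using pos by (intro subsetI) (simp only: atLeastAtMost_iff greaterThan_iff, linarith)
    ultimately show ?thesis unfolding f_def by (subst has_integral_restrict)
  qed
  have expint: "(\<lambda>t. M * exp (- c * t)) integrable_on {0<..}"
  proof -
    have "(\<lambda>t. exp (- c * t)) integrable_on {0<..}"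
    proof (rule integrable_spike_set[OF integrable_on_exp_minus_to_infinity[OF Mc(1), of 0]])
      show "negligible {t \<in> {0..} - {0<..}. exp (- c * t) \<noteq> 0}"
        by (rule negligible_subset[of "{0}"]) auto
      show "negligible {t \<in> {0<..} - {0..}. exp (- c * t) \<noteq> 0}"
        by (rule negligible_subset[of "{}"]) auto
    qed
    then show ?thesis using integrable_on_cmult_left[of "\<lambda>t. exp (- c * t)" "{0<..}" M] by simp
  qed
  have "(\<lambda>j. integral {0<..} (f j)) \<longlonglongrightarrow> integral {0<..} \<psi>"
  proof (rule dominated_convergence(2)[OF _ expint])
    show "f j integrable_on {0<..}" for j using f_int by blast
    show "norm (f j t) \<le> M * exp (- c * t)" if "t \<in> {0<..}" for j t
      using \<psi>_bound[of t] that order_trans[OF norm_ge_zero \<psi>_bound[of t]] by (auto simp: f_def)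
    fix t :: real assume "t \<in> {0<..}"
    then have t: "t > 0" by simp
    have "\<forall>\<^sub>F j in sequentially. real j \<ge> max t (1 / t)"
      using eventually_ge_at_top[of "nat \<lceil>max t (1 / t)\<rceil>"] by eventually_elim linarith
    then have "\<forall>\<^sub>F j in sequentially. f j t = \<psi> t"
    proof eventually_elim
      case (elim j)
      have "1 / t \<le> real j + 1" "t \<le> real j + 1" using elim by auto
      then have "1 / (real j + 1) \<le> t" using t by (simp add: field_simps)
      then show ?case using \<open>t \<le> real j + 1\<close> by (simp add: f_def)
    qed
    then show "(\<lambda>j. f j t) \<longlonglongrightarrow> \<psi> t" by (rule tendsto_eventually)
  qed
  moreover have "(\<lambda>j. integral {0<..} (f j)) \<longlonglongrightarrow> L' - L"
    unfolding integral_unique[OF f_int]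
    using cusp_lim_vertical[OF lim(1)[unfolded Cfin] lim(2)] by (intro tendsto_diff)
  ultimately have "integral {0<..} \<psi> = L' - L" by (rule LIMSEQ_unique)
  then have "\<i> * integral {0<..} (\<lambda>t. E (of_real x + \<i> * of_real t) * (X * (of_real x + \<i> * of_real t) + Y) ^ n) = L' - L"
    unfolding \<psi>_def by simp
  then have "- (\<i> * integral {0<..} (\<lambda>t. E (of_real x + \<i> * of_real t) * (X * (of_real x + \<i> * of_real t) + Y) ^ n)) = L - L'"
    by simp
  then show ?thesis by (simp add: cusp_int_def Cfin)
qed

lemma uhp_primitive:
  assumes "E holomorphic_on uhp"
  obtains H where "\<And>z. Im z > 0 \<Longrightarrow> (H has_field_derivative E z * (X * z + Y) ^ n) (at z)"
proof -
  have "(\<lambda>z. E z * (X * z + Y) ^ n) holomorphic_on uhp"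
    by (intro holomorphic_intros assms)
  then obtain H where H: "\<And>z. z \<in> uhp \<Longrightarrow> (H has_field_derivative E z * (X * z + Y) ^ n) (at z within uhp)"
    using holomorphic_convex_primitive'[OF convex_uhp open_uhp] by blast
  show ?thesis
    by (rule that[of H]) (use H at_within_open[OF _ open_uhp] in \<open>auto simp: mem_uhp\<close>)
qed

lemma act_minv_Cinf: "mdet g = 1 \<Longrightarrow> act g (act (minv g) Cinf) = Cinf"
  by (subst act_mmul_Cinf[symmetric]) (simp_all add: act_def mdet_def mult.commute)

text \<open>If \<open>H\<close> is a primitive of \<open>E (X z + Y)\<^sup>k\<^sup>-\<^sup>2\<close>, then \<open>H \<circ> \<gamma>\<close> is one of the
  transformed integrand, and the two have the same limits at \<open>\<gamma> p\<close> and \<open>p\<close>.\<close>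
lemma cusp_int_transform:
  assumes k: "k \<ge> 2" and \<gamma>: "mdet \<gamma> = 1"
    and E: "E holomorphic_on uhp" and E': "E' holomorphic_on uhp"
    and tr: "\<And>z. Im z > 0 \<Longrightarrow> E (mob \<gamma> z) = c * mj \<gamma> z ^ k * E' z"
    and good: "cusp_good E k Cinf" "cusp_good E k (act \<gamma> p)"
      "cusp_good E' k Cinf" "cusp_good E' k p" "cusp_good E' k (act (minv \<gamma>) Cinf)"
    and XY: "X' = X * of_real (m11 \<gamma>) + Y * of_real (m21 \<gamma>)" "Y' = X * of_real (m12 \<gamma>) + Y * of_real (m22 \<gamma>)"
  shows "cusp_int (\<lambda>z. E z * (X * z + Y) ^ (k - 2)) (act \<gamma> p) =
    c * (cusp_int (\<lambda>z. E' z * (X' * z + Y') ^ (k - 2)) p -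
         cusp_int (\<lambda>z. E' z * (X' * z + Y') ^ (k - 2)) (act (minv \<gamma>) Cinf))"
proof -
  let ?r = "act (minv \<gamma>) Cinf"
  obtain H where H: "\<And>z. Im z > 0 \<Longrightarrow> (H has_field_derivative E z * (X * z + Y) ^ (k - 2)) (at z)"
    using uhp_primitive[OF E] by blast
  obtain H' where H': "\<And>z. Im z > 0 \<Longrightarrow> (H' has_field_derivative E' z * (X' * z + Y') ^ (k - 2)) (at z)"
    using uhp_primitive[OF E'] by blast
  obtain L where L: "cusp_lim H (act \<gamma> p) L" using cusp_lim_exists[OF good(2) k H] by blast
  obtain L0 where L0: "cusp_lim H Cinf L0" using cusp_lim_exists[OF good(1) k H] by blast
  obtain l0 where l0: "cusp_lim H' Cinf l0" using cusp_lim_exists[OF good(3) k H'] by blast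
  obtain l where l: "cusp_lim H' p l" using cusp_lim_exists[OF good(4) k H'] by blast
  obtain lr where lr: "cusp_lim H' ?r lr" using cusp_lim_exists[OF good(5) k H'] by blast
  have D: "((H \<circ> mob \<gamma>) has_field_derivative (c * E' z) * (X' * z + Y') ^ (k - 2)) (at z)" if "Im z > 0" for z
    unfolding XY
    by (rule primitive_compose_deriv[where E = E and H = H and F = "\<lambda>z. c * E' z" and X = X and Y = Y, OF k \<gamma> that H])
      (use tr[OF that] in \<open>simp_all add: mult_ac\<close>)
  have "((\<lambda>z. (H \<circ> mob \<gamma>) z - c * H' z) has_field_derivative 0) (at z within uhp)" if "z \<in> uhp" for z
  proof -
    have z: "Im z > 0" using that by (simp add: mem_uhp)
    have "(c * E' z) * (X' * z + Y') ^ (k - 2) - c * (E' z * (X' * z + Y') ^ (k - 2)) = 0" by simp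
    with DERIV_diff[OF D[OF z] DERIV_cmult[OF H'[OF z], of c]] show ?thesis
      by (metis has_field_derivative_at_within)
  qed
  then obtain d where d: "\<And>z. z \<in> uhp \<Longrightarrow> (H \<circ> mob \<gamma>) z - c * H' z = d"
    using has_field_derivative_zero_constant[OF convex_uhp, of "\<lambda>z. (H \<circ> mob \<gamma>) z - c * H' z"] by blast
  have aff: "(H \<circ> mob \<gamma>) z = c * H' z + d" if "Im z > 0" for z
    using d[of z] that by (simp add: mem_uhp algebra_simps)
  have 1: "L = c * l + d"
    by (rule cusp_lim_unique[OF cusp_lim_compose[OF L \<gamma>] cusp_lim_affine[OF l aff]])
  \<comment> \<open>\<gamma> sends \<gamma>^-1 \<infinity> to \<infinity>, so the integration
    constant d is eliminated by the limit of H' at this third cusp.\<close>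
  have 2: "L0 = c * lr + d"
    by (rule cusp_lim_unique[OF cusp_lim_compose[OF _ \<gamma>] cusp_lim_affine[OF lr aff]])
      (simp add: act_minv_Cinf[OF \<gamma>] L0)
  have "cusp_int (\<lambda>z. E z * (X * z + Y) ^ (k - 2)) (act \<gamma> p) = L - L0"
    by (rule cusp_int_eq_limits[OF good(1,2) E H L L0])
  moreover have "cusp_int (\<lambda>z. E' z * (X' * z + Y') ^ (k - 2)) p = l - l0"
    by (rule cusp_int_eq_limits[OF good(3,4) E' H' l l0])
  moreover have "cusp_int (\<lambda>z. E' z * (X' * z + Y') ^ (k - 2)) ?r = lr - l0"
    by (rule cusp_int_eq_limits[OF good(3,5) E' H' lr l0])
  moreover have "L - L0 = c * ((l - l0) - (lr - l0))" using 1 2 by (simp add: algebra_simps)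
  ultimately show ?thesis by (simp only:)
qed

lemma cusp_good_transfer:
  assumes good: "cusp_good E' k p" and \<gamma>: "mdet \<gamma> = 1"
    and tr: "\<And>z. Im z > 0 \<Longrightarrow> E (mob \<gamma> z) = c * mj \<gamma> z ^ k * E' z"
  shows "cusp_good E k (act \<gamma> p)"
proof -
  obtain g F where g: "mdet g = 1" "act g Cinf = p" "cusp_decay F"
    and E': "\<And>z. Im z > 0 \<Longrightarrow> E' (mob g z) = mj g z ^ k * F z"
    using good by (auto simp: cusp_good_def)
  obtain K b T where F: "K \<ge> 0" "b > 0" "\<And>z. Im z \<ge> T \<Longrightarrow> cmod (F z) \<le> K * exp (- b * Im z)"
    using g(3) by (auto simp: cusp_decay_def)
  show ?thesis unfolding cusp_good_def
  proof (intro exI conjI allI impI)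
    show "mdet (mmul \<gamma> g) = 1" "act (mmul \<gamma> g) Cinf = act \<gamma> p"
      using g \<gamma> by (simp_all add: mdet_mmul act_mmul_Cinf)
    show "cusp_decay (\<lambda>z. c * F z)" unfolding cusp_decay_def
    proof (intro exI conjI allI impI)
      show "cmod c * K \<ge> 0" "b > 0" using F by simp_all
      fix z assume "Im z \<ge> T"
      from mult_left_mono[OF F(3)[OF this], of "cmod c"]
      show "cmod (c * F z) \<le> cmod c * K * exp (- b * Im z)" by (simp add: norm_mult mult.assoc)
    qed
    fix z assume z: "Im z > 0"
    have "E (mob (mmul \<gamma> g) z) = c * mj \<gamma> (mob g z) ^ k * E' (mob g z)"
      unfolding mob_mmul[OF g(1) z] by (rule tr[OF Im_mob[OF g(1) z]])
    then show "E (mob (mmul \<gamma> g) z) = mj (mmul \<gamma> g) z ^ k * (c * F z)"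
      by (simp add: E'[OF z] mj_mmul[OF g(1) z] power_mult_distrib)
  qed
qed

lemma cusp_good_Cinf:
  assumes "cusp_decay E"
  shows "cusp_good E k Cinf"
  unfolding cusp_good_def
  by (rule exI[of _ "\<lparr>m11 = 1, m12 = 0, m21 = 0, m22 = 1\<rparr>"], rule exI[of _ E])
    (use assms in \<open>simp add: mdet_def act_def mob_def mj_def\<close>)

section \<open>The reciprocity formula\<close>

lemma cusp_int_cmult: "cusp_int (\<lambda>z. c * f z) p = c * cusp_int f p"
  by (cases p) (simp_all add: cusp_int_def)

text \<open>Homogeneity moves j^(k - 2) inside the power and clears the denominator of \<gamma> x.
  If \<gamma> x = \<infinity>, both sides vanish: \<open>S_hat\<close> is 0 there, and so is the
  integral from \<infinity> to \<infinity>.\<close>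

lemma slash_S_hat:
  "slash k \<gamma> (S_hat E t k) x = (-1) ^ k * t * of_nat (k - 1) *
     cusp_int (\<lambda>z. E z * (of_real (jfac \<gamma> x) * z + - of_real (m11 \<gamma> * x + m12 \<gamma>)) ^ (k - 2)) (act \<gamma> (Cfin x))"
proof (cases "jfac \<gamma> x = 0")
  case True
  then show ?thesis by (simp add: slash_def act_def jfac_def S_hat_def cusp_int_def)
next
  case False
  let ?j = "complex_of_real (jfac \<gamma> x)"
  define y where "y = (m11 \<gamma> * x + m12 \<gamma>) / jfac \<gamma> x"
  have act: "act \<gamma> (Cfin x) = Cfin y" using False by (simp add: act_def jfac_def y_def)
  have "?j * z + - of_real (m11 \<gamma> * x + m12 \<gamma>) = ?j * (z - of_real y)" for z
    using False by (simp add: y_def right_diff_distrib)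
  then have "cusp_int (\<lambda>z. E z * (?j * z + - of_real (m11 \<gamma> * x + m12 \<gamma>)) ^ (k - 2)) (Cfin y) =
      cusp_int (\<lambda>z. ?j ^ (k - 2) * (E z * (z - of_real y) ^ (k - 2))) (Cfin y)"
    by (simp only: power_mult_distrib mult.left_commute)
  then show ?thesis by (simp add: slash_def act S_hat_def cusp_int_cmult)
qed

text \<open>Here the path ends at g \<infinity> and not at \<gamma> x, so the case \<gamma> x =
  \<infinity> need not give 0; the homogeneous value chosen in \<open>slashP\<close> is the
  right-hand side with j = 0.\<close>

lemma slashP_phi:
  "slashP k \<gamma> (phi E k g) x =
     cusp_int (\<lambda>z. E z * (of_real (jfac \<gamma> x) * z + - of_real (m11 \<gamma> * x + m12 \<gamma>)) ^ (k - 2)) (act g Cinf)"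
proof (cases "jfac \<gamma> x = 0")
  case True
  then show ?thesis by (simp add: slashP_def act_def jfac_def phi_def)
next
  case False
  let ?j = "complex_of_real (jfac \<gamma> x)"
  define y where "y = (m11 \<gamma> * x + m12 \<gamma>) / jfac \<gamma> x"
  have act: "act \<gamma> (Cfin x) = Cfin y" using False by (simp add: act_def jfac_def y_def)
  have "?j * z + - of_real (m11 \<gamma> * x + m12 \<gamma>) = ?j * (1 * z + - of_real y)" for z
    using False by (simp add: y_def right_diff_distrib)
  then have "cusp_int (\<lambda>z. E z * (?j * z + - of_real (m11 \<gamma> * x + m12 \<gamma>)) ^ (k - 2)) (act g Cinf) =
      cusp_int (\<lambda>z. ?j ^ (k - 2) * (E z * (1 * z + - of_real y) ^ (k - 2))) (act g Cinf)"
    by (simp only: power_mult_distrib mult.left_commute)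
  then show ?thesis by (simp only: slashP_def act cusp.case phi_def cusp_int_cmult)
qed

text \<open>The factor \<open>j(\<gamma>, x)\<^sup>k\<^sup>-\<^sup>2\<close> of the slash action turns \<open>(z - \<gamma> x)\<^sup>k\<^sup>-\<^sup>2\<close> into a form that
  pulls back to \<open>(z - x)\<^sup>k\<^sup>-\<^sup>2\<close> and makes sense even if \<open>\<gamma> x = \<infinity>\<close>.\<close>
lemma cusp_int_slash_transform:
  assumes "k \<ge> 2" and \<gamma>: "mdet \<gamma> = 1"
    and "E holomorphic_on uhp" "E' holomorphic_on uhp"
    and "\<And>z. Im z > 0 \<Longrightarrow> E (mob \<gamma> z) = c * mj \<gamma> z ^ k * E' z"
    and "cusp_good E k Cinf" "cusp_good E k (act \<gamma> p)"
      "cusp_good E' k Cinf" "cusp_good E' k p" "cusp_good E' k (act (minv \<gamma>) Cinf)"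
  shows "cusp_int (\<lambda>z. E z * (of_real (jfac \<gamma> x) * z + - of_real (m11 \<gamma> * x + m12 \<gamma>)) ^ (k - 2)) (act \<gamma> p) =
    c * (cusp_int (\<lambda>z. E' z * (1 * z + - of_real x) ^ (k - 2)) p -
         cusp_int (\<lambda>z. E' z * (1 * z + - of_real x) ^ (k - 2)) (act (minv \<gamma>) Cinf))"
proof (rule cusp_int_transform[OF assms])
  have "jfac \<gamma> x * m11 \<gamma> + - (m11 \<gamma> * x + m12 \<gamma>) * m21 \<gamma> = mdet \<gamma>"
    by (simp add: jfac_def mdet_def algebra_simps)
  from arg_cong[OF this[unfolded \<gamma>], of complex_of_real]
  show "1 = complex_of_real (jfac \<gamma> x) * of_real (m11 \<gamma>) + - of_real (m11 \<gamma> * x + m12 \<gamma>) * of_real (m21 \<gamma>)"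
    by (simp only: of_real_add of_real_mult of_real_minus of_real_1)
  have "jfac \<gamma> x * m12 \<gamma> + - (m11 \<gamma> * x + m12 \<gamma>) * m22 \<gamma> = - (x * mdet \<gamma>)"
    by (simp add: jfac_def mdet_def algebra_simps)
  from arg_cong[OF this[unfolded \<gamma> mult_1_right], of complex_of_real]
  show "- complex_of_real x = complex_of_real (jfac \<gamma> x) * of_real (m12 \<gamma>) + - of_real (m11 \<gamma> * x + m12 \<gamma>) * of_real (m22 \<gamma>)"
    by (simp only: of_real_add of_real_mult of_real_minus)
qed

lemma minv_mk: "minv (mk a b c d) = mk d (- b) (- c) a"
  by (simp add: minv_def mk_def)

text \<open>a is inverse to d modulo N, and complex conjugation inverts character values on
  units.\<close>

lemma psi_swap:
  assumes "dchar q1 ch1" "dchar q2 ch2" and ad: "[a * d = 1] (mod int (q1 * q2))"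
  shows "psi ch2 ch1 a = psi ch1 ch2 d"
proof -
  have *: "cnj (ch a) = ch d" "cnj (ch d) = ch a" if ch: "dchar q ch" and q: "q dvd q1 * q2" for ch q
  proof -
    have "[a * d = 1] (mod int q)" using ad q by (meson cong_dvd_modulus of_nat_dvd_iff)
    then have e: "ch a * ch d = 1" using dchar_cong[OF ch] dchar_mult[OF ch] dchar_1[OF ch] by metis
    then have "ch a \<noteq> 0" "ch d \<noteq> 0" by auto
    then have "cnj (ch a) * ch a = 1" "cnj (ch d) * ch d = 1"
      using dchar_cnj_mult[OF ch] dchar_nonzero_iff[OF ch] by blast+
    then show "cnj (ch a) = ch d" "cnj (ch d) = ch a"
      using e \<open>ch a \<noteq> 0\<close> \<open>ch d \<noteq> 0\<close> by (metis mult.commute mult_right_cancel)+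
  qed
  show ?thesis using *(1)[OF assms(1)] *(2)[OF assms(2)] by (simp add: psi_def mult.commute)
qed

section \<open>Decay at the cusps of C, and the final identity\<close>

context eis_pair
begin

text \<open>Both series are bundled because \<omega> exchanges them: decay of one at \<omega> p
  comes from decay of the other at p.\<close>

definition eis_cusp_good :: "cusp \<Rightarrow> bool" where
  "eis_cusp_good p \<longleftrightarrow> cusp_good (eis ch1 ch2 k) k p \<and> cusp_good (eis ch2 ch1 k) k p"

lemma eis_cusp_good_Cinf: "eis_cusp_good Cinf"
  unfolding eis_cusp_good_def
  using eis_cusp_decay eis_pair.eis_cusp_decay[OF swap] by (blast intro: cusp_good_Cinf)

lemma eis_Gamma0_swapped:
  assumes "a * d - b * (c * int (q1 * q2)) = 1" "Im z > 0"
  shows "eis ch2 ch1 k (mob (mk a b (c * int (q1 * q2)) d) z) =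
    psi ch2 ch1 d * mj (mk a b (c * int (q1 * q2)) d) z ^ k * eis ch2 ch1 k z"
  using eis_pair.eis_Gamma0[OF swap, of a d b c z] assms by (simp only: mult.commute[of q2 q1])

lemma eis_omega_swapped:
  assumes "Im z > 0"
  shows "eis ch2 ch1 k (mob (omega (q1 * q2)) z) =
    Rconst ch2 ch1 q2 q1 k * mj (omega (q1 * q2)) z ^ k * eis ch1 ch2 k z"
  using eis_pair.eis_omega[OF swap assms] by (simp only: mult.commute[of q2 q1])

lemma mdet_Gamma0: "a * d - b * (c * int (q1 * q2)) = 1 \<Longrightarrow> mdet (mk a b (c * int (q1 * q2)) d) = 1"
  by (simp only: mdet_mk of_int_1)

lemma mdet_omega_N: "mdet (omega (q1 * q2)) = 1"
  using q1 q2 by (intro mdet_omega) simp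

lemma eis_cusp_good_Gamma0:
  assumes "eis_cusp_good p" and det: "a * d - b * (c * int (q1 * q2)) = 1"
  shows "eis_cusp_good (act (mk a b (c * int (q1 * q2)) d) p)"
  unfolding eis_cusp_good_def
proof
  show "cusp_good (eis ch1 ch2 k) k (act (mk a b (c * int (q1 * q2)) d) p)"
    by (rule cusp_good_transfer[where E' = "eis ch1 ch2 k", OF _ mdet_Gamma0[OF det] eis_Gamma0[OF det]])
      (use assms in \<open>simp_all add: eis_cusp_good_def\<close>)
  show "cusp_good (eis ch2 ch1 k) k (act (mk a b (c * int (q1 * q2)) d) p)"
    by (rule cusp_good_transfer[where E' = "eis ch2 ch1 k", OF _ mdet_Gamma0[OF det] eis_Gamma0_swapped[OF det]])
      (use assms in \<open>simp_all add: eis_cusp_good_def\<close>)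
qed

lemma eis_cusp_good_omega:
  assumes "eis_cusp_good p"
  shows "eis_cusp_good (act (omega (q1 * q2)) p)"
  unfolding eis_cusp_good_def
proof
  show "cusp_good (eis ch1 ch2 k) k (act (omega (q1 * q2)) p)"
    by (rule cusp_good_transfer[where E' = "eis ch2 ch1 k", OF _ mdet_omega_N eis_omega])
      (use assms in \<open>simp_all add: eis_cusp_good_def\<close>)
  show "cusp_good (eis ch2 ch1 k) k (act (omega (q1 * q2)) p)"
    by (rule cusp_good_transfer[where E' = "eis ch1 ch2 k", OF _ mdet_omega_N eis_omega_swapped])
      (use assms in \<open>simp_all add: eis_cusp_good_def\<close>)
qed

lemma eis_cusp_good_Gamma0_Cinf:
  assumes "g \<in> Gamma0 (q1 * q2)"
  shows "eis_cusp_good (act g Cinf)" "mdet g = 1"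
proof -
  obtain a b c d where g: "g = mk a b (c * int (q1 * q2)) d" "a * d - b * (c * int (q1 * q2)) = 1"
    using assms unfolding Gamma0_def by (auto simp only: mem_Collect_eq mult.commute[of "int (q1 * q2)"])
  show "eis_cusp_good (act g Cinf)" unfolding g(1) by (rule eis_cusp_good_Gamma0[OF eis_cusp_good_Cinf g(2)])
  show "mdet g = 1" unfolding g(1) by (rule mdet_Gamma0[OF g(2)])
qed

lemma eis_cusp_good_cusps:
  assumes "p \<in> cusps (q1 * q2)"
  shows "eis_cusp_good p"
proof -
  obtain g where g: "p = act g Cinf"
    "g \<in> Gamma0 (q1 * q2) \<or> (\<exists>h\<in>Gamma0 (q1 * q2). g = mmul (omega (q1 * q2)) h)"
    using assms by (auto simp only: cusps_def mem_Collect_eq)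
  from g(2) show ?thesis
  proof
    assume "g \<in> Gamma0 (q1 * q2)"
    then show ?thesis unfolding g(1) by (rule eis_cusp_good_Gamma0_Cinf)
  next
    assume "\<exists>h\<in>Gamma0 (q1 * q2). g = mmul (omega (q1 * q2)) h"
    then obtain h where h: "h \<in> Gamma0 (q1 * q2)" "g = mmul (omega (q1 * q2)) h" by blast
    show ?thesis unfolding g(1) h(2) act_mmul_Cinf[OF mdet_omega_N eis_cusp_good_Gamma0_Cinf(2)[OF h(1)]]
      by (rule eis_cusp_good_omega[OF eis_cusp_good_Gamma0_Cinf(1)[OF h(1)]])
  qed
qed

text \<open>The Gauss sums of the conjugate characters are replaced by constants t1 and t2, since
  they only scale S12 and S21. The matrices are variables with defining equations, so that their
  entries are unfolded only where they matter.\<close>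

lemma reciprocity:
  assumes det: "a * d - b * (c * int (q1 * q2)) = 1" and x: "Cfin x \<in> cusps (q1 * q2)"
    and \<gamma>_def: "\<gamma> = mk a b (c * int (q1 * q2)) d"
    and \<gamma>'_def: "\<gamma>' = mk d (- c) (- b * int (q1 * q2)) a"
    and \<omega>_def: "\<omega> = omega (q1 * q2)"
    and t2: "t2 \<noteq> 0" and C: "C = (-1) ^ k * t1 * of_nat (k - 1)"
    and R: "R = Rconst ch1 ch2 q1 q2 k"
  defines "E12 \<equiv> eis ch1 ch2 k" and "E21 \<equiv> eis ch2 ch1 k"
  defines "S12 \<equiv> S_hat E12 t1 k" and "S21 \<equiv> S_hat E21 t2 k"
  shows "slash k \<gamma>' S12 x - psi ch1 ch2 a * S12 (Cfin x)
        + C * (psi ch1 ch2 a * phi E12 k (minv \<gamma>') 1 (- complex_of_real x)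
          - psi ch1 ch2 d * slashP k \<omega> (phi E12 k (minv \<gamma>)) x)
      = R * (t1 / t2) * (slash k \<gamma>' S21 x - S21 (Cfin x))
        + C * R * (phi E21 k (minv \<omega>) 1 (- complex_of_real x) - slashP k \<gamma>' (phi E21 k (minv \<omega>)) x)
        + (1 - psi ch1 ch2 d) * slash k \<omega> S12 x"
proof -
  have det': "d * a - (- c) * (- b * int (q1 * q2)) = 1" using det by (simp add: algebra_simps)
  have m: "mdet \<gamma> = 1" "mdet \<gamma>' = 1" "mdet \<omega> = 1"
    unfolding \<gamma>_def \<gamma>'_def \<omega>_def by (rule mdet_Gamma0[OF det] mdet_Gamma0[OF det'] mdet_omega_N)+
  have hol: "E12 holomorphic_on uhp" "E21 holomorphic_on uhp"
    unfolding E12_def E21_def by (rule eis_holomorphic eis_pair.eis_holomorphic[OF swap])+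
  have tr12: "E12 (mob \<gamma>' z) = psi ch1 ch2 a * mj \<gamma>' z ^ k * E12 z"
    and tr21: "E21 (mob \<gamma>' z) = psi ch2 ch1 a * mj \<gamma>' z ^ k * E21 z"
    and tr\<omega>: "E12 (mob \<omega> z) = R * mj \<omega> z ^ k * E21 z" if "Im z > 0" for z
    unfolding E12_def E21_def \<gamma>'_def \<omega>_def R
    using that by (rule eis_Gamma0[OF det'] eis_Gamma0_swapped[OF det'] eis_omega)+
  have psi: "psi ch2 ch1 a = psi ch1 ch2 d"
  proof (rule psi_swap[OF d1 d2])
    have "a * d - 1 = int (q1 * q2) * (b * c)" using det by (simp add: algebra_simps)
    then show "[a * d = 1] (mod int (q1 * q2))" by (metis cong_iff_dvd_diff dvd_triv_left)
  qed
  \<comment> \<open>The cusp at which the two \<Phi> terms meet: \<gamma>' p = \<omega>^-1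
    \<infinity> and \<omega> p = \<gamma>^-1 \<infinity>, so each of them brings in J21(p) with
    coefficient -C R \<psi>(\<gamma>).\<close>
  define p where "p = act (minv \<gamma>') (act (minv \<omega>) Cinf)"
  have good_inf: "eis_cusp_good Cinf" by (rule eis_cusp_good_Cinf)
  have good_x: "eis_cusp_good (Cfin x)" by (rule eis_cusp_good_cusps[OF x])
  have good_\<gamma>': "eis_cusp_good (act \<gamma>' r)" if "eis_cusp_good r" for r
    unfolding \<gamma>'_def by (rule eis_cusp_good_Gamma0[OF that det'])
  have good_\<omega>: "eis_cusp_good (act \<omega> r)" if "eis_cusp_good r" for r
    unfolding \<omega>_def by (rule eis_cusp_good_omega[OF that])
  have good_inv: "eis_cusp_good (act (minv \<gamma>') r)" if "eis_cusp_good r" for r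
  proof -
    have "minv \<gamma>' = mk a c (b * int (q1 * q2)) d" by (simp add: \<gamma>'_def minv_mk)
    moreover have "a * d - c * (b * int (q1 * q2)) = 1" using det by (simp add: algebra_simps)
    ultimately show ?thesis using eis_cusp_good_Gamma0[OF that] by metis
  qed
  \<comment> \<open>Both sides are the cusp 0; as matrices, \<omega>^-1 = -\<omega>.\<close>
  have "act (minv \<omega>) Cinf = act \<omega> Cinf" by (simp add: act_def \<omega>_def)
  then have good_\<omega>inv: "eis_cusp_good (act (minv \<omega>) Cinf)" using good_\<omega>[OF good_inf] by simp
  have good_p: "eis_cusp_good p" unfolding p_def by (rule good_inv[OF good_\<omega>inv])
  have p\<gamma>': "act \<gamma>' p = act (minv \<omega>) Cinf"
    unfolding p_def using m by (simp add: act_mmul_Cinf[symmetric] mdet_mmul mmul_minv_cancel)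
  have p\<omega>: "act \<omega> p = act (minv \<gamma>) Cinf"
  proof -
    \<comment> \<open>This is \<gamma> \<omega> = \<omega> \<gamma>' in the form \<omega>
      \<gamma>'^-1 \<omega>^-1 = \<gamma>^-1, checked on the entries.\<close>
    have "mmul \<omega> (mmul (minv \<gamma>') (minv \<omega>)) = minv \<gamma>"
      by (rule m2.equality) (use q1 q2 in \<open>auto simp: \<omega>_def \<gamma>_def \<gamma>'_def field_simps\<close>)
    then show ?thesis unfolding p_def using m by (simp add: act_mmul_Cinf[symmetric] mdet_mmul)
  qed
  define J12 where "J12 r = cusp_int (\<lambda>z. E12 z * (1 * z + - complex_of_real x) ^ (k - 2)) r" for r
  define J21 where "J21 r = cusp_int (\<lambda>z. E21 z * (1 * z + - complex_of_real x) ^ (k - 2)) r" for r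
  note good = good_inf good_x good_\<gamma>' good_\<omega> good_inv good_\<omega>inv good_p
  have g12: "cusp_good E12 k r" and g21: "cusp_good E21 k r" if "eis_cusp_good r" for r
    using that by (simp_all add: eis_cusp_good_def E12_def E21_def)
  define K where "K = (-1) ^ k * (of_nat (k - 1) :: complex)"
  have CK: "C = K * t1" by (simp add: C K_def)
  have S12: "S12 (Cfin x) = C * J12 (Cfin x)" and S21: "S21 (Cfin x) = K * t2 * J21 (Cfin x)"
    by (simp_all add: S12_def S21_def S_hat_def C K_def J12_def J21_def)
  have phi: "phi E12 k (minv \<gamma>') 1 (- of_real x) = J12 (act (minv \<gamma>') Cinf)"
    "phi E21 k (minv \<omega>) 1 (- of_real x) = J21 (act (minv \<omega>) Cinf)"
    by (simp_all add: phi_def J12_def J21_def)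
  have S12\<gamma>': "slash k \<gamma>' S12 x = C * (psi ch1 ch2 a * (J12 (Cfin x) - J12 (act (minv \<gamma>') Cinf)))"
    unfolding S12_def slash_S_hat C J12_def
    by (subst cusp_int_slash_transform[OF k m(2) hol(1) hol(1) tr12]) (simp_all only: g12 good)
  have S12\<omega>: "slash k \<omega> S12 x = C * (R * (J21 (Cfin x) - J21 (act (minv \<omega>) Cinf)))"
    unfolding S12_def slash_S_hat C J21_def
    by (subst cusp_int_slash_transform[OF k m(3) hol(1) hol(2) tr\<omega>]) (simp_all only: g12 g21 good)
  have S21\<gamma>': "slash k \<gamma>' S21 x = K * t2 * (psi ch1 ch2 d * (J21 (Cfin x) - J21 (act (minv \<gamma>') Cinf)))"
    unfolding S21_def slash_S_hat K_def J21_def psi[symmetric]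
    by (subst cusp_int_slash_transform[OF k m(2) hol(2) hol(2) tr21]) (simp_all add: g21 good)
  have P\<omega>: "slashP k \<omega> (phi E12 k (minv \<gamma>)) x = R * (J21 p - J21 (act (minv \<omega>) Cinf))"
    unfolding slashP_phi p\<omega>[symmetric] J21_def
    by (rule cusp_int_slash_transform[OF k m(3) hol(1) hol(2) tr\<omega>]) (simp_all only: g12 g21 good)
  have P\<gamma>': "slashP k \<gamma>' (phi E21 k (minv \<omega>)) x = psi ch1 ch2 d * (J21 p - J21 (act (minv \<gamma>') Cinf))"
    unfolding slashP_phi p\<gamma>'[symmetric] J21_def psi[symmetric]
    by (rule cusp_int_slash_transform[OF k m(2) hol(2) hol(2) tr21]) (simp_all only: g21 good)
  \<comment> \<open>S21 has the prefactor K t2, which the quotient t1/t2 converts into C = K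
    t1.\<close>
  have RK: "R * (t1 / t2) * (K * t2 * u - K * t2 * v) = R * C * (u - v)" for u v
    using t2 by (simp add: CK field_simps)
  \<comment> \<open>On the left all J12 terms cancel; both sides reduce to C R \<psi>(\<gamma>)
    (J21(\<omega>^-1 \<infinity>) - J21(p)).\<close>
  show ?thesis
    unfolding S12\<gamma>' S12\<omega> S21\<gamma>' P\<omega> P\<gamma>' S12 S21 phi RK by (simp add: algebra_simps)
qed

end

theorem theorem1p19:
  fixes k q1 q2 :: nat and ch1 ch2 :: "int \<Rightarrow> complex" and a b c d :: int and x :: real
  assumes "k \<ge> 2"
    and "primitive_dchar q1 ch1" and "nontrivial_dchar q1 ch1"
    and "primitive_dchar q2 ch2" and "nontrivial_dchar q2 ch2"
    and "ch1 (-1) * ch2 (-1) = (-1) ^ k"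
    and "a * d - b * (c * int (q1 * q2)) = 1"
    and "Cfin x \<in> cusps (q1 * q2)"
  shows
   "(let N = q1 * q2;
         \<gamma> = mk a b (c * int N) d;
         \<gamma>' = mk d (- c) (- b * int N) a;
         \<omega> = omega N;
         E12 = eis ch1 ch2 k; E21 = eis ch2 ch1 k;
         t1 = gauss q1 (cchar ch1); t2 = gauss q2 (cchar ch2);
         S12 = S_hat E12 t1 k; S21 = S_hat E21 t2 k;
         C = (-1) ^ k * t1 * of_nat (k - 1);
         R = Rconst ch1 ch2 q1 q2 k;
         \<psi>\<gamma> = psi ch1 ch2 d; \<psi>\<gamma>' = psi ch1 ch2 a;
         \<Phi>1 = phi E12 k (minv \<gamma>); \<Phi>2 = phi E21 k (minv \<omega>)
     in slash k \<gamma>' S12 x - \<psi>\<gamma>' * S12 (Cfin x)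
        + C * (\<psi>\<gamma>' * phi E12 k (minv \<gamma>') 1 (- complex_of_real x) - \<psi>\<gamma> * slashP k \<omega> \<Phi>1 x)
      = R * (t1 / t2) * (slash k \<gamma>' S21 x - S21 (Cfin x))
        + C * R * (phi E21 k (minv \<omega>) 1 (- complex_of_real x) - slashP k \<gamma>' \<Phi>2 x)
        + (1 - \<psi>\<gamma>) * slash k \<omega> S12 x)"
proof -
  interpret eis_pair q1 q2 k ch1 ch2
    using assms(1-6) by unfold_locales
  have "gauss q2 (cchar ch2) \<noteq> 0" by (rule gauss_nonzero[OF primitive_cchar[OF assms(4)]])
  from reciprocity[OF assms(7,8) refl refl refl this refl refl]
  show ?thesis unfolding Let_def .
qed

end
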